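(* Let $\gamma>0$ be a constant, let $p\in[1-n^{-\gamma},1]$ and $k\in\mathbb{N}$ be functions of $n$ with $k<\exp(n^{o(1)})$, and let $\mathbf{G}\sim\mathcal{G}(n,p,k)$. Then asymptotically almost surely, every $\mathrm{Res}(\oplus)$ refutation of $\mathrm{BinClique}(\mathbf{G},k)$ of depth $D$ and size $S$ satisfies $$D\sqrt{\log S}\ \ge\ \begin{cases}\Omega(n^{3\gamma/2}) & \text{if }\gamma<1/2,\\[2pt] \Omega\!\left(\dfrac{n^{(1+\gamma)/2}}{\sqrt{\log kn}}\right) & \text{if }1/2\le\gamma<1,\\[4pt] \Omega(n^{1-\varepsilon}) & \text{if }\gamma\ge1,\end{cases}$$ the last case holding for every constant $\varepsilon>0$.
   Context: $\mathcal{G}(n,p,k)$: graph on $V=V_1\sqcup\dots\sqcup V_k$, $|V_i|=n$, in which each pair of vertices in different blocks is an edge independently with probability $p$ and there are no edges within blocks. For a Boolean variable $x$, $(x\neq0)$ denotes $x$ and $(x\neq1)$ denotes $\overline{x}$. For a graph $G$ with vertex set $V$, each vertex identified with its binary representation in $\{0,1\}^{\log|V|}$, the CNF $\mathrm{BinClique}(G,k)$ has variables $x_{i,a}$, $i\in[k]$, $a\in[\log|V|]$, and clauses: for all $i\neq j\in[k]$ and all $v_i\neq v_j\in V$ with $\{v_i,v_j\}\notin E$, the clause $\bigvee_{a}(x_{i,a}\neq v_{i,a})\vee\bigvee_a(x_{j,a}\neq v_{j,a})$; and for all $v\in V$ and $i\neq j\in[k]$, the clause $\bigvee_a(x_{i,a}\neq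 v_a)\vee\bigvee_a(x_{j,a}\neq v_a)$. $\mathrm{Res}(\oplus)$: lines are linear clauses, i.e. disjunctions of equations $f=a$ with $f$ a linear form over $\mathbb{F}_2$ and $a\in\mathbb{F}_2$ (a propositional clause is a linear clause via $x\mapsto (x=1)$, $\overline x\mapsto(x=0)$). A refutation of a CNF $F$ is a sequence of linear clauses ending in the empty clause, each being a clause of $F$ or derived from earlier ones by the resolution rule (from $C\vee(f=1)$ and $D\vee(f=0)$ derive $C\vee D$) or by semantic weakening (from $C$ derive any linear clause $D$ satisfied by every $0/1$ assignment satisfying $C$). Its size is the number of linear clauses; its depth is the maximum number of resolution steps on a path from axioms to the empty clause. "Asymptotically almost surely": with probability $1-o(1)$ as $n\to\infty$. *)

theory Defs
  imports "HOL-Analysis.Analysis"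
begin

text \<open>A linear equation  f = a  over F_2 is represented by the pair (S, a), where the
  linear form f is the sum of the variables in the finite set S, and a :: bool
  (True = 1, False = 0).  A linear clause is a finite set of linear equations,
  read as their disjunction; the empty clause is the empty set.\<close>

type_synonym 'v lin_eq = "'v set \<times> bool"
type_synonym 'v lin_clause = "'v lin_eq set"

definition sat_eq :: "('v \<Rightarrow> bool) \<Rightarrow> 'v lin_eq \<Rightarrow> bool" where
  "sat_eq \<alpha> e = (odd (card {x \<in> fst e. \<alpha> x}) = snd e)"

definition sat_clause :: "('v \<Rightarrow> bool) \<Rightarrow> 'v lin_clause \<Rightarrow> bool" where
  "sat_clause \<alpha> C = (\<exists>e\<in>C. sat_eq \<alpha> e)"

definition wf_clause :: "'v set \<Rightarrow> 'v lin_clause \<Rightarrow> bool" where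
  "wf_clause X C = (finite C \<and> (\<forall>e\<in>C. finite (fst e) \<and> fst e \<subseteq> X))"

definition lit_neq :: "'v \<Rightarrow> bool \<Rightarrow> 'v lin_eq" where
  "lit_neq x b = ({x}, \<not> b)"

datatype 'v step =
    Ax "'v lin_clause"
  | Res nat nat "'v lin_clause"
  | Weak nat "'v lin_clause"

fun line :: "'v step \<Rightarrow> 'v lin_clause" where
  "line (Ax C) = C"
| "line (Res i j C) = C"
| "line (Weak i C) = C"

fun valid_step :: "'v lin_clause set \<Rightarrow> 'v step list \<Rightarrow> nat \<Rightarrow> 'v step \<Rightarrow> bool" where
  "valid_step F P n (Ax C) = (C \<in> F)"
| "valid_step F P n (Res i j C) =
     (i < n \<and> j < n \<and>
      (\<exists>f. (f, True) \<in> line (P ! i) \<and> (f, False) \<in> line (P ! j) \<and>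
           C = (line (P ! i) - {(f, True)}) \<union> (line (P ! j) - {(f, False)})))"
| "valid_step F P n (Weak i C) =
     (i < n \<and> (\<forall>\<alpha>. sat_clause \<alpha> (line (P ! i)) \<longrightarrow> sat_clause \<alpha> C))"

definition is_refutation :: "'v set \<Rightarrow> 'v lin_clause set \<Rightarrow> 'v step list \<Rightarrow> bool" where
  "is_refutation X F P =
     (P \<noteq> [] \<and>
      (\<forall>n < length P. wf_clause X (line (P ! n)) \<and> valid_step F P n (P ! n)) \<and>
      line (last P) = {})"

definition proof_size :: "'v step list \<Rightarrow> nat" where
  "proof_size P = length P"

fun step_depth :: "nat list \<Rightarrow> 'v step \<Rightarrow> nat" where
  "step_depth ds (Ax C) = 0"
| "step_depth ds (Res i j C) = Suc (max (ds ! i) (ds ! j))"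
| "step_depth ds (Weak i C) = ds ! i"

definition depths :: "'v step list \<Rightarrow> nat list" where
  "depths P = foldl (\<lambda>ds s. ds @ [step_depth ds s]) [] P"

definition proof_depth :: "'v step list \<Rightarrow> nat" where
  "proof_depth P = last (depths P)"

text \<open>Vertices of G(n,p,k) are 0..<k*n; vertex v lies in block v div n.  Each vertex
  is identified with its binary representation with L = ceil(log2 |V|) bits;
  bit a of v is odd (v div 2^a).  Variables x_{i,a} are pairs (i,a).\<close>

definition nbits :: "nat \<Rightarrow> nat" where
  "nbits N = nat \<lceil>log 2 (real N)\<rceil>"

definition vbit :: "nat \<Rightarrow> nat \<Rightarrow> bool" where
  "vbit v a = odd (v div 2 ^ a)"

definition bc_vars :: "nat \<Rightarrow> nat \<Rightarrow> (nat \<times> nat) set" where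
  "bc_vars N k = {(i, a). i < k \<and> a < nbits N}"

definition neq_block :: "nat \<Rightarrow> nat \<Rightarrow> nat \<Rightarrow> (nat \<times> nat) lin_clause" where
  "neq_block N i v = {lit_neq (i, a) (vbit v a) | a. a < nbits N}"

definition BinClique :: "nat \<Rightarrow> nat set set \<Rightarrow> nat \<Rightarrow> (nat \<times> nat) lin_clause set" where
  "BinClique N E k =
     {neq_block N i u \<union> neq_block N j v | i j u v.
        i < k \<and> j < k \<and> i \<noteq> j \<and> u < N \<and> v < N \<and> u \<noteq> v \<and> {u, v} \<notin> E}
   \<union> {neq_block N i v \<union> neq_block N j v | i j v. i < k \<and> j < k \<and> i \<noteq> j \<and> v < N}"

definition cross_pairs :: "nat \<Rightarrow> nat \<Rightarrow> nat set set" where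
  "cross_pairs n k = {{u, v} | u v. u < k * n \<and> v < k * n \<and> u div n \<noteq> v div n}"

definition prob_G :: "nat \<Rightarrow> real \<Rightarrow> nat \<Rightarrow> (nat set set \<Rightarrow> bool) \<Rightarrow> real" where
  "prob_G n p k Q =
     (\<Sum>E \<in> Pow (cross_pairs n k).
        (if Q E then p ^ card E * (1 - p) ^ (card (cross_pairs n k) - card E) else 0))"

definition aas :: "(nat \<Rightarrow> real) \<Rightarrow> (nat \<Rightarrow> nat) \<Rightarrow> (nat \<Rightarrow> nat set set \<Rightarrow> bool) \<Rightarrow> bool" where
  "aas p k Q = ((\<lambda>n. prob_G n (p n) (k n) (Q n)) \<longlonglongrightarrow> 1)"

definition all_refs_bound :: "nat \<Rightarrow> nat \<Rightarrow> nat set set \<Rightarrow> real \<Rightarrow> bool" where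
  "all_refs_bound n k E b =
     (\<forall>P. is_refutation (bc_vars (k * n) k) (BinClique (k * n) E k) P \<longrightarrow>
          real (proof_depth P) * sqrt (log 2 (real (proof_size P))) \<ge> b)"

end

theory Submission
  imports Defs "HOL-Real_Asymp.Real_Asymp" "HOL-Computational_Algebra.Primes"
begin

text \<open>If kn is not a power of 2, then a binary string that encodes no vertex gives a satisfying assignment.
  Otherwise restrict x_i to block i, so that it carries log n free bits. Asymptotically almost surely every
  vertex has at most \<open>\<delta> n\<close> non-neighbours in each other block, where \<open>\<delta>\<close> is
  four times \<open>n powr (-\<gamma>)\<close>; take \<open>\<gamma>\<close> to be 2/3 if it is at least 1.

  A refutation is descended from the empty clause through falsified lines. The state fixes a set W of blocks
  to at most two vertices each, any choice of which is a clique, as affine functions of the other blocks. A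
  query of a non-constant form is answered by a random vertex u of a block on which the form
  depends: the block is restricted to u and the vertex that differs from u in one bit of the form. With
  \<open>\<delta> (|W| + d)\<close> small, d steps succeed with probability at least
  \<open>exp (- O(\<delta> d\<^sup>2))\<close> no matter how large W was at the start. Some line of the
  refutation is thus reached with probability \<open>exp (- O(\<delta> d\<^sup>2)) / S\<close>, and so the linear
  system falsifying it has no independent transversal (one bit in each of m blocks) with m larger than
  \<open>O(log S + \<delta> d\<^sup>2)\<close>. By Rado's theorem the state can be replaced by one that has only m more
  blocks than the initial one and still falsifies the line. With d of order \<open>sqrt (log S / \<delta>)\<close> this can
  be repeated about \<open>1 / (\<delta> log S)\<close> times, and the depth is at least d times that.\<close>

section \<open>Rado's theorem\<close>

text \<open>The obstacle is the number of fixed blocks, which grows to order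
  \<open>1 / \<delta>\<close>. Then a constant fraction of the values of a queried block has no
  admissible partner, and counting these as failures would cost a constant factor per step. So such
  a value is accepted as well: its block is fixed, the query is repeated in the smaller state, and
  only the drift matters. Genuine failures are measured against the common neighbours of the blocks
  fixed when the phase began; after \<open>t\<close> new blocks their fraction is
  \<open>O(\<delta> t)\<close>, which over \<open>O(d)\<close> steps adds up to the exponent
  \<open>O(\<delta> d\<^sup>2)\<close>. Pairs differing in one bit keep every restriction affine, so
  the falsity of a line stays a linear system and matroid theory applies: Rado's theorem yields a
  few blocks that carry all constraints which fresh pairs cannot solve. Up to constants,
  \<open>d\<close> times the number of phases is \<open>\<delta> powr (-3/2) / sqrt (log S)\<close>,
  the source of the exponent \<open>3 * \<gamma> / 2\<close>.\<close>

locale exchange_closure =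
  fixes cl :: "'a set \<Rightarrow> 'a set"
  assumes ext: "X \<subseteq> cl X"
    and mono: "X \<subseteq> Y \<Longrightarrow> cl X \<subseteq> cl Y"
    and idem: "cl (cl X) \<subseteq> cl X"
    and exch: "e \<in> cl (insert a X) \<Longrightarrow> e \<notin> cl X \<Longrightarrow> a \<in> cl (insert e X)"
begin

definition indep :: "'a set \<Rightarrow> bool" where
  "indep A \<longleftrightarrow> (\<forall>a\<in>A. a \<notin> cl (A - {a}))"

lemma cl_least: "X \<subseteq> cl Y \<Longrightarrow> cl X \<subseteq> cl Y"
  using mono idem by blast

lemma indep_insert:
  assumes "indep A" "e \<notin> cl A"
  shows "indep (insert e A)"
  unfolding indep_def
proof
  fix a assume a: "a \<in> insert e A"
  show "a \<notin> cl (insert e A - {a})"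
  proof (cases "a = e")
    case True
    then have "insert e A - {a} \<subseteq> A" by auto
    then show ?thesis using True assms(2) mono by blast
  next
    case False
    then have "a \<in> A" using a by simp
    then have na: "a \<notin> cl (A - {a})" using assms(1) by (simp add: indep_def)
    show ?thesis
    proof
      assume "a \<in> cl (insert e A - {a})"
      moreover have "insert e A - {a} = insert e (A - {a})" using False by auto
      ultimately have "e \<in> cl (insert a (A - {a}))" using exch na by metis
      then show False using assms(2) \<open>a \<in> A\<close> by (simp add: insert_absorb)
    qed
  qed
qed

lemma indep_swap:
  assumes "indep A" "j \<in> A" "e \<notin> cl (A - {j})"
  shows "indep (insert e (A - {j}))"
proof (rule indep_insert)
  show "indep (A - {j})"
    unfolding indep_def
  proof
    fix a assume "a \<in> A - {j}"
    then have "a \<notin> cl (A - {a})" using assms(1) by (simp add: indep_def)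
    moreover have "cl (A - {j} - {a}) \<subseteq> cl (A - {a})" by (rule mono) auto
    ultimately show "a \<notin> cl (A - {j} - {a})" by blast
  qed
qed (use assms in auto)

lemma cl_remove:
  assumes "indep A" "e \<in> cl A" "finite Q" "Q \<subseteq> A" "\<forall>j\<in>Q. e \<in> cl (A - {j})"
  shows "e \<in> cl (A - Q)"
  using assms(3,4,5)
proof (induction Q rule: finite_induct)
  case empty
  then show ?case using assms(2) by simp
next
  case (insert j Q)
  then have IH: "e \<in> cl (A - Q)" and j: "j \<in> A" "e \<in> cl (A - {j})" by auto
  have eq: "insert j (A - insert j Q) = A - Q" using insert.hyps j by auto
  show ?case
  proof (rule ccontr)
    assume "e \<notin> cl (A - insert j Q)"
    then have "j \<in> cl (insert e (A - insert j Q))" using exch[of e j "A - insert j Q"] IH eq by simp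
    moreover have "insert e (A - insert j Q) \<subseteq> cl (A - {j})"
      using j(2) ext[of "A - {j}"] by auto
    ultimately have "j \<in> cl (A - {j})" using cl_least by blast
    then show False using assms(1) j(1) by (simp add: indep_def)
  qed
qed

text \<open>The new element comes from a block that \<open>A\<close> misses, so an independent
  transversal stays one, of the same size, while the block of \<open>j\<close> becomes free.\<close>

definition swap :: "'a set \<Rightarrow> ('a \<Rightarrow> 'b) \<Rightarrow> 'a set \<Rightarrow> 'a set \<Rightarrow> bool" where
  "swap V f A A' \<longleftrightarrow> (\<exists>e\<in>V. \<exists>j\<in>A. f e \<notin> f ` A \<and> e \<notin> cl (A - {j}) \<and> A' = insert e (A - {j}))"

text \<open>T consists of the blocks hit by every transversal that is reachable by exchanges from one of
  maximum size; exchanges do not change the span of the part outside T.\<close>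

theorem rado:
  fixes f :: "'a \<Rightarrow> 'b"
  assumes V: "finite V"
  obtains A T where "A \<subseteq> V" "indep A" "inj_on f A" "T \<subseteq> f ` A"
    "\<And>e. e \<in> V \<Longrightarrow> f e \<notin> T \<Longrightarrow> e \<in> cl {a \<in> A. f a \<notin> T}"
proof -
  define tr where "tr A \<longleftrightarrow> A \<subseteq> V \<and> indep A \<and> inj_on f A" for A
  have t0: "tr {}" by (simp add: tr_def indep_def)
  have bd: "card A < Suc (card V)" if "tr A" for A
    using that card_mono[OF V] by (simp add: tr_def le_imp_less_Suc)
  obtain A0 where A0: "tr A0" "\<And>A. tr A \<Longrightarrow> card A \<le> card A0"
    using ex_has_greatest_nat[of tr "{}" card "Suc (card V)"] t0 bd by metis
  have fin: "finite A" if "tr A" for A using that V finite_subset by (auto simp: tr_def)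
  have span: "e \<in> cl A" if A: "tr A" "card A = card A0" "e \<in> V" "f e \<notin> f ` A" for e A
  proof (rule ccontr)
    assume "e \<notin> cl A"
    then have "tr (insert e A)" using A indep_insert by (auto simp: tr_def)
    then have "card (insert e A) \<le> card A0" using A0 by blast
    moreover have "e \<notin> A" using A by auto
    ultimately show False using A fin by simp
  qed
  have step: "tr A' \<and> card A' = card A0" if s: "swap V f A A'" "tr A" "card A = card A0" for A A'
  proof -
    obtain e j where ej: "e \<in> V" "j \<in> A" "f e \<notin> f ` A" "e \<notin> cl (A - {j})" "A' = insert e (A - {j})"
      using s unfolding swap_def by blast
    have "indep A'" unfolding ej(5) by (rule indep_swap) (use ej s in \<open>auto simp: tr_def\<close>)
    moreover have "inj_on f A'" unfolding ej(5)
      using s(2) ej(3) by (auto simp: tr_def intro: inj_on_subset)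
    moreover have "A' \<subseteq> V" using ej s by (auto simp: tr_def)
    moreover have "e \<notin> A" using ej by auto
    then have "card A' = Suc (card (A - {j}))" using ej(5) fin[OF s(2)] by simp
    then have "card A' = card A" using card_Suc_Diff1[OF fin[OF s(2)] ej(2)] by simp
    ultimately show ?thesis using s by (simp add: tr_def)
  qed
  define reach where "reach = (swap V f)\<^sup>*\<^sup>* A0"
  have rtr: "tr A \<and> card A = card A0" if "reach A" for A
    using that unfolding reach_def by (induction rule: rtranclp_induct) (use step A0 in auto)
  define J where "J = {b \<in> f ` V. \<exists>A. reach A \<and> b \<notin> f ` A}"
  \<comment> \<open>Maximality puts \<open>e\<close> into \<open>cl A\<close>. An element
    \<open>j\<close> of \<open>A\<close> needed for this has its block in \<open>J\<close>, since
    exchanging it for \<open>e\<close> gives a reachable transversal that misses this block. So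
    \<open>cl_remove\<close> discards everything outside \<open>J\<close>.\<close>
  have free: "e \<in> cl {a \<in> A. f a \<in> J}" if A: "reach A" "e \<in> V" "f e \<notin> f ` A" for A e
  proof -
    have tA: "tr A" "card A = card A0" using rtr A by auto
    have "e \<in> cl (A - {a \<in> A. f a \<notin> J})"
    proof (rule cl_remove)
      show "\<forall>j\<in>{a \<in> A. f a \<notin> J}. e \<in> cl (A - {j})"
      proof (rule ccontr)
        assume "\<not> ?thesis"
        then obtain j where j: "j \<in> A" "f j \<notin> J" "e \<notin> cl (A - {j})" by blast
        then have "swap V f A (insert e (A - {j}))" using A unfolding swap_def by blast
        then have "reach (insert e (A - {j}))" using A(1) unfolding reach_def by simp
        moreover have "f j \<noteq> f e" using A(3) j(1) by (metis imageI)
        then have "f j \<notin> f ` insert e (A - {j})"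
          using tA j(1) by (auto simp: tr_def inj_on_def)
        moreover have "f j \<in> f ` V" using tA j by (auto simp: tr_def)
        ultimately show False using j(2) unfolding J_def by blast
      qed
    qed (use tA span A fin in \<open>auto simp: tr_def\<close>)
    moreover have "A - {a \<in> A. f a \<notin> J} = {a \<in> A. f a \<in> J}" by auto
    ultimately show ?thesis by simp
  qed
  \<comment> \<open>The element brought in by a swap is by \<open>free\<close> already spanned by
    the part over \<open>J\<close>; so this span can only shrink along swaps, and every reachable
    transversal can be traced back to \<open>A0\<close>.\<close>
  have inv: "cl {a \<in> A. f a \<in> J} \<subseteq> cl {a \<in> A0. f a \<in> J}" if "reach A" for A
    using that unfolding reach_def
  proof (induction rule: rtranclp_induct)
    case base
    then show ?case by simp
  next
    case (step A A')
    then have rA: "reach A" by (simp add: reach_def)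
    obtain e j where ej: "e \<in> V" "j \<in> A" "f e \<notin> f ` A" "e \<notin> cl (A - {j})" "A' = insert e (A - {j})"
      using step.hyps unfolding swap_def by blast
    have "{a \<in> A'. f a \<in> J} \<subseteq> cl {a \<in> A. f a \<in> J}"
      using ej free[OF rA ej(1,3)] ext[of "{a \<in> A. f a \<in> J}"] by auto
    then show ?case using cl_least step.IH by blast
  qed
  show thesis
  proof (rule that[of A0 "f ` V - J"])
    show "A0 \<subseteq> V" "indep A0" "inj_on f A0" using A0 by (auto simp: tr_def)
    have "reach A0" by (simp add: reach_def)
    then show "f ` V - J \<subseteq> f ` A0" unfolding J_def by blast
    fix e assume e: "e \<in> V" "f e \<notin> f ` V - J"
    then obtain A where A: "reach A" "f e \<notin> f ` A" unfolding J_def by blast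
    have "e \<in> cl {a \<in> A0. f a \<in> J}" using free[OF A(1) e(1) A(2)] inv[OF A(1)] by blast
    moreover have "{a \<in> A0. f a \<in> J} \<subseteq> {a \<in> A0. f a \<notin> f ` V - J}" by auto
    ultimately show "e \<in> cl {a \<in> A0. f a \<notin> f ` V - J}" using mono by blast
  qed
qed

end

section \<open>Parities and configurations\<close>

lemma odd_card_sym_diff:
  assumes "finite S" "finite T"
  shows "odd (card {e \<in> sym_diff S T. Q e}) = (odd (card {e \<in> S. Q e}) \<noteq> odd (card {e \<in> T. Q e}))"
proof -
  let ?A = "{e \<in> S. Q e}" and ?B = "{e \<in> T. Q e}"
  have "{e \<in> sym_diff S T. Q e} = (?A - ?B) \<union> (?B - ?A)" by auto
  moreover have "card ((?A - ?B) \<union> (?B - ?A)) = card (?A - ?B) + card (?B - ?A)"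
    using assms by (intro card_Un_disjoint) auto
  moreover have "card ?A = card (?A - ?B) + card (?A \<inter> ?B)"
    using assms by (subst card_Un_disjoint[symmetric]) (auto intro: arg_cong[where f = card])
  moreover have "card ?B = card (?B - ?A) + card (?A \<inter> ?B)"
    using assms by (subst card_Un_disjoint[symmetric]) (auto intro: arg_cong[where f = card])
  ultimately show ?thesis by auto
qed

text \<open>A linear form over F_2 as the set of its bits, each given by block and position;
  addition of forms is \<open>sym_diff\<close>.\<close>

definition par :: "(nat \<times> nat) set \<Rightarrow> (nat \<Rightarrow> nat) \<Rightarrow> bool" where
  "par S x = odd (card {e \<in> S. bit (x (fst e)) (snd e)})"

lemma par_empty [simp]: "par {} x = False"
  by (simp add: par_def)

lemma par_sym_diff: "finite S \<Longrightarrow> finite T \<Longrightarrow> par (sym_diff S T) x = (par S x \<noteq> par T x)"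
  unfolding par_def by (rule odd_card_sym_diff)

lemma par_cong:
  assumes "\<And>i a. (i, a) \<in> S \<Longrightarrow> bit (x i) a = bit (y i) a"
  shows "par S x = par S y"
proof -
  have "{e \<in> S. bit (x (fst e)) (snd e)} = {e \<in> S. bit (y (fst e)) (snd e)}" using assms by auto
  then show ?thesis by (simp add: par_def)
qed

lemma par_split:
  assumes "finite S"
  shows "par S x = (par {e \<in> S. P e} x \<noteq> par {e \<in> S. \<not> P e} x)"
proof -
  have "sym_diff {e \<in> S. P e} {e \<in> S. \<not> P e} = S" by auto
  then show ?thesis using par_sym_diff[of "{e \<in> S. P e}" "{e \<in> S. \<not> P e}" x] assms by simp
qed

lemma bit_flip_bit_nat: "bit (flip_bit a (u::nat)) b = (if a = b then \<not> bit u a else bit u b)"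
  by (simp add: bit_flip_bit_iff)

lemma par_upd_flip_notin: "(i, a) \<notin> S \<Longrightarrow> par S (x(i := flip_bit a u)) = par S (x(i := u))"
  by (rule par_cong) (auto simp: bit_flip_bit_nat)

lemma par_upd_flip:
  assumes "finite S" "(i, a) \<in> S"
  shows "par S (x(i := flip_bit a u)) = (\<not> par S (x(i := u)))"
proof -
  have 1: "sym_diff (S - {(i, a)}) {(i, a)} = S" using assms by auto
  have 2: "par {(i, a)} y = bit (y i) a" for y
  proof -
    have "{e \<in> {(i, a)}. bit (y (fst e)) (snd e)} = (if bit (y i) a then {(i, a)} else {})" by auto
    then show ?thesis by (simp add: par_def)
  qed
  have "par S z = (par (S - {(i, a)}) z \<noteq> bit (z i) a)" for z
    using par_sym_diff[of "S - {(i, a)}" "{(i, a)}" z] assms 1 2 by simp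
  then show ?thesis using par_upd_flip_notin[of i a "S - {(i, a)}" x u] by (simp add: bit_flip_bit_nat)
qed

lemma flip_bit_less:
  assumes "(u::nat) < 2 ^ l" "a < l"
  shows "flip_bit a u < 2 ^ l"
proof -
  have "take_bit l (flip_bit a u) = flip_bit a u"
    using assms by (simp add: take_bit_flip_bit_eq take_bit_nat_eq_self)
  then show ?thesis by (simp add: take_bit_nat_eq_self_iff)
qed

lemma flip_bit_flip_bit [simp]: "flip_bit a (flip_bit a (u::nat)) = u"
  by (rule bit_eqI) (simp add: bit_flip_bit_nat)

lemma bit_add_mult_power:
  assumes "(u::nat) < 2 ^ l"
  shows "bit (i * 2 ^ l + u) a = (if a < l then bit u a else bit i (a - l))"
proof (cases "a < l")
  case True
  have "bit (take_bit l (i * 2 ^ l + u)) a = bit (i * 2 ^ l + u) a" using True by (simp add: bit_take_bit_iff)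
  moreover have "take_bit l (i * 2 ^ l + u) = u" using assms by (simp add: take_bit_eq_mod)
  ultimately show ?thesis using True by simp
next
  case False
  then have "(2::nat) ^ a = 2 ^ l * 2 ^ (a - l)" by (simp flip: power_add)
  then have "(i * 2 ^ l + u) div 2 ^ a = i div 2 ^ (a - l)" using assms by (simp add: div_mult2_eq)
  then show ?thesis using False by (simp add: bit_iff_odd)
qed

text \<open>Solves the equation \<open>S = b\<close> for bit \<open>a\<close> of block
  \<open>i\<close>: if \<open>S\<close> contains this bit, the two candidates give opposite
  parities. Which of them is taken depends on the other blocks through a single linear form.\<close>

definition pick :: "nat \<Rightarrow> nat \<Rightarrow> nat \<Rightarrow> (nat \<times> nat) set \<Rightarrow> bool \<Rightarrow> (nat \<Rightarrow> nat) \<Rightarrow> nat" where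
  "pick i a u S b x = (if par S (x(i := u)) = b then u else flip_bit a u)"

lemma par_pick:
  assumes "finite S" "(i, a) \<in> S"
  shows "par S (x(i := pick i a u S b x)) = b"
  using par_upd_flip[OF assms, of x u] by (auto simp: pick_def)

section \<open>Affine restrictions of the blocks\<close>

locale bin_clique =
  fixes k l n :: nat and E :: "nat set set" and \<delta> :: real
  assumes n_eq: "n = 2 ^ l" and l_pos: "0 < l"
    and deg: "\<And>i j u. i < k \<Longrightarrow> j < k \<Longrightarrow> i \<noteq> j \<Longrightarrow> u < n \<Longrightarrow>
      real (card {v. v < n \<and> {i * n + u, j * n + v} \<notin> E}) \<le> \<delta> * real n"
begin

definition adj :: "nat \<Rightarrow> nat \<Rightarrow> nat \<Rightarrow> nat \<Rightarrow> bool" where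
  "adj i u j v \<longleftrightarrow> {i * n + u, j * n + v} \<in> E"

lemma adj_commute: "adj i u j v = adj j v i u"
  by (simp add: adj_def insert_commute)

text \<open>Values on \<open>W\<close> are left arbitrary because a configuration overwrites
  them.\<close>

definition adm :: "nat set \<Rightarrow> (nat \<Rightarrow> nat) set" where
  "adm W = {x. \<forall>i<k. i \<notin> W \<longrightarrow> x i < n}"

definition vars :: "nat set \<Rightarrow> (nat \<times> nat) set" where
  "vars W = ({..<k} - W) \<times> {..<l}"

definition robust :: "nat set \<Rightarrow> (nat \<Rightarrow> nat set) \<Rightarrow> bool" where
  "robust W P \<longleftrightarrow> (\<forall>i\<in>W. \<forall>j\<in>W. i \<noteq> j \<longrightarrow> (\<forall>u\<in>P i. \<forall>v\<in>P j. adj i u j v))"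

text \<open>At most one free bit: a choice between two values that differ in one bit is governed by
  one parity and so stays affine. A single value is thin as well.\<close>

definition thin :: "nat set \<Rightarrow> bool" where
  "thin Q \<longleftrightarrow> (\<exists>u a. a < l \<and> u < n \<and> Q \<subseteq> {u, flip_bit a u})"

text \<open>A configuration: the blocks in W are restricted to thin sets any choice from which is a clique,
  and \<open>\<sigma>\<close> fills these blocks in by affine functions of the remaining ones.\<close>

definition cfg :: "nat set \<Rightarrow> (nat \<Rightarrow> nat set) \<Rightarrow> ((nat \<Rightarrow> nat) \<Rightarrow> nat \<Rightarrow> nat) \<Rightarrow> bool" where
  "cfg W P \<sigma> \<longleftrightarrow> W \<subseteq> {..<k} \<and> (\<forall>i\<in>W. thin (P i)) \<and> robust W P \<and>
     (\<forall>x\<in>adm W. \<forall>i\<in>W. \<sigma> x i \<in> P i) \<and> (\<forall>x i. i \<notin> W \<longrightarrow> \<sigma> x i = x i) \<and>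
     (\<forall>x y. (\<forall>i. i \<notin> W \<longrightarrow> x i = y i) \<longrightarrow> \<sigma> x = \<sigma> y) \<and>
     (\<forall>S\<subseteq>vars {}. \<exists>S'\<subseteq>vars W. \<exists>c. \<forall>x\<in>adm W. par S (\<sigma> x) = (par S' x \<noteq> c))"

lemma finite_vars: "finite (vars W)"
  by (simp add: vars_def)

lemma adm_mono: "W \<subseteq> W' \<Longrightarrow> adm W \<subseteq> adm W'"
  by (auto simp: adm_def)

lemma thin_bound: "thin Q \<Longrightarrow> u \<in> Q \<Longrightarrow> u < n"
  unfolding thin_def using flip_bit_less[of _ l] by (auto simp: n_eq)

lemma thin_card: "thin Q \<Longrightarrow> finite Q \<and> card Q \<le> 2"
proof -
  assume "thin Q"
  then obtain u a where "Q \<subseteq> {u, flip_bit a u}" unfolding thin_def by blast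
  moreover have "card {u, flip_bit a u} \<le> 2" by (simp add: card_insert_if)
  ultimately show ?thesis by (meson card_mono finite.emptyI finite.insertI finite_subset le_trans)
qed

lemma cfg_id: "cfg {} P (\<lambda>x. x)"
  unfolding cfg_def robust_def by (auto intro: exI[of _ False])

lemma
  assumes "cfg W P \<sigma>"
  shows cfg_W: "W \<subseteq> {..<k}"
    and cfg_thin: "i \<in> W \<Longrightarrow> thin (P i)"
    and cfg_robust: "robust W P"
    and cfg_in: "x \<in> adm W \<Longrightarrow> i \<in> W \<Longrightarrow> \<sigma> x i \<in> P i"
    and cfg_out: "i \<notin> W \<Longrightarrow> \<sigma> x i = x i"
    and cfg_dep: "(\<And>i. i \<notin> W \<Longrightarrow> x i = y i) \<Longrightarrow> \<sigma> x = \<sigma> y"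
    and cfg_pull: "S \<subseteq> vars {} \<Longrightarrow> \<exists>S'\<subseteq>vars W. \<exists>c. \<forall>x\<in>adm W. par S (\<sigma> x) = (par S' x \<noteq> c)"
  using assms unfolding cfg_def by simp_all

lemma cfg_finite: "cfg W P \<sigma> \<Longrightarrow> finite W"
  by (rule finite_subset[OF cfg_W]) auto

lemma cfg_idem:
  assumes "cfg W P \<sigma>"
  shows "\<sigma> (\<sigma> x) = \<sigma> x"
  by (rule cfg_dep[OF assms]) (rule cfg_out[OF assms])

lemma cfg_adm: "cfg W P \<sigma> \<Longrightarrow> x \<in> adm W \<Longrightarrow> \<sigma> x \<in> adm {}"
proof -
  assume c: "cfg W P \<sigma>" and x: "x \<in> adm W"
  have "\<sigma> x i < n" if "i < k" for i
  proof (cases "i \<in> W")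
    case True
    then show ?thesis using cfg_in[OF c x] cfg_thin[OF c] thin_bound by blast
  next
    case False
    then show ?thesis using cfg_out[OF c] x that by (simp add: adm_def)
  qed
  then show ?thesis by (simp add: adm_def)
qed

text \<open>Fixing one more block means filling it in first and then applying the old
  \<open>\<sigma>\<close>. So only the pullback of forms through this one assignment has to be
  checked.\<close>

lemma cfg_update:
  assumes c: "cfg W P \<sigma>" and i: "i < k" "i \<notin> W" and Q: "thin Q"
    and rob: "robust (insert i W) (P(i := Q))"
    and sel: "\<And>x. x \<in> adm (insert i W) \<Longrightarrow> s x \<in> Q"
    and dep: "\<And>x y. (\<And>j. j \<notin> insert i W \<Longrightarrow> x j = y j) \<Longrightarrow> s x = s y"
    and pull: "\<And>S. S \<subseteq> vars W \<Longrightarrow> \<exists>S'\<subseteq>vars (insert i W). \<exists>c. \<forall>x\<in>adm (insert i W).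
        par S (x(i := s x)) = (par S' x \<noteq> c)"
  shows "cfg (insert i W) (P(i := Q)) (\<lambda>x. \<sigma> (x(i := s x)))"
proof -
  have a: "x(i := s x) \<in> adm W" if "x \<in> adm (insert i W)" for x
    using that thin_bound[OF Q sel[OF that]] by (auto simp: adm_def)
  have "\<exists>S'\<subseteq>vars (insert i W). \<exists>c. \<forall>x\<in>adm (insert i W). par S (\<sigma> (x(i := s x))) = (par S' x \<noteq> c)"
    if S: "S \<subseteq> vars {}" for S
  proof -
    obtain S1 c1 where 1: "S1 \<subseteq> vars W" "\<forall>x\<in>adm W. par S (\<sigma> x) = (par S1 x \<noteq> c1)"
      using cfg_pull[OF c S] by blast
    obtain S2 c2 where 2: "S2 \<subseteq> vars (insert i W)"
      "\<forall>x\<in>adm (insert i W). par S1 (x(i := s x)) = (par S2 x \<noteq> c2)"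
      using pull[OF 1(1)] by blast
    have "\<forall>x\<in>adm (insert i W). par S (\<sigma> (x(i := s x))) = (par S2 x \<noteq> (c1 \<noteq> c2))"
      using 1 2 a by auto
    then show ?thesis using 2 by blast
  qed
  moreover have "\<sigma> (x(i := s x)) = \<sigma> (y(i := s y))" if "\<forall>j. j \<notin> insert i W \<longrightarrow> x j = y j" for x y
    using cfg_dep[OF c, of "x(i := s x)" "y(i := s y)"] dep[of x y] that by auto
  moreover have "\<sigma> (x(i := s x)) j \<in> (P(i := Q)) j" if "x \<in> adm (insert i W)" "j \<in> insert i W" for x j
    using cfg_in[OF c a[OF that(1)]] cfg_out[OF c, of i] sel[OF that(1)] that(2) i by auto
  moreover have "thin ((P(i := Q)) j)" if "j \<in> insert i W" for j
    using that Q cfg_thin[OF c] by auto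
  moreover have "\<sigma> (x(i := s x)) j = x j" if "j \<notin> insert i W" for x j
    using cfg_out[OF c, of j] that by auto
  moreover have "insert i W \<subseteq> {..<k}" using i cfg_W[OF c] by auto
  ultimately show ?thesis unfolding cfg_def using rob by (intro conjI ballI allI impI) simp_all
qed

text \<open>If \<open>S\<close> cannot distinguish the value \<open>s x\<close> from
  \<open>u\<close>, its bits in block \<open>i\<close> contribute the constant parity of
  \<open>u\<close>, and the remaining bits form \<open>S'\<close>.\<close>

lemma pull_const:
  assumes "S \<subseteq> vars W" and s: "\<And>x. x \<in> adm (insert i W) \<Longrightarrow> par S (x(i := s x)) = par S (x(i := u))"
  shows "\<exists>S'\<subseteq>vars (insert i W). \<exists>c. \<forall>x\<in>adm (insert i W). par S (x(i := s x)) = (par S' x \<noteq> c)"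
proof -
  have fin: "finite S" using assms finite_vars finite_subset by blast
  let ?S = "{e \<in> S. fst e \<noteq> i}"
  have "?S \<subseteq> vars (insert i W)" using assms by (auto simp: vars_def)
  moreover have "par S (x(i := s x)) = (par ?S x \<noteq> par {e \<in> S. fst e = i} (\<lambda>_. u))"
    if "x \<in> adm (insert i W)" for x
  proof -
    have "par ?S (x(i := u)) = par ?S x" by (rule par_cong) auto
    moreover have "par {e \<in> S. fst e = i} (x(i := u)) = par {e \<in> S. fst e = i} (\<lambda>_. u)"
      by (rule par_cong) auto
    ultimately show ?thesis using s[OF that] par_split[OF fin, of "x(i := u)" "\<lambda>e. fst e = i"] by auto
  qed
  ultimately show ?thesis by blast
qed

lemma cfg_single:
  assumes c: "cfg W P \<sigma>" and i: "i < k" "i \<notin> W" and Q: "thin Q" "u \<in> Q"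
    and rob: "robust (insert i W) (P(i := Q))"
  shows "cfg (insert i W) (P(i := Q)) (\<lambda>x. \<sigma> (x(i := u)))"
  by (rule cfg_update[OF c i Q(1) rob]) (use Q pull_const in auto)

lemma cfg_pair:
  assumes c: "cfg W P \<sigma>" and i: "i < k" "i \<notin> W" and a: "a < l" "u < n"
    and rob: "robust (insert i W) (P(i := {u, flip_bit a u}))"
    and S0: "S0 \<subseteq> vars W" "(i, a) \<in> S0"
  shows "cfg (insert i W) (P(i := {u, flip_bit a u})) (\<lambda>x. \<sigma> (x(i := pick i a u S0 b x)))"
proof (rule cfg_update[OF c i _ rob])
  show "thin {u, flip_bit a u}" using a unfolding thin_def by blast
  show "pick i a u S0 b x \<in> {u, flip_bit a u}" for x by (simp add: pick_def)
  have fin0: "finite S0" using S0 finite_vars finite_subset by blast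
  show "pick i a u S0 b x = pick i a u S0 b y" if "\<And>j. j \<notin> insert i W \<Longrightarrow> x j = y j" for x y
  proof -
    have "par S0 (x(i := u)) = par S0 (y(i := u))"
      by (rule par_cong) (use that S0 in \<open>auto simp: vars_def\<close>)
    then show ?thesis by (simp add: pick_def)
  qed
  fix S assume S: "S \<subseteq> vars W"
  let ?s = "pick i a u S0 b"
  have irr: "par T (x(i := ?s x)) = par T (x(i := u))" if "(i, a) \<notin> T" for T x
    using par_upd_flip_notin[OF that] by (auto simp: pick_def)
  show "\<exists>S'\<subseteq>vars (insert i W). \<exists>c. \<forall>x\<in>adm (insert i W). par S (x(i := ?s x)) = (par S' x \<noteq> c)"
  proof (cases "(i, a) \<in> S")
    case False
    then show ?thesis using irr by (intro pull_const[OF S]) blast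
  next
    case True
    \<comment> \<open>Adding \<open>S0\<close>, whose parity after the update is the constant
      \<open>b\<close>, cancels the only bit in which the two candidates differ.\<close>
    let ?T = "sym_diff S S0"
    have finS: "finite S" using S finite_vars finite_subset by blast
    have ia: "(i, a) \<notin> ?T" using True S0 by auto
    have "\<exists>S'\<subseteq>vars (insert i W). \<exists>c. \<forall>x\<in>adm (insert i W). par ?T (x(i := ?s x)) = (par S' x \<noteq> c)"
    proof (rule pull_const)
      show "?T \<subseteq> vars W" using S S0(1) by blast
    qed (rule irr[OF ia])
    then obtain S' c where 1: "S' \<subseteq> vars (insert i W)"
      "\<forall>x\<in>adm (insert i W). par ?T (x(i := ?s x)) = (par S' x \<noteq> c)" by blast
    have "par S (x(i := ?s x)) = (par S' x \<noteq> (c \<noteq> b))" if "x \<in> adm (insert i W)" for x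
    proof -
      have "par ?T (x(i := ?s x)) = (par S' x \<noteq> c)" using 1(2) that by blast
      then show ?thesis
        unfolding par_sym_diff[OF finS fin0] par_pick[OF fin0 S0(2)] by argo
    qed
    then show ?thesis using 1(1) by blast
  qed
qed

end

section \<open>Contracting a configuration to a small one\<close>

lemma card_flip_preimage:
  assumes "finite Y"
  shows "card {v::nat. flip_bit a v \<in> Y} \<le> card Y" "finite {v::nat. flip_bit a v \<in> Y}"
proof -
  have eq: "{v::nat. flip_bit a v \<in> Y} = flip_bit a ` Y"
    by (force intro: image_eqI[where x = "flip_bit a _"])
  show "card {v::nat. flip_bit a v \<in> Y} \<le> card Y" "finite {v::nat. flip_bit a v \<in> Y}"
    unfolding eq using assms by (auto intro: card_image_le)
qed

text \<open>For a linear space \<open>R\<close> of forms, seen as the row space of a matrix, this is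
  the span operator of the columns: a column lies in the span of others iff every row combination
  that vanishes on those vanishes on it. Exchange holds since a form containing \<open>a\<close> but
  not \<open>e\<close> can be added to one containing both.\<close>

lemma cl_exchange:
  assumes "\<And>S T. S \<in> R \<Longrightarrow> T \<in> R \<Longrightarrow> sym_diff S T \<in> R"
  shows "exchange_closure (\<lambda>X. {e. \<forall>S\<in>R. S \<inter> X = {} \<longrightarrow> e \<notin> S})"
proof
  fix X Y :: "'a set" and e a :: 'a
  let ?cl = "\<lambda>X. {e. \<forall>S\<in>R. S \<inter> X = {} \<longrightarrow> e \<notin> S}"
  show "X \<subseteq> ?cl X" by auto
  show "?cl X \<subseteq> ?cl Y" if "X \<subseteq> Y" using that by fastforce
  show "?cl (?cl X) \<subseteq> ?cl X" by blast
  assume e: "e \<in> ?cl (insert a X)" "e \<notin> ?cl X"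
  then obtain T where T: "T \<in> R" "T \<inter> X = {}" "e \<in> T" by blast
  then have aT: "a \<in> T" using e(1) by blast
  have "a \<notin> S" if S: "S \<in> R" "S \<inter> insert e X = {}" for S
  proof
    assume a: "a \<in> S"
    have "sym_diff S T \<inter> insert a X = {}" using S T a aT by auto
    then have "e \<notin> sym_diff S T" using e(1) assms[OF S(1) T(1)] by blast
    then show False using S T by auto
  qed
  then show "a \<in> ?cl (insert e X)" by blast
qed

context bin_clique
begin

lemma n_pos: "0 < n"
  by (simp add: n_eq)

text \<open>Union bound: each block of \<open>V\<close> allows at most two values, and each of them
  has at most \<open>\<delta> * n\<close> non-neighbours in block \<open>j\<close>.\<close>

lemma card_nonadj:
  assumes "finite V" "V \<subseteq> {..<k}" "j \<notin> V" "j < k" "\<And>i. i \<in> V \<Longrightarrow> thin (P i)"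
  shows "real (card {v. v < n \<and> (\<exists>i\<in>V. \<exists>w\<in>P i. \<not> adj i w j v)}) \<le> 2 * real (card V) * \<delta> * real n"
proof -
  let ?Y = "\<lambda>i w. {v. v < n \<and> \<not> adj i w j v}"
  have eq: "{v. v < n \<and> (\<exists>i\<in>V. \<exists>w\<in>P i. \<not> adj i w j v)} = (\<Union>i\<in>V. \<Union>w\<in>P i. ?Y i w)" by auto
  have dn: "0 \<le> \<delta> * real n" if "i \<in> V" for i
  proof -
    have "i \<noteq> j" "i < k" using that assms by auto
    then show ?thesis using order_trans[OF of_nat_0_le_iff deg[of i j 0]] assms(4) n_pos by blast
  qed
  have i: "real (card (\<Union>w\<in>P i. ?Y i w)) \<le> 2 * (\<delta> * real n)" if "i \<in> V" for i
  proof -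
    have t: "thin (P i)" using assms that by blast
    have Y: "real (card (?Y i w)) \<le> \<delta> * real n" if w: "w \<in> P i" for w
    proof -
      have "i \<noteq> j" "i < k" using \<open>i \<in> V\<close> assms by auto
      then show ?thesis using deg[of i j w] assms(4) thin_bound[OF t w] by (simp add: adj_def)
    qed
    have "real (card (\<Union>w\<in>P i. ?Y i w)) \<le> (\<Sum>w\<in>P i. real (card (?Y i w)))"
      using card_UN_le[of "P i" "?Y i"] thin_card[OF t] by (simp flip: of_nat_sum)
    also have "\<dots> \<le> (\<Sum>w\<in>P i. \<delta> * real n)" by (rule sum_mono) (use Y in auto)
    also have "\<dots> = real (card (P i)) * (\<delta> * real n)" by simp
    also have "\<dots> \<le> 2 * (\<delta> * real n)"
      using thin_card[OF t] dn[OF that] by (intro mult_right_mono) auto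
    finally show ?thesis .
  qed
  have "real (card (\<Union>i\<in>V. \<Union>w\<in>P i. ?Y i w)) \<le> (\<Sum>i\<in>V. real (card (\<Union>w\<in>P i. ?Y i w)))"
    using card_UN_le[of V "\<lambda>i. \<Union>w\<in>P i. ?Y i w"] assms(1) by (simp flip: of_nat_sum)
  also have "\<dots> \<le> (\<Sum>i\<in>V. 2 * (\<delta> * real n))" by (rule sum_mono) (use i in auto)
  finally show ?thesis unfolding eq by (simp add: mult_ac)
qed

lemma robust_insert:
  assumes "robust V P" "j \<notin> V" "\<And>i w v. i \<in> V \<Longrightarrow> w \<in> P i \<Longrightarrow> v \<in> Q \<Longrightarrow> adj i w j v"
  shows "robust (insert j V) (P(j := Q))"
  using assms adj_commute unfolding robust_def by auto

lemma robust_cong: "robust W P \<Longrightarrow> (\<And>i. i \<in> W \<Longrightarrow> P' i = P i) \<Longrightarrow> robust W P'"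
  by (simp add: robust_def)

lemma cfg_cong:
  assumes "cfg W P \<sigma>" "\<And>i. i \<in> W \<Longrightarrow> P' i = P i"
  shows "cfg W P' \<sigma>"
  using assms robust_cong[OF cfg_robust[OF assms(1)] assms(2)] unfolding cfg_def by simp

text \<open>Greedy choice. A value is excluded if it, or its partner with bit \<open>b j\<close>
  flipped, is non-adjacent to an earlier value. Each of the two reasons excludes at most
  \<open>2 * card (W \<union> B) * \<delta> * n\<close> values, so the factor 4 leaves one
  over.\<close>

lemma robust_extend:
  assumes "finite B" "finite W" "B \<subseteq> {..<k}" "W \<subseteq> {..<k}" "W \<inter> B = {}" "robust W P"
    and "\<And>i. i \<in> W \<Longrightarrow> thin (P i)" "\<And>i. i \<in> B \<Longrightarrow> b i < l"
    and "4 * (real (card W) + real (card B)) * \<delta> < 1" "0 \<le> \<delta>"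
  shows "\<exists>u. (\<forall>i\<in>B. u i < n) \<and>
    robust (W \<union> B) (\<lambda>i. if i \<in> B then {u i, flip_bit (b i) (u i)} else P i)"
  using assms
proof (induction B rule: finite_induct)
  case empty
  then show ?case by simp
next
  case (insert j B)
  have small: "4 * (real (card W) + real (card B)) * \<delta> < 1"
  proof -
    have "4 * (real (card W) + real (card B)) * \<delta> \<le> 4 * (real (card W) + real (card (insert j B))) * \<delta>"
      using insert.hyps \<open>0 \<le> \<delta>\<close> by (intro mult_right_mono) auto
    then show ?thesis using insert.prems by linarith
  qed
  obtain u where u: "\<forall>i\<in>B. u i < n"
    "robust (W \<union> B) (\<lambda>i. if i \<in> B then {u i, flip_bit (b i) (u i)} else P i)"
    using insert.IH insert.prems small by auto
  let ?P = "\<lambda>i. if i \<in> B then {u i, flip_bit (b i) (u i)} else P i"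
  have thin: "thin (?P i)" if "i \<in> W \<union> B" for i
  proof (cases "i \<in> B")
    case True
    then show ?thesis using insert.prems(7)[of i] u(1) unfolding thin_def by auto
  next
    case False
    then show ?thesis using insert.prems(6)[of i] that by auto
  qed
  let ?Y = "{v. v < n \<and> (\<exists>i\<in>W \<union> B. \<exists>w\<in>?P i. \<not> adj i w j v)}"
  let ?Y' = "{v. flip_bit (b j) v \<in> ?Y}"
  have Y: "real (card ?Y) \<le> 2 * real (card (W \<union> B)) * \<delta> * real n"
    by (rule card_nonadj) (use insert thin in auto)
  have finY: "finite ?Y" by simp
  have "card (?Y \<union> ?Y') \<le> card ?Y + card ?Y"
    using card_Un_le[of ?Y ?Y'] card_flip_preimage(1)[OF finY, of "b j"] by linarith
  moreover have "card (W \<union> B) \<le> card W + card B" by (rule card_Un_le)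
  then have "4 * real (card (W \<union> B)) * \<delta> \<le> 4 * (real (card W) + real (card B)) * \<delta>"
    using \<open>0 \<le> \<delta>\<close> by (intro mult_right_mono) auto
  then have "(4 * real (card (W \<union> B)) * \<delta>) * real n < 1 * real n"
    using small n_pos by (intro mult_strict_right_mono) auto
  ultimately have "card (?Y \<union> ?Y') < n" using Y by (simp add: mult_ac)
  moreover have "finite (?Y \<union> ?Y')" using finY card_flip_preimage(2)[OF finY] by blast
  ultimately have "\<not> {..<n} \<subseteq> ?Y \<union> ?Y'"
    using card_mono[of "?Y \<union> ?Y'" "{..<n}"] by (simp only: card_lessThan not_le[symmetric]) blast
  then obtain v where v: "v < n" "v \<notin> ?Y" "v \<notin> ?Y'" unfolding subset_iff Un_iff lessThan_iff by blast
  have fv: "flip_bit (b j) v < n" using v insert.prems flip_bit_less[of v l "b j"] by (auto simp: n_eq)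
  have rob: "robust (insert j (W \<union> B)) (?P(j := {v, flip_bit (b j) v}))"
    by (rule robust_insert[OF u(2)]) (use insert v fv in auto)
  have "robust (W \<union> insert j B)
      (\<lambda>i. if i \<in> insert j B then {(u(j := v)) i, flip_bit (b i) ((u(j := v)) i)} else P i)"
    unfolding Un_insert_right by (rule robust_cong[OF rob]) (use insert.hyps in auto)
  moreover have "\<forall>i\<in>insert j B. (u(j := v)) i < n" using u v by auto
  ultimately show ?case by blast
qed

text \<open>Gaussian elimination, one block at a time: an equation containing the designated bit of the
  block serves as pivot if there is one. The last hypothesis says that an equation
  without designated bits only constrains blocks that get their value from \<open>x\<close>, which satisfies it.\<close>

lemma eliminate:
  assumes "finite Q"
    and "cfg W P \<sigma>" "Q \<inter> W = {}" "Q \<subseteq> {..<k}" "robust (W \<union> Q) P"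
    and "\<And>i. i \<in> Q \<Longrightarrow> a i < l \<and> y i < n"
    and "\<And>i. i \<in> Q \<Longrightarrow> i \<in> p \<Longrightarrow> P i = {y i, flip_bit (a i) (y i)}"
    and "\<And>i. i \<in> Q \<Longrightarrow> y i \<in> P i \<and> thin (P i)"
    and "\<And>S c S' c'. (S, c) \<in> R \<Longrightarrow> (S', c') \<in> R \<Longrightarrow> (sym_diff S S', c \<noteq> c') \<in> R"
    and "\<And>S c. (S, c) \<in> R \<Longrightarrow> S \<subseteq> vars W"
    and "\<And>i. i \<in> T \<Longrightarrow> y i = x i"
    and "\<And>S c. (S, c) \<in> R \<Longrightarrow> (\<And>i. i \<in> Q \<inter> p \<Longrightarrow> (i, a i) \<notin> S) \<Longrightarrow> fst ` S \<subseteq> T \<inter> Q \<and> par S x = c"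
  shows "\<exists>\<sigma>'. cfg (W \<union> Q) P \<sigma>' \<and>
    (\<forall>z\<in>adm (W \<union> Q). \<sigma> (\<sigma>' z) = \<sigma>' z \<and> (\<forall>S c. (S, c) \<in> R \<longrightarrow> par S (\<sigma>' z) = c))"
  using assms
proof (induction Q arbitrary: W \<sigma> R rule: finite_induct)
  case empty
  have S: "S = {}" "\<not> c" if "(S, c) \<in> R" for S c
    using empty.prems(11)[OF that] by auto
  have "par S (\<sigma> z) = c" if "(S, c) \<in> R" for S c z
    using S[OF that] by simp
  then show ?case using empty.prems(1) cfg_idem[OF empty.prems(1)] by (intro exI[of _ \<sigma>]) simp
next
  case (insert i Q)
  note c = insert.prems(1)
  have iW: "i \<notin> W" "i < k" using insert.prems by auto
  have ai: "a i < l" "y i < n" using insert.prems(5)[of i] by auto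
  have rob: "robust (insert i W) P"
    using insert.prems(4) unfolding robust_def by auto
  define piv where "piv \<longleftrightarrow> i \<in> p \<and> (\<exists>S c. (S, c) \<in> R \<and> (i, a i) \<in> S)"
  have finS: "finite S" if "(S, c) \<in> R" for S c
    using insert.prems(9)[OF that] finite_vars finite_subset by blast
  \<comment> \<open>With a pivot equation \<open>S0\<close> the block takes whichever of its two
    values satisfies it; without one it is frozen at \<open>y i\<close>. In both cases only bit
    \<open>a i\<close> can deviate from \<open>y i\<close>.\<close>
  obtain \<sigma>1 where s1: "cfg (insert i W) P \<sigma>1" "\<And>z. \<sigma> (\<sigma>1 z) = \<sigma>1 z"
    "\<not> piv \<Longrightarrow> \<forall>z. \<sigma>1 z i = y i"
    "\<And>z b. b \<noteq> a i \<Longrightarrow> bit (\<sigma>1 z i) b = bit (y i) b"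
    "piv \<Longrightarrow> \<exists>S0 c0. (S0, c0) \<in> R \<and> (i, a i) \<in> S0 \<and> (\<forall>z. par S0 (\<sigma>1 z) = c0)"
  proof (cases piv)
    case True
    then obtain S0 c0 where 0: "i \<in> p" "(S0, c0) \<in> R" "(i, a i) \<in> S0" unfolding piv_def by blast
    have S0: "S0 \<subseteq> vars W" using insert.prems(9) 0 by blast
    have Pi: "P i = {y i, flip_bit (a i) (y i)}" using insert.prems(6) 0 by blast
    let ?s = "\<lambda>z. \<sigma> (z(i := pick i (a i) (y i) S0 c0 z))"
    have "cfg (insert i W) (P(i := {y i, flip_bit (a i) (y i)})) ?s"
      by (rule cfg_pair[OF c iW(2,1) ai _ S0 0(3)]) (use rob in \<open>simp add: Pi[symmetric]\<close>)
    then have "cfg (insert i W) P ?s" by (simp add: Pi[symmetric])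
    moreover have "par S0 (?s z) = c0" for z
    proof -
      have "par S0 (?s z) = par S0 (z(i := pick i (a i) (y i) S0 c0 z))"
        by (rule par_cong) (use S0 cfg_out[OF c] in \<open>auto simp: vars_def\<close>)
      then show ?thesis using par_pick[OF finS[OF 0(2)] 0(3)] by simp
    qed
    moreover have "bit (?s z i) b = bit (y i) b" if "b \<noteq> a i" for z b
      using cfg_out[OF c iW(1)] that by (auto simp: pick_def bit_flip_bit_nat)
    ultimately show thesis using that[of ?s] True cfg_idem[OF c] 0 by blast
  next
    case False
    let ?s = "\<lambda>z. \<sigma> (z(i := y i))"
    have "cfg (insert i W) (P(i := P i)) ?s"
      by (rule cfg_single[OF c iW(2,1)]) (use insert.prems(7)[of i] rob in auto)
    moreover have "?s z i = y i" for z by (rule trans[OF cfg_out[OF c iW(1)] fun_upd_same])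
    moreover have "\<sigma> (?s z) = ?s z" for z by (rule cfg_idem[OF c])
    ultimately show thesis using that[of ?s] False by (simp only: fun_upd_triv) blast
  qed
  \<comment> \<open>In the equations of \<open>R1\<close> block \<open>i\<close> contributes the
    constant \<open>pi S\<close>, which \<open>R'\<close> moves to the right-hand side. The
    equations containing the pivot bit are recovered at the end by adding \<open>S0\<close>.\<close>
  define R1 where "R1 = {(S, c) \<in> R. i \<in> p \<longrightarrow> (i, a i) \<notin> S}"
  define pi where "pi S = par {e \<in> S. fst e = i} (\<lambda>_. y i)" for S
  define R' where "R' = {({e \<in> S. fst e \<noteq> i}, c \<noteq> pi S) | S c. (S, c) \<in> R1}"
  have R1R: "(S, c) \<in> R" if "(S, c) \<in> R1" for S c using that by (simp add: R1_def)
  have block: "par {e \<in> S. fst e = i} (\<sigma>1 z) = pi S" if "(S, c) \<in> R1" for S c z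
    unfolding pi_def
  proof (rule par_cong)
    fix j b assume "(j, b) \<in> {e \<in> S. fst e = i}"
    then have j: "j = i" "(i, b) \<in> S" by auto
    show "bit (\<sigma>1 z j) b = bit (y i) b"
    proof (cases "piv \<and> b = a i")
      case True
      then show ?thesis using that j by (auto simp: R1_def piv_def)
    next
      case False
      then show ?thesis using s1(3,4) j by metis
    qed
  qed
  have split: "par S z = (par {e \<in> S. fst e \<noteq> i} z \<noteq> par {e \<in> S. fst e = i} z)" if "(S, c) \<in> R" for S c z
    using par_split[OF finS[OF that], of z "\<lambda>e. fst e \<noteq> i"] by simp
  have "\<exists>\<sigma>'. cfg (insert i W \<union> Q) P \<sigma>' \<and>
    (\<forall>z\<in>adm (insert i W \<union> Q). \<sigma>1 (\<sigma>' z) = \<sigma>' z \<and> (\<forall>S c. (S, c) \<in> R' \<longrightarrow> par S (\<sigma>' z) = c))"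
  proof (rule insert.IH[OF s1(1)])
    show "Q \<inter> insert i W = {}" "Q \<subseteq> {..<k}" "robust (insert i W \<union> Q) P" using insert by auto
    show "a j < l \<and> y j < n" "y j \<in> P j \<and> thin (P j)" if "j \<in> Q" for j
      using that insert.prems(5,7) by auto
    show "P j = {y j, flip_bit (a j) (y j)}" if "j \<in> Q" "j \<in> p" for j
      using that insert.prems(6) by auto
    show "y j = x j" if "j \<in> T" for j using that insert.prems(10) by auto
    show "S \<subseteq> vars (insert i W)" if Sc: "(S, c) \<in> R'" for S c
    proof -
      obtain U d where 1: "(U, d) \<in> R1" "S = {e \<in> U. fst e \<noteq> i}"
        using Sc unfolding R'_def by blast
      then show ?thesis using insert.prems(9)[OF R1R[OF 1(1)]] unfolding vars_def by auto
    qed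
    show "(sym_diff S S', c \<noteq> c') \<in> R'" if SS': "(S, c) \<in> R'" "(S', c') \<in> R'" for S c S' c'
    proof -
      obtain U d where 1: "(U, d) \<in> R1" "S = {e \<in> U. fst e \<noteq> i}" "c = (d \<noteq> pi U)"
        using SS' unfolding R'_def by blast
      obtain U' d' where 2: "(U', d') \<in> R1" "S' = {e \<in> U'. fst e \<noteq> i}" "c' = (d' \<noteq> pi U')"
        using SS' unfolding R'_def by blast
      have k1: "(sym_diff U U', d \<noteq> d') \<in> R1"
        using insert.prems(8)[OF R1R[OF 1(1)] R1R[OF 2(1)]] 1(1) 2(1) unfolding R1_def by blast
      have k2: "sym_diff S S' = {e \<in> sym_diff U U'. fst e \<noteq> i}" using 1 2 by auto
      have "{e \<in> sym_diff U U'. fst e = i} = sym_diff {e \<in> U. fst e = i} {e \<in> U'. fst e = i}"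
        by auto
      then have "pi (sym_diff U U') = (pi U \<noteq> pi U')"
        unfolding pi_def using par_sym_diff finS[OF R1R[OF 1(1)]] finS[OF R1R[OF 2(1)]] by simp
      then have k3: "(c \<noteq> c') = ((d \<noteq> d') \<noteq> pi (sym_diff U U'))" using 1(3) 2(3) by argo
      show ?thesis
        unfolding R'_def mem_Collect_eq k2 k3
        by (intro exI[of _ "sym_diff U U'"] exI[of _ "d \<noteq> d'"] conjI refl k1)
    qed
    show "fst ` S \<subseteq> T \<inter> Q \<and> par S x = c"
      if S: "(S, c) \<in> R'" "\<And>j. j \<in> Q \<inter> p \<Longrightarrow> (j, a j) \<notin> S" for S c
    proof -
      obtain U d where 1: "(U, d) \<in> R1" "S = {e \<in> U. fst e \<noteq> i}" "c = (d \<noteq> pi U)"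
        using S unfolding R'_def by blast
      have "(j, a j) \<notin> U" if "j \<in> insert i Q \<inter> p" for j
      proof (cases "j = i")
        case True
        then show ?thesis using 1 that by (auto simp: R1_def)
      next
        case False
        then show ?thesis using S(2)[of j] that 1 by auto
      qed
      then have U: "fst ` U \<subseteq> T \<inter> insert i Q" "par U x = d"
        using insert.prems(11)[OF R1R[OF 1(1)]] by auto
      have "par {e \<in> U. fst e = i} x = pi U"
        unfolding pi_def by (rule par_cong) (use U insert.prems(10) in auto)
      then have "par S x = c" using split[OF R1R[OF 1(1)], of x] U(2) 1 by auto
      moreover have "fst ` S \<subseteq> T \<inter> Q" using U(1) 1 by auto
      ultimately show ?thesis by simp
    qed
  qed
  then obtain \<sigma>' where s': "cfg (W \<union> insert i Q) P \<sigma>'"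
    "\<And>z. z \<in> adm (W \<union> insert i Q) \<Longrightarrow> \<sigma>1 (\<sigma>' z) = \<sigma>' z"
    "\<And>z S c. z \<in> adm (W \<union> insert i Q) \<Longrightarrow> (S, c) \<in> R' \<Longrightarrow> par S (\<sigma>' z) = c" by auto
  have main: "par S (\<sigma>' z) = c" if z: "z \<in> adm (W \<union> insert i Q)" and S: "(S, c) \<in> R1" for S c z
  proof -
    have "({e \<in> S. fst e \<noteq> i}, c \<noteq> pi S) \<in> R'" using S unfolding R'_def by blast
    then have "par {e \<in> S. fst e \<noteq> i} (\<sigma>' z) = (c \<noteq> pi S)" using s'(3)[OF z] by blast
    moreover have "par {e \<in> S. fst e = i} (\<sigma>' z) = pi S" using block[OF S, of "\<sigma>' z"] s'(2)[OF z] by simp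
    ultimately show ?thesis using split[OF R1R[OF S]] by auto
  qed
  have "par S (\<sigma>' z) = c" if z: "z \<in> adm (W \<union> insert i Q)" and S: "(S, c) \<in> R" for S c z
  proof (cases "(S, c) \<in> R1")
    case True
    then show ?thesis using main z by blast
  next
    case False
    then have "i \<in> p" "(i, a i) \<in> S" using S by (auto simp: R1_def)
    then have piv using S unfolding piv_def by blast
    then obtain S0 c0 where 0: "(S0, c0) \<in> R" "(i, a i) \<in> S0" "\<forall>z. par S0 (\<sigma>1 z) = c0"
      using s1(5) by blast
    have "(sym_diff S S0, c \<noteq> c0) \<in> R1"
      using insert.prems(8)[OF S 0(1)] \<open>(i, a i) \<in> S\<close> 0(2) by (simp add: R1_def)
    then have "par (sym_diff S S0) (\<sigma>' z) = (c \<noteq> c0)" using main z by blast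
    moreover have "par S0 (\<sigma>' z) = c0" using 0(3) s'(2)[OF z] by metis
    ultimately show ?thesis using par_sym_diff[OF finS[OF S] finS[OF 0(1)]] by auto
  qed
  moreover have "\<sigma> (\<sigma>' z) = \<sigma>' z" if "z \<in> adm (W \<union> insert i Q)" for z
    using s'(2)[OF that] s1(2) by metis
  ultimately show ?case using s'(1) by blast
qed

text \<open>The equations of the affine hull of \<open>Z\<close>, as far as they speak of the free
  blocks.\<close>

definition eqs :: "nat set \<Rightarrow> (nat \<Rightarrow> nat) set \<Rightarrow> ((nat \<times> nat) set \<times> bool) set" where
  "eqs W Z = {(S, c). S \<subseteq> vars W \<and> (\<forall>z\<in>Z. par S z = c)}"

lemma eqs_sym_diff:
  assumes "(S, c) \<in> eqs W Z" "(S', c') \<in> eqs W Z"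
  shows "(sym_diff S S', c \<noteq> c') \<in> eqs W Z"
proof -
  have f: "finite S" "finite S'"
    using assms finite_vars finite_subset unfolding eqs_def by blast+
  show ?thesis using assms par_sym_diff[OF f] unfolding eqs_def by auto
qed

text \<open>\<open>rado\<close> is applied to the column matroid of the equations, the bits of one
  block forming a class. Blocks of \<open>T\<close> inherit their values from the large state at its
  point \<open>z\<close>; the other blocks of \<open>A\<close> receive fresh pairs that differ in
  their bit of \<open>A\<close>, and these bits serve as pivots. An equation without pivots is
  confined to inherited blocks, where \<open>z\<close> satisfies it. \<open>A\<close> is produced
  before the state because its size must first be bounded by counting.\<close>

lemma contract_cfg:
  assumes c0: "cfg W0 P0 \<sigma>0" and d0: "0 \<le> \<delta>"
  obtains A where "A \<subseteq> vars W0" "inj_on fst A"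
    "\<And>e. e \<in> A \<Longrightarrow> \<exists>S c. (S, c) \<in> eqs W0 Z \<and> S \<inter> A = {e}"
    "\<And>z W' P' \<sigma>'. 4 * (real (card W0) + real (card A)) * \<delta> < 1 \<Longrightarrow> z \<in> Z \<Longrightarrow> z \<in> adm {} \<Longrightarrow>
      cfg W' P' \<sigma>' \<Longrightarrow> W0 \<subseteq> W' \<Longrightarrow> \<forall>i\<in>W0. P' i = P0 i \<Longrightarrow>
      \<forall>x\<in>adm W'. \<sigma>' x \<in> Z \<Longrightarrow> \<sigma>' z = z \<Longrightarrow>
      \<exists>W P \<sigma>. cfg W P \<sigma> \<and> card W \<le> card W0 + card A \<and>
        (\<forall>x\<in>adm W. \<sigma>0 (\<sigma> x) = \<sigma> x \<and> (\<forall>S c. (S, c) \<in> eqs W0 Z \<longrightarrow> par S (\<sigma> x) = c))"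
proof -
  let ?R = "fst ` eqs W0 Z"
  let ?cl = "\<lambda>X. {e. \<forall>S\<in>?R. S \<inter> X = {} \<longrightarrow> e \<notin> S}"
  have "sym_diff S T \<in> ?R" if ST: "S \<in> ?R" "T \<in> ?R" for S T
  proof -
    obtain c d where "(S, c) \<in> eqs W0 Z" "(T, d) \<in> eqs W0 Z" using ST by auto
    then have "(sym_diff S T, c \<noteq> d) \<in> eqs W0 Z" by (rule eqs_sym_diff)
    then show ?thesis by (rule image_eqI[rotated]) simp
  qed
  then interpret exchange_closure ?cl by (rule cl_exchange)
  obtain A T where A: "A \<subseteq> vars W0" "indep A" "inj_on fst A" "T \<subseteq> fst ` A"
    and T: "\<And>e. e \<in> vars W0 \<Longrightarrow> fst e \<notin> T \<Longrightarrow> e \<in> ?cl {a \<in> A. fst a \<notin> T}"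
    by (rule rado[OF finite_vars[of W0], of fst]) (rule that; assumption)
  show thesis
  proof (rule that[OF A(1,3)])
    fix e assume e: "e \<in> A"
    then have "e \<notin> ?cl (A - {e})" using A(2) unfolding indep_def by blast
    then obtain S c where "(S, c) \<in> eqs W0 Z" "S \<inter> (A - {e}) = {}" "e \<in> S" by auto
    then show "\<exists>S c. (S, c) \<in> eqs W0 Z \<and> S \<inter> A = {e}" using e by blast
  next
    fix z W' P' \<sigma>'
    assume sm: "4 * (real (card W0) + real (card A)) * \<delta> < 1" and z: "z \<in> Z" "z \<in> adm {}"
      and c': "cfg W' P' \<sigma>'" and W': "W0 \<subseteq> W'" and P': "\<forall>i\<in>W0. P' i = P0 i"
      and Z': "\<forall>x\<in>adm W'. \<sigma>' x \<in> Z" and zz: "\<sigma>' z = z"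
    have zW': "z \<in> adm W'" using z(2) adm_mono[of "{}" W'] by auto
    have zP: "z i \<in> P' i" if "i \<in> W'" for i using cfg_in[OF c' zW' that] zz by simp
    \<comment> \<open>Blocks of \<open>T\<close> that the large state leaves free stay free: no
      equation without pivot bits will involve them.\<close>
    define T' where "T' = T \<inter> (W' - W0)"
    define B where "B = fst ` A - T"
    have "\<forall>i\<in>fst ` A. \<exists>b. (i, b) \<in> A" by auto
    then obtain aB where aB: "\<And>i. i \<in> fst ` A \<Longrightarrow> (i, aB i) \<in> A" by metis
    have Aeq: "e = (fst e, aB (fst e))" if "e \<in> A" for e
      using inj_onD[OF A(3), of e "(fst e, aB (fst e))"] that aB by auto
    have "\<exists>a. a < l \<and> (P' i \<noteq> {z i} \<longrightarrow> P' i = {z i, flip_bit a (z i)})" if i: "i \<in> T'" for i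
    proof -
      have iW: "i \<in> W'" using i by (simp add: T'_def)
      obtain u a where ua: "a < l" "P' i \<subseteq> {u, flip_bit a u}"
        using cfg_thin[OF c' iW] unfolding thin_def by blast
      have "z i = u \<or> z i = flip_bit a u" using zP[OF iW] ua by auto
      then have "{u, flip_bit a u} = {z i, flip_bit a (z i)}" by auto
      then have "P' i \<subseteq> {z i, flip_bit a (z i)}" using ua by simp
      then show ?thesis using zP[OF iW] ua(1) by blast
    qed
    then obtain aT where aT: "\<And>i. i \<in> T' \<Longrightarrow> aT i < l"
      "\<And>i. i \<in> T' \<Longrightarrow> P' i \<noteq> {z i} \<Longrightarrow> P' i = {z i, flip_bit (aT i) (z i)}" by metis
    have finA: "finite A" using A(1) finite_vars finite_subset by blast
    have finT: "finite T" using A(4) finA finite_subset by blast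
    have Bs: "B \<subseteq> {..<k}" "B \<inter> W0 = {}" "\<And>i. i \<in> B \<Longrightarrow> aB i < l"
      using A(1) aB unfolding B_def vars_def by auto
    have Ts: "T' \<subseteq> {..<k}" "T' \<inter> W0 = {}" "T' \<inter> B = {}" "T' \<subseteq> W'"
      using cfg_W[OF c'] by (auto simp: T'_def B_def)
    have finB: "finite B" using finA by (simp add: B_def)
    have finT': "finite T'" using finT by (simp add: T'_def)
    have "card T' + card B \<le> card A"
    proof -
      have "card T' + card B = card (T' \<union> B)"
        using Ts finB finT' by (simp add: card_Un_disjoint)
      also have "\<dots> \<le> card (fst ` A)" using A(4) finA by (intro card_mono) (auto simp: T'_def B_def)
      finally show ?thesis using card_image_le[OF finA, of fst] by linarith
    qed
    moreover have "card (W0 \<union> T') \<le> card W0 + card T'" by (rule card_Un_le)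
    moreover have "card (W0 \<union> (T' \<union> B)) \<le> card (W0 \<union> T') + card B"
      by (metis Un_assoc card_Un_le)
    ultimately have cards: "card (W0 \<union> T') + card B \<le> card W0 + card A"
      "card (W0 \<union> (T' \<union> B)) \<le> card W0 + card A" by linarith+
    have "4 * (real (card (W0 \<union> T')) + real (card B)) * \<delta> \<le> 4 * (real (card W0) + real (card A)) * \<delta>"
      using cards(1) d0 by (intro mult_right_mono) auto
    then have sm': "4 * (real (card (W0 \<union> T')) + real (card B)) * \<delta> < 1" using sm by linarith
    have "\<exists>u. (\<forall>i\<in>B. u i < n) \<and>
      robust ((W0 \<union> T') \<union> B) (\<lambda>i. if i \<in> B then {u i, flip_bit (aB i) (u i)} else P' i)"
    proof (rule robust_extend)
      show "robust (W0 \<union> T') P'" using cfg_robust[OF c'] W' Ts unfolding robust_def by blast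
      show "thin (P' i)" if "i \<in> W0 \<union> T'" for i using cfg_thin[OF c'] that W' Ts by blast
      show "W0 \<union> T' \<subseteq> {..<k}" using Ts cfg_W[OF c0] by blast
      show "finite (W0 \<union> T')" using finT' cfg_finite[OF c0] by simp
    qed (use Bs finB sm' d0 Ts in auto)
    then obtain u where u: "\<And>i. i \<in> B \<Longrightarrow> u i < n"
      "robust (W0 \<union> (T' \<union> B)) (\<lambda>i. if i \<in> B then {u i, flip_bit (aB i) (u i)} else P' i)"
      by (auto simp: Un_assoc)
    define P where "P i = (if i \<in> B then {u i, flip_bit (aB i) (u i)} else P' i)" for i
    define a where "a i = (if i \<in> B then aB i else aT i)" for i
    define y where "y i = (if i \<in> B then u i else z i)" for i
    \<comment> \<open>Pivots are possible in the fresh blocks and in inherited blocks that really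
      have two values.\<close>
    define p where "p = B \<union> {i. P' i \<noteq> {z i}}"
    have zn: "z i < n" if "i < k" for i using z(2) that by (simp add: adm_def)
    have "\<exists>\<sigma>. cfg (W0 \<union> (T' \<union> B)) P \<sigma> \<and> (\<forall>x\<in>adm (W0 \<union> (T' \<union> B)).
      \<sigma>0 (\<sigma> x) = \<sigma> x \<and> (\<forall>S c. (S, c) \<in> eqs W0 Z \<longrightarrow> par S (\<sigma> x) = c))"
    proof (rule eliminate[where a = a and y = y and p = p and x = z and T = T'])
      show "finite (T' \<union> B)" using finT' finB by simp
      show "cfg W0 P \<sigma>0" by (rule cfg_cong[OF c0]) (use P' Bs in \<open>auto simp: P_def\<close>)
      show "(T' \<union> B) \<inter> W0 = {}" "T' \<union> B \<subseteq> {..<k}" using Ts Bs by auto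
      show "robust (W0 \<union> (T' \<union> B)) P" using u(2) by (simp add: P_def[abs_def])
      show "a i < l \<and> y i < n" if "i \<in> T' \<union> B" for i
        using that Bs Ts aT u zn by (auto simp: a_def y_def)
      show "P i = {y i, flip_bit (a i) (y i)}" if "i \<in> T' \<union> B" "i \<in> p" for i
        using that aT(2)[of i] by (auto simp: P_def a_def y_def p_def)
      show "y i \<in> P i \<and> thin (P i)" if i: "i \<in> T' \<union> B" for i
      proof (cases "i \<in> B")
        case True
        then show ?thesis using u(1) Bs(3) by (auto simp: y_def P_def thin_def)
      next
        case False
        then have "i \<in> W'" using i Ts by auto
        then show ?thesis using False zP cfg_thin[OF c'] by (simp add: y_def P_def)
      qed
      show "(sym_diff S S', c \<noteq> c') \<in> eqs W0 Z" if "(S, c) \<in> eqs W0 Z" "(S', c') \<in> eqs W0 Z" for S c S' c'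
        using that by (rule eqs_sym_diff)
      show "S \<subseteq> vars W0" if "(S, c) \<in> eqs W0 Z" for S c using that by (simp add: eqs_def)
      show "y i = z i" if "i \<in> T'" for i using that Ts by (auto simp: y_def)
      show "fst ` S \<subseteq> T' \<inter> (T' \<union> B) \<and> par S z = c"
        if S: "(S, c) \<in> eqs W0 Z" "\<And>i. i \<in> (T' \<union> B) \<inter> p \<Longrightarrow> (i, a i) \<notin> S" for S c
      proof
        show Sz: "par S z = c" using S(1) z(1) by (simp add: eqs_def)
        have finS: "finite S" using S(1) finite_vars finite_subset unfolding eqs_def by blast
        have SV: "S \<subseteq> vars W0" using S(1) by (simp add: eqs_def)
        \<comment> \<open>The bits of \<open>A\<close> outside \<open>T\<close> are pivots, so
          \<open>S\<close> avoids them; as they span every bit outside \<open>T\<close>,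
          \<open>S\<close> avoids all of those.\<close>
        have "S \<inter> {a \<in> A. fst a \<notin> T} = {}"
        proof -
          have "e \<notin> S" if e: "e \<in> A" "fst e \<notin> T" for e
          proof -
            have "fst e \<in> B" using e by (simp add: B_def)
            then show ?thesis using S(2)[of "fst e"] Aeq[OF e(1)] by (auto simp: p_def a_def)
          qed
          then show ?thesis by blast
        qed
        moreover have "S \<in> ?R" using imageI[OF S(1), of fst] by simp
        ultimately have inT: "fst e \<in> T" if "e \<in> S" for e
          using T[of e] SV that by blast
        \<comment> \<open>If \<open>S\<close> had a bit in a block free in the large state, flipping
          it in \<open>z\<close> would give a second point of that state. On the bits of
          \<open>S\<close> nothing else changes, because the inherited blocks vary only in pivot
          bits. So the parity of \<open>S\<close> would change although it is constant on
          \<open>Z\<close>.\<close>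
        have "fst e \<in> W'" if e: "e \<in> S" for e
        proof (rule ccontr)
          assume nW: "fst e \<notin> W'"
          define i b where "i = fst e" and "b = snd e"
          have ib: "(i, b) \<in> S" "i < k" "b < l" "i \<notin> W'" using e nW SV by (auto simp: i_def b_def vars_def)
          let ?x = "z(i := flip_bit b (z i))"
          have "flip_bit b (z i) < n" using flip_bit_less[of "z i" l b] zn[OF ib(2)] ib(3) by (simp add: n_eq)
          then have xW: "?x \<in> adm W'" using zW' unfolding adm_def by simp
          have "par S (\<sigma>' ?x) = par S ?x"
          proof (rule par_cong)
            fix j b' assume jb: "(j, b') \<in> S"
            show "bit (\<sigma>' ?x j) b' = bit (?x j) b'"
            proof (cases "j \<in> W'")
              case False
              then show ?thesis using cfg_out[OF c'] by simp
            next
              case True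
              then have jT: "j \<in> T'" using inT[OF jb] jb SV by (auto simp: T'_def vars_def)
              have j: "\<sigma>' ?x j \<in> P' j" "?x j = z j" using cfg_in[OF c' xW True] True ib by auto
              show ?thesis
              proof (cases "P' j = {z j}")
                case True
                then show ?thesis using j by simp
              next
                case False
                then have "(j, a j) \<notin> S" using S(2)[of j] jT by (simp add: p_def)
                moreover have "j \<notin> B" using jT Ts(3) by blast
                ultimately have "b' \<noteq> aT j" using jb by (auto simp: a_def)
                moreover have "\<sigma>' ?x j \<in> {z j, flip_bit (aT j) (z j)}" using j(1) aT(2)[OF jT False] by simp
                ultimately show ?thesis using j(2) by (auto simp: bit_flip_bit_nat)
              qed
            qed
          qed
          moreover have "par S (\<sigma>' ?x) = c" using S(1) bspec[OF Z' xW] by (simp add: eqs_def)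
          moreover have "par S ?x = (\<not> par S z)" using par_upd_flip[OF finS ib(1), of z "z i"] by simp
          ultimately show False using Sz by auto
        qed
        then show "fst ` S \<subseteq> T' \<inter> (T' \<union> B)" using inT SV by (fastforce simp: T'_def vars_def)
      qed
    qed
    then show "\<exists>W P \<sigma>. cfg W P \<sigma> \<and> card W \<le> card W0 + card A \<and>
        (\<forall>x\<in>adm W. \<sigma>0 (\<sigma> x) = \<sigma> x \<and> (\<forall>S c. (S, c) \<in> eqs W0 Z \<longrightarrow> par S (\<sigma> x) = c))"
      using cards(2) by blast
  qed
qed

section \<open>Counting the solutions of a linear system with an independent transversal\<close>

lemma card_bit_unset:
  assumes "a < l"
  shows "2 * card {v. v < n \<and> \<not> bit v a} \<le> n"
proof -
  let ?X = "{v. v < n \<and> \<not> bit v a}"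
  have "card (?X \<union> flip_bit a ` ?X) = card ?X + card (flip_bit a ` ?X)"
    by (rule card_Un_disjoint) (auto simp: bit_flip_bit_nat)
  also have "card (flip_bit a ` ?X) = card ?X"
    by (rule card_image, rule inj_on_inverseI[of _ "flip_bit a"]) simp
  finally have "2 * card ?X = card (?X \<union> flip_bit a ` ?X)" by simp
  also have "\<dots> \<le> card {..<n}"
    using assms flip_bit_less[of _ l a] by (intro card_mono) (auto simp: n_eq)
  finally show ?thesis by simp
qed

text \<open>Solutions stay distinct after their bits in \<open>A\<close> are erased: if two differed
  only there, say in \<open>e\<close>, the equation with \<open>S \<inter> A = {e}\<close> would
  have different values on them. Erasing a bit leaves at most \<open>n / 2\<close> values in its
  block, which is at most \<open>5 / 9\<close> of \<open>N i\<close> as \<open>N i\<close> has at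
  least \<open>9 / 10 * n\<close> elements.\<close>

lemma card_solutions:
  assumes A: "A \<subseteq> vars W0" "inj_on fst A" and U: "U = {..<k} - W0"
    and N: "\<And>i. i \<in> U \<Longrightarrow> N i \<subseteq> {..<n}" "\<And>i. i \<in> U \<Longrightarrow> 9 * real n \<le> 10 * real (card (N i))"
    and ind: "\<And>e. e \<in> A \<Longrightarrow> \<exists>S c. (S, c) \<in> R \<and> S \<inter> A = {e}"
    and R: "\<And>S c. (S, c) \<in> R \<Longrightarrow> S \<subseteq> vars W0"
    and X: "X \<subseteq> PiE U N" "\<And>x S c. x \<in> X \<Longrightarrow> (S, c) \<in> R \<Longrightarrow> par S x = c"
  shows "(9 / 5) ^ card A * real (card X) \<le> real (card (PiE U N))"
proof -
  have finU: "finite U" by (simp add: U)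
  have finN: "finite (N i)" if "i \<in> U" for i using N(1)[OF that] finite_subset by blast
  have finA: "finite A" using A(1) finite_vars finite_subset by blast
  let ?F = "fst ` A"
  have FU: "?F \<subseteq> U" using A(1) U by (auto simp: vars_def)
  have "\<forall>i\<in>?F. \<exists>b. (i, b) \<in> A" by auto
  then obtain a where a: "\<And>i. i \<in> ?F \<Longrightarrow> (i, a i) \<in> A" by metis
  have al: "a i < l" if "i \<in> ?F" for i using a[OF that] A(1) by (auto simp: vars_def)
  have aeq: "b = a i" if "(i, b) \<in> A" for i b
    using inj_onD[OF A(2), of "(i, b)" "(i, a i)"] that a[of i] by force
  define \<phi> where "\<phi> x i = (if i \<in> ?F then unset_bit (a i) (x i) else x i)" for x :: "nat \<Rightarrow> nat" and i
  define N' where "N' i = (if i \<in> ?F then {v. v < n \<and> \<not> bit v (a i)} else N i)" for i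
  have unset: "unset_bit b v < n" if "v < n" "b < l" for v b :: nat
  proof -
    have "take_bit l (unset_bit b v) = unset_bit b v"
      using that by (simp add: n_eq take_bit_unset_bit_eq take_bit_nat_eq_self)
    then show ?thesis by (simp add: n_eq take_bit_nat_eq_self_iff)
  qed
  have "\<phi> ` X \<subseteq> PiE U N'"
  proof
    fix w assume "w \<in> \<phi> ` X"
    then obtain x where x: "x \<in> PiE U N" "w = \<phi> x" using X(1) by blast
    have "\<phi> x i \<in> N' i" if i: "i \<in> U" for i
    proof (cases "i \<in> ?F")
      case True
      then have "unset_bit (a i) (x i) < n"
        using PiE_mem[OF x(1) i] N(1)[OF i] unset[OF _ al[OF True]] by blast
      then show ?thesis using True by (simp add: \<phi>_def N'_def bit_unset_bit_iff)
    next
      case False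
      then show ?thesis using PiE_mem[OF x(1) i] by (simp add: \<phi>_def N'_def)
    qed
    moreover have "\<phi> x i = undefined" if "i \<notin> U" for i
      using PiE_arb[OF x(1) that] that FU by (auto simp: \<phi>_def)
    ultimately show "w \<in> PiE U N'" using x(2) by auto
  qed
  moreover have "inj_on \<phi> X"
  proof (rule inj_onI, rule ccontr)
    fix x y assume xy: "x \<in> X" "y \<in> X" "\<phi> x = \<phi> y" "x \<noteq> y"
    have agree: "bit (x i) b = bit (y i) b" if "(i, b) \<notin> A" for i b
    proof (cases "i \<in> ?F")
      case True
      then have "b \<noteq> a i" using a that by blast
      moreover have "unset_bit (a i) (x i) = unset_bit (a i) (y i)"
        using fun_cong[OF xy(3), of i] True by (simp add: \<phi>_def)
      ultimately show ?thesis by (metis bit_unset_bit_iff)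
    next
      case False
      then show ?thesis using fun_cong[OF xy(3), of i] by (simp add: \<phi>_def)
    qed
    obtain i where "x i \<noteq> y i" using xy(4) by blast
    then obtain b where ib: "bit (x i) b \<noteq> bit (y i) b" by (meson bit_eqI)
    then have iA: "(i, b) \<in> A" using agree by blast
    then obtain S c where S: "(S, c) \<in> R" "S \<inter> A = {(i, b)}" using ind by blast
    have finS: "finite S" using R[OF S(1)] finite_vars finite_subset by blast
    have "par S x = par S (y(i := flip_bit b (y i)))"
    proof (rule par_cong)
      fix j b' assume jb: "(j, b') \<in> S"
      show "bit (x j) b' = bit ((y(i := flip_bit b (y i))) j) b'"
      proof (cases "(j, b') = (i, b)")
        case True
        then show ?thesis using ib by (auto simp: bit_flip_bit_nat)
      next
        case False
        then have "(j, b') \<notin> A" using S jb by blast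
        then show ?thesis using agree False by (auto simp: bit_flip_bit_nat)
      qed
    qed
    also have "\<dots> = (\<not> par S (y(i := y i)))" by (rule par_upd_flip[OF finS]) (use S in blast)
    finally show False using X(2)[OF xy(1) S(1)] X(2)[OF xy(2) S(1)] by simp
  qed
  moreover have finN': "finite (PiE U N')" using finU finN by (intro finite_PiE) (auto simp: N'_def)
  ultimately have "card X \<le> card (PiE U N')" using card_inj_on_le by blast
  then have "real (card X) \<le> (\<Prod>i\<in>U. real (card (N' i)))" by (simp add: card_PiE finU flip: of_nat_prod)
  also have "\<dots> \<le> (\<Prod>i\<in>U. (if i \<in> ?F then 5 / 9 else 1) * real (card (N i)))"
  proof (rule prod_mono, intro conjI)
    fix i assume i: "i \<in> U"
    show "real (card (N' i)) \<le> (if i \<in> ?F then 5 / 9 else 1) * real (card (N i))"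
    proof (cases "i \<in> ?F")
      case True
      then have "2 * real (card (N' i)) \<le> real n" using card_bit_unset[OF al[OF True]] by (simp add: N'_def)
      then show ?thesis using N(2)[OF i] True by simp
    qed (simp add: N'_def)
  qed simp
  also have "\<dots> = (\<Prod>i\<in>U. if i \<in> ?F then 5 / 9 else 1) * real (card (PiE U N))"
    by (simp add: prod.distrib card_PiE finU)
  also have "(\<Prod>i\<in>U. if i \<in> ?F then 5 / 9 else (1::real)) = (5 / 9) ^ card A"
  proof -
    have "(\<Prod>i\<in>U. if i \<in> ?F then 5 / 9 else (1::real)) = (\<Prod>i\<in>U \<inter> ?F. 5 / 9)"
      by (rule prod.inter_restrict[OF finU, symmetric])
    also have "U \<inter> ?F = ?F" using FU by blast
    finally show ?thesis by (simp add: card_image[OF A(2)])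
  qed
  finally have "real (card X) \<le> (5 / 9) ^ card A * real (card (PiE U N))" .
  then have "(9 / 5) ^ card A * real (card X) \<le> (9 / 5) ^ card A * ((5 / 9) ^ card A * real (card (PiE U N)))"
    by (intro mult_left_mono) auto
  also have "\<dots> = real (card (PiE U N))" by (simp flip: power_mult_distrib mult.assoc)
  finally show ?thesis .
qed

end

section \<open>Walking down a refutation\<close>

lemma depths_append: "depths (P @ [s]) = depths P @ [step_depth (depths P) s]"
  by (simp add: depths_def)

lemma length_depths [simp]: "length (depths P) = length P"
  by (induction P rule: rev_induct) (simp_all add: depths_append, simp add: depths_def)

lemma depths_nth: "v < length P \<Longrightarrow> depths P ! v = step_depth (take v (depths P)) (P ! v)"
proof (induction P rule: rev_induct)
  case (snoc s P)
  then show ?case by (cases "v = length P") (auto simp: depths_append nth_append)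
qed simp

lemma le_two_power_nbits:
  assumes "0 < N"
  shows "N \<le> 2 ^ nbits N"
proof -
  have "real N = 2 powr (log 2 (real N))" using assms by simp
  also have "\<dots> \<le> 2 powr real (nbits N)"
    unfolding nbits_def by (rule powr_mono) (use real_nat_ceiling_ge in auto)
  also have "\<dots> = real (2 ^ nbits N)" by (simp add: powr_realpow)
  finally show ?thesis by linarith
qed

lemma vbit_eq_bit: "vbit v a = bit v a"
  by (simp add: vbit_def bit_iff_odd)

lemma vbit_inj:
  assumes "u < 2 ^ m" "v < 2 ^ m" "\<And>a. a < m \<Longrightarrow> vbit u a = vbit v a"
  shows "u = v"
proof -
  have "take_bit m u = take_bit m v"
    by (rule bit_eqI) (use assms(3) in \<open>auto simp: bit_take_bit_iff vbit_eq_bit\<close>)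
  then show ?thesis using assms by (simp add: take_bit_nat_eq_self)
qed

lemma falsify_neq_block:
  assumes "\<not> sat_clause \<alpha> (neq_block N i u)" "a < nbits N"
  shows "\<alpha> (i, a) = vbit u a"
proof -
  have "\<not> sat_eq \<alpha> (lit_neq (i, a) (vbit u a))"
    using assms unfolding sat_clause_def neq_block_def by blast
  moreover have "{x \<in> {(i, a)}. \<alpha> x} = (if \<alpha> (i, a) then {(i, a)} else {})" by auto
  ultimately show ?thesis by (auto simp: sat_eq_def lit_neq_def split: if_splits)
qed

lemma sat_clause_Un: "sat_clause \<alpha> (C \<union> D) \<longleftrightarrow> sat_clause \<alpha> C \<or> sat_clause \<alpha> D"
  by (auto simp: sat_clause_def)

context bin_clique
begin

definition asg :: "(nat \<Rightarrow> nat) \<Rightarrow> nat \<times> nat \<Rightarrow> bool" where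
  "asg x = (\<lambda>(i, a). vbit (i * n + x i) a)"

text \<open>As \<open>n = 2 ^ l\<close>, the bits of \<open>i * n + z i\<close> below
  \<open>l\<close> are those of \<open>z i\<close>, and the higher ones are those of
  \<open>i\<close>, hence constants collected in \<open>c\<close>.\<close>

lemma pull_form:
  assumes "finite F" "F \<subseteq> bc_vars N k"
  shows "\<exists>S\<subseteq>vars {}. \<exists>c. \<forall>z\<in>adm {}. odd (card {v \<in> F. asg z v}) = (par S z \<noteq> c)"
proof -
  let ?S = "F \<inter> vars {}" and ?H = "F - vars {}"
  let ?c = "odd (card {e \<in> ?H. bit (fst e) (snd e - l)})"
  have "odd (card {v \<in> F. asg z v}) = (par ?S z \<noteq> ?c)" if z: "z \<in> adm {}" for z
  proof -
    have asg: "asg z e = (if snd e < l then bit (z (fst e)) (snd e) else bit (fst e) (snd e - l))"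
      if "e \<in> F" for e
    proof -
      have "fst e < k" using that assms by (auto simp: bc_vars_def)
      then have "z (fst e) < n" using z by (simp add: adm_def)
      then have "z (fst e) < 2 ^ l" by (simp only: n_eq)
      moreover have "asg z e = bit (fst e * n + z (fst e)) (snd e)"
        by (simp add: asg_def vbit_eq_bit split_beta)
      ultimately show ?thesis
        using bit_add_mult_power[of "z (fst e)" l "fst e" "snd e"] by (simp only: n_eq)
    qed
    have dis: "{v \<in> F. asg z v} = {e \<in> ?S. bit (z (fst e)) (snd e)} \<union> {e \<in> ?H. bit (fst e) (snd e - l)}"
    proof (rule set_eqI)
      fix e
      have "e \<in> F \<Longrightarrow> e \<in> vars {} \<longleftrightarrow> snd e < l" using assms by (cases e) (auto simp: vars_def bc_vars_def)
      then show "e \<in> {v \<in> F. asg z v} \<longleftrightarrow>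
          e \<in> {e \<in> ?S. bit (z (fst e)) (snd e)} \<union> {e \<in> ?H. bit (fst e) (snd e - l)}"
        using asg[of e] by (cases "e \<in> F"; cases "snd e < l") simp_all
    qed
    have "card {v \<in> F. asg z v} = card {e \<in> ?S. bit (z (fst e)) (snd e)} + card {e \<in> ?H. bit (fst e) (snd e - l)}"
      unfolding dis by (rule card_Un_disjoint) (use assms in auto)
    then show ?thesis by (simp add: par_def)
  qed
  then show ?thesis by (intro exI[of _ ?S] exI[of _ ?c] conjI) auto
qed

lemma cfg_pull_form:
  assumes "cfg W Q \<sigma>" "finite F" "F \<subseteq> bc_vars N k"
  shows "\<exists>S\<subseteq>vars W. \<exists>c. \<forall>x\<in>adm W. odd (card {v \<in> F. asg (\<sigma> x) v}) = (par S x \<noteq> c)"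
proof -
  obtain S1 c1 where 1: "S1 \<subseteq> vars {}" "\<And>z. z \<in> adm {} \<Longrightarrow> odd (card {v \<in> F. asg z v}) = (par S1 z \<noteq> c1)"
    using pull_form[OF assms(2,3)] by blast
  obtain S c where 2: "S \<subseteq> vars W" "\<And>x. x \<in> adm W \<Longrightarrow> par S1 (\<sigma> x) = (par S x \<noteq> c)"
    using cfg_pull[OF assms(1) 1(1)] by blast
  have "odd (card {v \<in> F. asg (\<sigma> x) v}) = (par S x \<noteq> (c \<noteq> c1))" if "x \<in> adm W" for x
    using 1(2)[OF cfg_adm[OF assms(1) that]] 2(2)[OF that] by argo
  then show ?thesis using 2(1) by blast
qed

text \<open>Falsifying the clause pins block \<open>i\<close> to \<open>u\<close> and block
  \<open>j\<close> to \<open>v\<close>. A free block takes both values 0 and 1, so both blocks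
  belong to \<open>W\<close>; then \<open>u\<close> and \<open>v\<close> are distinct, lying in
  different blocks, and adjacent by \<open>robust\<close>.\<close>

lemma axiom_satisfiable:
  assumes C: "C \<in> BinClique (k * n) E k" and c: "cfg W Q \<sigma>"
    and f: "\<And>x. x \<in> adm W \<Longrightarrow> \<not> sat_clause (asg (\<sigma> x)) C"
  shows False
proof -
  obtain i j u v where ij: "i < k" "j < k" "i \<noteq> j" "u < k * n" "v < k * n"
    and Ceq: "C = neq_block (k * n) i u \<union> neq_block (k * n) j v" and uv: "{u, v} \<notin> E \<or> u = v"
    using C unfolding BinClique_def by auto
  have two: "2 \<le> n" using l_pos n_eq by (metis One_nat_def Suc_leI power_increasing power_one_right one_le_numeral)
  have vertex: "i' * n + \<sigma> x i' = u'"
    if "\<not> sat_clause (asg (\<sigma> x)) (neq_block (k * n) i' u')" "x \<in> adm W" "i' < k" "u' < k * n" for i' u' x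
  proof (rule vbit_inj[of _ "nbits (k * n)"])
    have "\<sigma> x i' < n" using cfg_adm[OF c that(2)] that(3) by (simp add: adm_def)
    then have "i' * n + \<sigma> x i' < (i' + 1) * n" by simp
    also have "\<dots> \<le> k * n" using that(3) by (intro mult_right_mono) auto
    finally have "i' * n + \<sigma> x i' < k * n" .
    moreover have b: "k * n \<le> 2 ^ nbits (k * n)" using that(3) n_pos by (intro le_two_power_nbits) simp
    ultimately show "i' * n + \<sigma> x i' < 2 ^ nbits (k * n)" by linarith
    show "u' < 2 ^ nbits (k * n)" using b that(4) by linarith
    show "vbit (i' * n + \<sigma> x i') a = vbit u' a" if "a < nbits (k * n)" for a
      using falsify_neq_block[OF \<open>\<not> sat_clause (asg (\<sigma> x)) (neq_block (k * n) i' u')\<close> that]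
      by (simp add: asg_def)
  qed
  have ui: "i * n + \<sigma> x i = u" and vj: "j * n + \<sigma> x j = v" if "x \<in> adm W" for x
    using f[OF that] vertex[OF _ that] ij unfolding Ceq sat_clause_Un by blast+
  let ?x = "\<lambda>_::nat. 0::nat"
  have x: "?x \<in> adm W" "?x(m := 1) \<in> adm W" for m using two by (auto simp: adm_def)
  have W: "i \<in> W"
  proof (rule ccontr)
    assume "i \<notin> W"
    then show False using ui[OF x(1)] ui[OF x(2)[of i]] cfg_out[OF c] by simp
  qed
  have W': "j \<in> W"
  proof (rule ccontr)
    assume "j \<notin> W"
    then show False using vj[OF x(1)] vj[OF x(2)[of j]] cfg_out[OF c] by simp
  qed
  have "\<sigma> ?x i < n" "\<sigma> ?x j < n" using cfg_adm[OF c x(1)] ij by (auto simp: adm_def)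
  then have "u div n = i" "v div n = j" using ui[OF x(1)] vj[OF x(1)] by (auto simp: div_eq_dividend_iff)
  then have "{u, v} \<notin> E" using uv ij by auto
  moreover have "adj i (\<sigma> ?x i) j (\<sigma> ?x j)"
    using cfg_robust[OF c] W W' cfg_in[OF c x(1)] ij unfolding robust_def by blast
  ultimately show False using ui[OF x(1)] vj[OF x(1)] by (simp add: adj_def)
qed

end

section \<open>The random walk through the refutation\<close>

lemma card_PiE_split:
  assumes "i \<in> U" "finite U" "\<And>j. j \<in> U \<Longrightarrow> finite (N j)"
  shows "card {x \<in> PiE U N. \<phi> x} = (\<Sum>u\<in>N i. card {y \<in> PiE (U - {i}) N. \<phi> (y(i := u))})"
proof -
  let ?Y = "PiE (U - {i}) N"
  have "{x \<in> PiE U N. \<phi> x} = (\<lambda>(u, y). y(i := u)) ` (SIGMA u:N i. {y \<in> ?Y. \<phi> (y(i := u))})" (is "_ = ?f ` ?Z")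
  proof (intro equalityI subsetI)
    fix x assume x: "x \<in> {x \<in> PiE U N. \<phi> x}"
    have "x(i := undefined) \<in> ?Y" "x i \<in> N i" using x assms(1) by (auto simp: PiE_def extensional_def)
    moreover have "(x(i := undefined))(i := x i) = x" by simp
    ultimately have "(x i, x(i := undefined)) \<in> ?Z" using x by auto
    then show "x \<in> ?f ` ?Z" by (rule rev_image_eqI) simp
  next
    fix x assume "x \<in> ?f ` ?Z"
    then show "x \<in> {x \<in> PiE U N. \<phi> x}" using assms(1) by (auto simp: PiE_def extensional_def Pi_def)
  qed
  moreover have "inj_on ?f ?Z"
  proof (rule inj_onI)
    fix p q assume pq: "p \<in> ?Z" "q \<in> ?Z" "?f p = ?f q"
    obtain u y u' y' where p: "p = (u, y)" "q = (u', y')" by (cases p, cases q)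
    have e: "y(i := u) = y'(i := u')" using pq(3) p by simp
    have "u = u'" using fun_cong[OF e, of i] by simp
    moreover have "y j = y' j" for j
    proof (cases "j = i")
      case True
      then show ?thesis using pq p by (auto simp: PiE_def extensional_def)
    next
      case False
      then show ?thesis using fun_cong[OF e, of j] by simp
    qed
    ultimately show "p = q" using p by auto
  qed
  moreover have "finite ?Y" using assms by (intro finite_PiE) auto
  ultimately show ?thesis
    using assms by (simp add: card_image)
qed

text \<open>Success probability of the walk up to a cutoff term. The argument is
  \<open>t + 2 * d\<close> for \<open>t\<close> blocks fixed by the walk and \<open>d\<close>
  resolution steps still to go: a block fixed with progress lowers it by 1, one without progress
  raises it by 1.\<close>

definition gauss :: "real \<Rightarrow> nat \<Rightarrow> real" where
  "gauss \<delta> z = exp (- 6 * (real z)\<^sup>2 * \<delta>)"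

lemma gauss_antimono: "0 \<le> \<delta> \<Longrightarrow> y \<le> z \<Longrightarrow> gauss \<delta> z \<le> gauss \<delta> y"
  unfolding gauss_def by (auto intro!: mult_right_mono power_mono)

lemma gauss_bounds: "0 < gauss \<delta> z" "0 \<le> \<delta> \<Longrightarrow> gauss \<delta> z \<le> 1"
  unfolding gauss_def by simp_all

text \<open>One step of the walk: Q of the G admissible values come in pairs, which make progress; the drift
  towards progress outweighs the loss of the inadmissible values.\<close>

lemma gauss_step:
  assumes d: "0 \<le> \<delta>" and z: "z = t + 2 * d" "1 \<le> d"
    and G: "0 \<le> Q" "Q \<le> G" "G \<le> \<nu>" "(1 - 20 / 9 * real t * \<delta>) * \<nu> \<le> G" "9 * (G - Q) \<le> \<nu>"
    and t: "20 * real t * \<delta> \<le> 1" and c: "0 \<le> c"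
  shows "(gauss \<delta> z - c) * \<nu> \<le> Q * (gauss \<delta> (z - 1) - c) + (G - Q) * (gauss \<delta> (z + 1) - c)"
proof -
  define r where "r = real z"
  have r: "2 \<le> r" "real t \<le> r" using z by (auto simp: r_def)
  have g1: "gauss \<delta> (z - 1) = gauss \<delta> z * exp (6 * \<delta> * (2 * r - 1))"
    using z unfolding gauss_def r_def
    by (simp flip: exp_add add: of_nat_diff power2_eq_square algebra_simps)
  have g2: "gauss \<delta> (z + 1) = gauss \<delta> z * exp (- (6 * \<delta> * (2 * r + 1)))"
    unfolding gauss_def r_def by (simp flip: exp_add add: power2_eq_square algebra_simps)
  have e1: "1 + 6 * \<delta> * (2 * r - 1) \<le> exp (6 * \<delta> * (2 * r - 1))"
    and e2: "1 - 6 * \<delta> * (2 * r + 1) \<le> exp (- (6 * \<delta> * (2 * r + 1)))"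
    using exp_ge_add_one_self[of "6 * \<delta> * (2 * r - 1)"] exp_ge_add_one_self[of "- (6 * \<delta> * (2 * r + 1))"] by auto
  have nu: "0 \<le> \<nu>" using G by linarith
  have tn: "20 / 9 * real t * \<delta> * \<nu> \<le> 1 / 9 * \<nu>" by (rule mult_right_mono[OF _ nu]) (use t in linarith)
  have tr: "20 / 9 * real t * \<delta> * \<nu> \<le> 20 / 9 * r * \<delta> * \<nu>"
    using r d nu by (intro mult_right_mono) auto
  \<comment> \<open>To first order the drift gains \<open>12 * \<delta> * r * (2 / 3 * \<nu>) = 8 *
    \<delta> * r * \<nu>\<close>. Against it stand the lost values, at most
    \<open>20 / 9 * \<delta> * r * \<nu>\<close>, and the term \<open>6 * \<delta> * \<nu>\<close>,
    at most \<open>3 * \<delta> * r * \<nu>\<close> because \<open>r\<close> is at least 2. The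
    factor 6 in \<open>gauss\<close> is large enough for the gain to win.\<close>
  have "2 / 3 * \<nu> \<le> G - 2 * (G - Q)" using G(4,5) tn by (simp add: algebra_simps)
  then have p1: "12 * \<delta> * r * (2 / 3 * \<nu>) \<le> 12 * \<delta> * r * (G - 2 * (G - Q))"
    using d r by (intro mult_left_mono) auto
  have p2: "6 * \<delta> * G \<le> 6 * \<delta> * \<nu>" using d G by (intro mult_left_mono) auto
  have p3: "\<delta> * \<nu> * 2 \<le> \<delta> * \<nu> * r" using d nu r by (intro mult_left_mono) auto
  have "\<nu> \<le> Q * (1 + 6 * \<delta> * (2 * r - 1)) + (G - Q) * (1 - 6 * \<delta> * (2 * r + 1))"
    using p1 p2 p3 tr G(4) mult_nonneg_nonneg[OF d nu] by (simp add: algebra_simps)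
  also have "\<dots> \<le> Q * exp (6 * \<delta> * (2 * r - 1)) + (G - Q) * exp (- (6 * \<delta> * (2 * r + 1)))"
    using e1 e2 G by (intro add_mono mult_left_mono) auto
  finally have "gauss \<delta> z * \<nu> \<le> gauss \<delta> z * (Q * exp (6 * \<delta> * (2 * r - 1)) + (G - Q) * exp (- (6 * \<delta> * (2 * r + 1))))"
    by (intro mult_left_mono) (auto simp: gauss_def)
  also have "\<dots> = Q * gauss \<delta> (z - 1) + (G - Q) * gauss \<delta> (z + 1)" unfolding g1 g2 by (simp add: algebra_simps)
  finally have "gauss \<delta> z * \<nu> \<le> Q * gauss \<delta> (z - 1) + (G - Q) * gauss \<delta> (z + 1)" .
  moreover have "c * G \<le> c * \<nu>" using c G by (intro mult_left_mono) auto
  ultimately show ?thesis by (simp add: algebra_simps)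
qed

locale bin_clique_refutation = bin_clique +
  fixes P :: "(nat \<times> nat) step list"
  assumes ref: "is_refutation (bc_vars (k * n) k) (BinClique (k * n) E k) P"
    and \<delta>_nonneg: "0 \<le> \<delta>"
begin

definition dep :: "nat \<Rightarrow> nat" where
  "dep v = depths P ! v"

definition fals :: "nat \<Rightarrow> nat set \<Rightarrow> ((nat \<Rightarrow> nat) \<Rightarrow> nat \<Rightarrow> nat) \<Rightarrow> bool" where
  "fals v W \<sigma> \<longleftrightarrow> (\<forall>x\<in>adm W. \<not> sat_clause (asg (\<sigma> x)) (line (P ! v)))"

text \<open>The last conjunct says that the points of the new state are points of the old
  one.\<close>

definition refines :: "nat set \<Rightarrow> (nat \<Rightarrow> nat set) \<Rightarrow> ((nat \<Rightarrow> nat) \<Rightarrow> nat \<Rightarrow> nat) \<Rightarrow>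
    nat set \<Rightarrow> (nat \<Rightarrow> nat set) \<Rightarrow> ((nat \<Rightarrow> nat) \<Rightarrow> nat \<Rightarrow> nat) \<Rightarrow> bool" where
  "refines W0 P0 \<sigma>0 W Q \<sigma> \<longleftrightarrow> cfg W Q \<sigma> \<and> W0 \<subseteq> W \<and> (\<forall>i\<in>W0. Q i = P0 i) \<and>
     (\<forall>x\<in>adm W. \<sigma>0 (\<sigma> x) = \<sigma> x)"

text \<open>\<open>\<sigma> z = z\<close> marks \<open>z\<close> as a point of the state that
  reaches \<open>w\<close>, so probabilities become counts of points. Progress is a drop of
  \<open>dep\<close>, which weakening steps leave unchanged.\<close>

definition good :: "nat set \<Rightarrow> (nat \<Rightarrow> nat set) \<Rightarrow> ((nat \<Rightarrow> nat) \<Rightarrow> nat \<Rightarrow> nat) \<Rightarrow>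
    nat \<Rightarrow> nat \<Rightarrow> nat \<Rightarrow> (nat \<Rightarrow> nat) \<Rightarrow> bool" where
  "good W0 P0 \<sigma>0 d v w z \<longleftrightarrow> w < length P \<and> dep w + d \<le> dep v \<and>
     (\<exists>W Q \<sigma>. refines W0 P0 \<sigma>0 W Q \<sigma> \<and> fals w W \<sigma> \<and> \<sigma> z = z)"

lemma
  assumes "v < length P"
  shows valid: "valid_step (BinClique (k * n) E k) P v (P ! v)"
    and finite_line: "e \<in> line (P ! v) \<Longrightarrow> finite (fst e)"
    and line_vars: "e \<in> line (P ! v) \<Longrightarrow> fst e \<subseteq> bc_vars (k * n) k"
  using ref assms unfolding is_refutation_def wf_clause_def by blast+

lemma dep_eq: "v < length P \<Longrightarrow> dep v = step_depth (take v (depths P)) (P ! v)"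
  unfolding dep_def by (rule depths_nth)

lemma dep_Res: "v < length P \<Longrightarrow> P ! v = Res i j C \<Longrightarrow> Suc (dep i) \<le> dep v \<and> Suc (dep j) \<le> dep v"
  using dep_eq[of v] valid[of v] by (simp add: dep_def)

lemma dep_Weak: "v < length P \<Longrightarrow> P ! v = Weak i C \<Longrightarrow> dep i = dep v"
  using dep_eq[of v] valid[of v] by (simp add: dep_def)

lemma good_mono:
  assumes "good W0 P0 \<sigma>0 d v w z" "dep v + d' \<le> dep v' + d"
  shows "good W0 P0 \<sigma>0 d' v' w z"
  using assms unfolding good_def by auto

lemma card_good_mono:
  assumes "finite X" "dep v + d' \<le> dep v' + d"
  shows "real (card {x \<in> X. \<exists>w. good W0 P0 \<sigma>0 d v w (s x)}) \<le>
    real (card {x \<in> X. \<exists>w. good W0 P0 \<sigma>0 d' v' w (s x)})"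
proof -
  have "{x \<in> X. \<exists>w. good W0 P0 \<sigma>0 d v w (s x)} \<subseteq> {x \<in> X. \<exists>w. good W0 P0 \<sigma>0 d' v' w (s x)}"
    using good_mono[OF _ assms(2)] by blast
  then show ?thesis using assms(1) by (simp add: card_mono)
qed

definition nbh :: "nat set \<Rightarrow> (nat \<Rightarrow> nat set) \<Rightarrow> nat \<Rightarrow> nat set" where
  "nbh W Q i = {u. u < n \<and> (\<forall>j\<in>W. \<forall>w\<in>Q j. adj j w i u)}"

lemma card_nbh:
  assumes V: "finite V" "V \<subseteq> {..<k}" "i \<notin> V" "i < k" "\<And>j. j \<in> V \<Longrightarrow> thin (Q j)"
    and X: "X \<subseteq> {..<n}"
  shows "real (card (X - nbh V Q i)) \<le> 2 * real (card V) * \<delta> * real n"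
proof -
  have "card (X - nbh V Q i) \<le> card {v. v < n \<and> (\<exists>j\<in>V. \<exists>w\<in>Q j. \<not> adj j w i v)}"
    using X by (intro card_mono) (auto simp: nbh_def)
  then show ?thesis using card_nonadj[where P = Q, OF V] by linarith
qed

lemma fals_Res:
  assumes v: "v < length P" "P ! v = Res i j C"
  obtains F where "finite F" "F \<subseteq> bc_vars (k * n) k" "i < v" "j < v"
    "\<forall>W \<sigma> b. fals v W \<sigma> \<longrightarrow> (\<forall>x\<in>adm W. odd (card {a \<in> F. asg (\<sigma> x) a}) = b) \<longrightarrow>
      fals (if b then j else i) W \<sigma>"
proof -
  obtain f where f: "i < v" "j < v" "(f, True) \<in> line (P ! i)" "(f, False) \<in> line (P ! j)"
    "C = (line (P ! i) - {(f, True)}) \<union> (line (P ! j) - {(f, False)})"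
    using valid[OF v(1)] v(2) by auto
  show thesis
  proof (rule that[of f])
    show "finite f" "f \<subseteq> bc_vars (k * n) k"
      using finite_line[of i "(f, True)"] line_vars[of i "(f, True)"] f v by auto
    show "i < v" "j < v" by (rule f)+
    have "fals (if b then j else i) W \<sigma>"
      if fv: "fals v W \<sigma>" and b: "\<forall>x\<in>adm W. odd (card {a \<in> f. asg (\<sigma> x) a}) = b" for W \<sigma> b
    proof -
      have "\<not> sat_eq (asg (\<sigma> x)) e"
        if x: "x \<in> adm W" "e \<in> line (P ! (if b then j else i))" for x e
      proof (cases "e = (f, \<not> b)")
        case True
        then show ?thesis using b x(1) by (auto simp: sat_eq_def)
      next
        case False
        then have "e \<in> line (P ! v)" using x(2) f(5) v(2) by (auto split: if_splits)
        then show ?thesis using fv x(1) unfolding fals_def sat_clause_def by blast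
      qed
      then show ?thesis unfolding fals_def sat_clause_def by blast
    qed
    then show "\<forall>W \<sigma> b. fals v W \<sigma> \<longrightarrow> (\<forall>x\<in>adm W. odd (card {a \<in> f. asg (\<sigma> x) a}) = b) \<longrightarrow>
      fals (if b then j else i) W \<sigma>" by blast
  qed
qed

lemma fals_Weak:
  assumes "v < length P" "P ! v = Weak i C" "fals v W \<sigma>"
  shows "i < v" "fals i W \<sigma>"
  using valid[OF assms(1)] assms(2,3) unfolding fals_def by auto

lemma not_fals_Ax:
  assumes "v < length P" "P ! v = Ax C" "cfg W Q \<sigma>"
  shows "\<not> fals v W \<sigma>"
  using axiom_satisfiable[of C W Q \<sigma>] valid[OF assms(1)] assms(2,3) unfolding fals_def by auto

lemma refines_step:
  assumes "refines W0 P0 \<sigma>0 W Q \<sigma>" "i \<notin> W" "cfg (insert i W) (Q(i := R)) (\<lambda>x. \<sigma> (x(i := s x)))"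
    and "\<And>x. x \<in> adm (insert i W) \<Longrightarrow> s x < n"
  shows "refines W0 P0 \<sigma>0 (insert i W) (Q(i := R)) (\<lambda>x. \<sigma> (x(i := s x)))"
proof -
  have "\<sigma>0 (\<sigma> (x(i := s x))) = \<sigma> (x(i := s x))" if "x \<in> adm (insert i W)" for x
  proof -
    have "x(i := s x) \<in> adm W" using that assms(4)[OF that] by (auto simp: adm_def)
    then show ?thesis using assms(1) by (simp add: refines_def)
  qed
  then show ?thesis using assms(1,2,3) unfolding refines_def by auto
qed

lemma fals_step:
  assumes "fals v W \<sigma>" "\<And>x. x \<in> adm (insert i W) \<Longrightarrow> s x < n"
  shows "fals v (insert i W) (\<lambda>x. \<sigma> (x(i := s x)))"
proof -
  have "x(i := s x) \<in> adm W" if "x \<in> adm (insert i W)" for x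
    using that assms(2)[OF that] by (auto simp: adm_def)
  then show ?thesis using assms(1) unfolding fals_def by blast
qed

text \<open>Randomness is a uniform point of the product of the sets \<open>N i\<close>, the common
  neighbours of the initial blocks. This reference set stays the same during the walk, so the size
  of \<open>W0\<close> enters only through \<open>K\<close>, not through the losses. The cutoff
  \<open>gauss \<delta> K\<close> makes the claim void once about \<open>K\<close> blocks are used
  up.\<close>

lemma walk:
  assumes base: "cfg W0 P0 \<sigma>0" and K: "20 * real (card W0 + K) * \<delta> \<le> 1"
    and c: "refines W0 P0 \<sigma>0 W Q \<sigma>" "v < length P" "fals v W \<sigma>"
  defines "N \<equiv> nbh W0 P0"
  shows "(gauss \<delta> (card (W - W0) + 2 * d) - gauss \<delta> K) * real (card (PiE ({..<k} - W) N))
    \<le> real (card {x \<in> PiE ({..<k} - W) N. \<exists>w. good W0 P0 \<sigma>0 d v w (\<sigma> x)})"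
  using c
\<comment> \<open>Passing to a premise lowers \<open>v\<close>; fixing a block without progress
  keeps \<open>v\<close> but increases \<open>card (W - W0)\<close>, which is below \<open>K\<close>
  whenever a step is made there.\<close>
proof (induction "v + (K - card (W - W0))" arbitrary: v W Q \<sigma> d rule: less_induct)
  case less
  define t where "t = card (W - W0)"
  let ?U = "{..<k} - W"
  let ?gd = "\<lambda>d v z. \<exists>w. good W0 P0 \<sigma>0 d v w z"
  note r = less.prems(1) and v = less.prems(2) and fv = less.prems(3)
  have c: "cfg W Q \<sigma>" and W0W: "W0 \<subseteq> W" and QP: "\<And>i. i \<in> W0 \<Longrightarrow> Q i = P0 i"
    using r by (auto simp: refines_def)
  have Nn: "N i \<subseteq> {..<n}" for i by (auto simp: N_def nbh_def)
  have finN: "finite (N i)" for i by (rule finite_subset[OF Nn]) simp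
  have finX: "finite (PiE V N)" if "finite V" for V using that finN by (intro finite_PiE) auto
  have Xadm: "x \<in> adm W" if "x \<in> PiE ?U N" for x
    using PiE_mem[OF that] Nn unfolding adm_def by blast
  show ?case
  proof (cases "K \<le> t + 2 * d")
    case True
    then have "gauss \<delta> (t + 2 * d) - gauss \<delta> K \<le> 0" using gauss_antimono[OF \<delta>_nonneg] by simp
    then have "(gauss \<delta> (t + 2 * d) - gauss \<delta> K) * real (card (PiE ?U N)) \<le> 0"
      by (rule mult_nonpos_nonneg) simp
    then show ?thesis unfolding t_def by linarith
  next
    case tK: False
    show ?thesis
    proof (cases "d = 0")
      case True
      have "good W0 P0 \<sigma>0 d v v (\<sigma> x)" for x
        unfolding good_def using v fv r True cfg_idem[OF c] by auto
      then have "{x \<in> PiE ?U N. ?gd d v (\<sigma> x)} = PiE ?U N" by blast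
      moreover have "gauss \<delta> (t + 2 * d) - gauss \<delta> K \<le> 1"
        using gauss_bounds[of \<delta>] \<delta>_nonneg by (smt (verit))
      ultimately show ?thesis unfolding t_def using mult_right_mono[of _ 1 "real (card (PiE ?U N))"] by simp
    next
      case d: False
      show ?thesis
      proof (cases "P ! v")
        case (Ax C)
        then show ?thesis using not_fals_Ax[OF v _ c] fv by blast
      next
        case (Weak i C)
        note i = fals_Weak[OF v Weak fv]
        have "(gauss \<delta> (card (W - W0) + 2 * d) - gauss \<delta> K) * real (card (PiE ?U N))
            \<le> real (card {x \<in> PiE ?U N. ?gd d i (\<sigma> x)})"
          by (rule less.hyps[OF _ r _ i(2)]) (use i(1) v in auto)
        also have "\<dots> \<le> real (card {x \<in> PiE ?U N. ?gd d v (\<sigma> x)})"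
          by (rule card_good_mono) (use finX dep_Weak[OF v Weak] in auto)
        finally show ?thesis .
      next
        case (Res i j C)
        obtain F where F: "finite F" "F \<subseteq> bc_vars (k * n) k" "i < v" "j < v"
          and child': "\<forall>W \<sigma> b. fals v W \<sigma> \<longrightarrow> (\<forall>x\<in>adm W. odd (card {a \<in> F. asg (\<sigma> x) a}) = b) \<longrightarrow>
            fals (if b then j else i) W \<sigma>"
          by (rule fals_Res[OF v Res]) (rule that; assumption)
        have child: "fals (if b then j else i) W \<sigma>"
          if "fals v W \<sigma>" "\<And>x. x \<in> adm W \<Longrightarrow> odd (card {a \<in> F. asg (\<sigma> x) a}) = b" for W \<sigma> b
          using child'[rule_format, of W \<sigma> b] that by auto
        have dch: "dep (if b then j else i) + d \<le> dep v + (d - 1)" for b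
          using dep_Res[OF v Res] d by auto
        have vch: "(if b then j else i) < v" for b using F by simp
        obtain S c where S: "S \<subseteq> vars W" and
          Sc: "\<forall>x\<in>adm W. odd (card {a \<in> F. asg (\<sigma> x) a}) = (par S x \<noteq> c)"
          using cfg_pull_form[OF \<open>cfg W Q \<sigma>\<close> F(1,2)] by (elim exE conjE) (rule that)
        note S = S bspec[OF Sc]
        show ?thesis
        proof (cases "S = {}")
          \<comment> \<open>A constant form costs nothing: no block is fixed, and the argument of
            \<open>gauss\<close> drops by 2.\<close>
          case True
          have f: "fals (if c then j else i) W \<sigma>" by (rule child[OF fv]) (use S(2) True in auto)
          have "(gauss \<delta> (t + 2 * d) - gauss \<delta> K) * real (card (PiE ?U N))
            \<le> (gauss \<delta> (t + 2 * (d - 1)) - gauss \<delta> K) * real (card (PiE ?U N))"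
            using gauss_antimono[OF \<delta>_nonneg, of "t + 2 * (d - 1)" "t + 2 * d"]
            by (intro mult_right_mono) auto
          also have "\<dots> \<le> real (card {x \<in> PiE ?U N. ?gd (d - 1) (if c then j else i) (\<sigma> x)})"
            unfolding t_def by (rule less.hyps[OF _ r _ f]) (use vch[of c] v in auto)
          also have "\<dots> \<le> real (card {x \<in> PiE ?U N. ?gd d v (\<sigma> x)})"
            by (rule card_good_mono) (use finX dch[of c] in auto)
          finally show ?thesis unfolding t_def .
        next
          case False
          then obtain h a where ha: "(h, a) \<in> S" by auto
          then have h: "h < k" "h \<notin> W" "a < l" using S(1) by (auto simp: vars_def)
          have finS: "finite S" using S(1) finite_vars finite_subset by blast
          let ?Y = "PiE (?U - {h}) N"
          have Ueq: "{..<k} - insert h W = ?U - {h}" by auto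
          have card': "card (insert h W - W0) = Suc t"
          proof -
            have "insert h W - W0 = insert h (W - W0)" using h(2) W0W by blast
            then show ?thesis using h(2) cfg_finite[OF \<open>cfg W Q \<sigma>\<close>] by (simp add: t_def)
          qed
          have tK': "t < K" using tK by simp
          define g where "g u = real (card {y \<in> ?Y. ?gd d v (\<sigma> (y(h := u)))})" for u
          define D where "D = N h \<inter> nbh W Q h"
          define Pr where "Pr = {u \<in> D. flip_bit a u \<in> D}"
          define Y where "Y = real (card ?Y)"
          define h1 where "h1 = gauss \<delta> (t + 2 * d - 1) - gauss \<delta> K"
          define h2 where "h2 = gauss \<delta> (t + 2 * d + 1) - gauss \<delta> K"
          have Dn: "u < n" if "u \<in> D" for u using that by (auto simp: D_def nbh_def)
          have finD: "finite D" using finN by (simp add: D_def)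
          have rob: "robust (insert h W) (Q(h := R))" if "R \<subseteq> D" for R
            by (rule robust_insert[OF cfg_robust[OF \<open>cfg W Q \<sigma>\<close>] h(2)])
              (use that in \<open>auto simp: D_def nbh_def\<close>)
          \<comment> \<open>The bound for values with inadmissible partner: block \<open>h\<close>
            is fixed, while the line and \<open>d\<close> stay the same.\<close>
          have single: "h2 * Y \<le> g u" if u: "u \<in> D" for u
          proof -
            have th: "thin {u}" using Dn[OF u] h by (auto simp: thin_def)
            have "cfg (insert h W) (Q(h := {u})) (\<lambda>x. \<sigma> (x(h := u)))"
              by (rule cfg_single[OF \<open>cfg W Q \<sigma>\<close> h(1,2) th]) (use rob[of "{u}"] u in auto)
            then have r': "refines W0 P0 \<sigma>0 (insert h W) (Q(h := {u})) (\<lambda>x. \<sigma> (x(h := u)))"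
              using Dn[OF u] by (intro refines_step[OF r h(2)])
            have f': "fals v (insert h W) (\<lambda>x. \<sigma> (x(h := u)))"
              using Dn[OF u] by (intro fals_step[OF fv])
            have "(gauss \<delta> (card (insert h W - W0) + 2 * d) - gauss \<delta> K) * real (card (PiE ({..<k} - insert h W) N))
              \<le> real (card {x \<in> PiE ({..<k} - insert h W) N. ?gd d v (\<sigma> (x(h := u)))})"
              by (rule less.hyps[OF _ r' v f']) (use tK' card' in \<open>simp add: t_def\<close>)
            then show ?thesis unfolding Ueq card' h2_def Y_def g_def by simp
          qed
          \<comment> \<open>For each choice of the other blocks, the picks for
            \<open>b = True\<close> and \<open>b = False\<close> are the two members of the pair in
            some order. So the two premises together account for all points above \<open>u\<close>
            and its partner, although neither value alone decides the query.\<close>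
          have pair: "2 * h1 * Y \<le> g u + g (flip_bit a u)" if u: "u \<in> Pr" for u
          proof -
            have uD: "u \<in> D" "{u, flip_bit a u} \<subseteq> D" using u by (auto simp: Pr_def)
            define q where "q b = real (card {y \<in> ?Y. ?gd d v (\<sigma> (y(h := pick h a u S b y)))})" for b
            have pn: "pick h a u S b x < n" for b x using uD Dn by (simp add: pick_def)
            have q: "h1 * Y \<le> q b" for b
            proof -
              let ?s = "pick h a u S b" and ?v = "if b \<noteq> c then j else i"
              have "cfg (insert h W) (Q(h := {u, flip_bit a u})) (\<lambda>x. \<sigma> (x(h := ?s x)))"
                by (rule cfg_pair[OF \<open>cfg W Q \<sigma>\<close> h(1,2,3) Dn[OF uD(1)] rob[OF uD(2)] S(1) ha])
              then have r': "refines W0 P0 \<sigma>0 (insert h W) (Q(h := {u, flip_bit a u})) (\<lambda>x. \<sigma> (x(h := ?s x)))"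
                using pn by (intro refines_step[OF r h(2)])
              have f': "fals ?v (insert h W) (\<lambda>x. \<sigma> (x(h := ?s x)))"
              proof (rule child)
                show "fals v (insert h W) (\<lambda>x. \<sigma> (x(h := ?s x)))" using pn by (intro fals_step[OF fv])
                fix x assume "x \<in> adm (insert h W)"
                then have "x(h := ?s x) \<in> adm W" using pn by (auto simp: adm_def)
                then show "odd (card {a \<in> F. asg (\<sigma> (x(h := ?s x))) a}) = (b \<noteq> c)"
                  unfolding S(2)[OF \<open>x(h := ?s x) \<in> adm W\<close>] par_pick[OF finS ha] by simp
              qed
              have "(gauss \<delta> (card (insert h W - W0) + 2 * (d - 1)) - gauss \<delta> K) *
                  real (card (PiE ({..<k} - insert h W) N))
                \<le> real (card {x \<in> PiE ({..<k} - insert h W) N. ?gd (d - 1) ?v (\<sigma> (x(h := ?s x)))})"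
                by (rule less.hyps[OF _ r' _ f']) (use tK' card' vch[of "b \<noteq> c"] v in \<open>auto simp: t_def\<close>)
              also have "\<dots> \<le> q b"
                unfolding q_def Ueq by (rule card_good_mono) (use finX dch[of "b \<noteq> c"] in auto)
              also have "card (insert h W - W0) + 2 * (d - 1) = t + 2 * d - 1" using d card' by simp
              finally show ?thesis unfolding Ueq h1_def Y_def .
            qed
            have "card {y \<in> ?Y. \<phi> y} = (\<Sum>y\<in>?Y. if \<phi> y then 1 else 0)" for \<phi>
              using finX[of "?U - {h}"] by (simp add: sum.If_cases Int_def)
            then have "g u + g (flip_bit a u) = q True + q False"
              unfolding g_def q_def of_nat_add[symmetric] sum.distrib[symmetric] of_nat_eq_iff
              by (simp only: sum.distrib[symmetric]) (rule sum.cong, auto simp: pick_def)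
            then show ?thesis using q[of True] q[of False] by linarith
          qed
          have finPr: "finite Pr" "Pr \<subseteq> D" using finD by (auto simp: Pr_def)
          have "2 * (\<Sum>u\<in>Pr. g u) = (\<Sum>u\<in>Pr. g u) + (\<Sum>u\<in>Pr. g (flip_bit a u))"
          proof -
            have "(\<Sum>u\<in>Pr. g (flip_bit a u)) = (\<Sum>u\<in>Pr. g u)"
              by (rule sum.reindex_bij_witness[of _ "flip_bit a" "flip_bit a"]) (auto simp: Pr_def)
            then show ?thesis by simp
          qed
          also have "\<dots> = (\<Sum>u\<in>Pr. g u + g (flip_bit a u))" by (simp add: sum.distrib)
          also have "\<dots> \<ge> (\<Sum>u\<in>Pr. 2 * h1 * Y)" by (rule sum_mono) (rule pair)
          finally have sPr: "real (card Pr) * (h1 * Y) \<le> (\<Sum>u\<in>Pr. g u)" by simp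
          have "(\<Sum>u\<in>D - Pr. h2 * Y) \<le> (\<Sum>u\<in>D - Pr. g u)" by (rule sum_mono) (use single in auto)
          then have sD: "(real (card D) - real (card Pr)) * (h2 * Y) \<le> (\<Sum>u\<in>D - Pr. g u)"
            using finPr finD by (simp add: card_Diff_subset of_nat_diff card_mono)
          have "(\<Sum>u\<in>Pr. g u) + (\<Sum>u\<in>D - Pr. g u) = (\<Sum>u\<in>D. g u)"
            using sum.subset_diff[OF finPr(2) finD, of g] by simp
          also have "\<dots> \<le> (\<Sum>u\<in>N h. g u)"
            by (rule sum_mono2) (use finN in \<open>auto simp: D_def g_def\<close>)
          finally have tot: "(real (card Pr) * h1 + (real (card D) - real (card Pr)) * h2) * Y \<le> (\<Sum>u\<in>N h. g u)"
            using sPr sD by (simp add: algebra_simps)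
          have split: "real (card {x \<in> PiE ?U N. ?gd d v (\<sigma> x)}) = (\<Sum>u\<in>N h. g u)"
            unfolding g_def of_nat_sum[symmetric] of_nat_eq_iff
            by (rule card_PiE_split) (use h finN in auto)
          have split1: "real (card (PiE ?U N)) = real (card (N h)) * Y"
            using card_PiE_split[of h ?U N "\<lambda>_. True"] h finN by (simp add: Y_def)
          define \<nu> where "\<nu> = real (card (N h))"
          have cW: "card W = card W0 + t"
            using W0W cfg_finite[OF \<open>cfg W Q \<sigma>\<close>] unfolding t_def
            by (metis card_Diff_subset card_mono le_add_diff_inverse finite_subset)
          have "20 * real (card W0 + t) * \<delta> \<le> 20 * real (card W0 + K) * \<delta>"
            using tK' \<delta>_nonneg by (intro mult_right_mono) auto
          then have small: "20 * real (card W) * \<delta> \<le> 1" using K cW by simp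
          have le: "m * \<delta> * real n \<le> real n" if "m * \<delta> \<le> 1" for m
            using mult_right_mono[OF that, of "real n"] by simp
          have n1: "real n - \<nu> \<le> 2 * real (card W0) * \<delta> * real n"
          proof -
            have "{..<n} = N h \<union> ({..<n} - N h)" using Nn by auto
            then have "n \<le> card (N h) + card ({..<n} - N h)" by (metis card_Un_le card_lessThan)
            moreover have "real (card ({..<n} - nbh W0 P0 h)) \<le> 2 * real (card W0) * \<delta> * real n"
              by (rule card_nbh) (use cfg_finite[OF base] cfg_W[OF base] cfg_thin[OF base] h W0W in auto)
            ultimately show ?thesis unfolding \<nu>_def N_def by linarith
          qed
          have Deq: "D = N h \<inter> nbh (W - W0) Q h"
            using QP by (auto simp: D_def N_def nbh_def)
          \<comment> \<open>This is the only real loss, and relative to \<open>N h\<close> it is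
            caused by the \<open>t\<close> new blocks alone. The unpaired values counted in
            \<open>n3\<close> involve all of \<open>W\<close> but cost only progress; at most
            \<open>n / 10\<close>, they are a ninth of \<open>\<nu>\<close>.\<close>
          have n2: "\<nu> - real (card D) \<le> 2 * real t * \<delta> * real n"
          proof -
            have "real (card (N h - nbh (W - W0) Q h)) \<le> 2 * real (card (W - W0)) * \<delta> * real n"
              by (rule card_nbh) (use cfg_finite[OF c] cfg_W[OF c] cfg_thin[OF c] h Nn in auto)
            moreover have "card (N h) = card D + card (N h - nbh (W - W0) Q h)"
              unfolding Deq using finN by (subst card_Un_disjoint[symmetric]) (auto intro: arg_cong[where f = card])
            ultimately show ?thesis by (simp add: \<nu>_def t_def)
          qed
          have n3: "real (card D) - real (card Pr) \<le> 2 * real (card W) * \<delta> * real n"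
          proof -
            have "D - Pr \<subseteq> {u. flip_bit a u \<in> {..<n} - nbh W Q h}"
            proof
              fix u assume "u \<in> D - Pr"
              then have u: "u \<in> D" "flip_bit a u \<notin> D" by (auto simp: Pr_def)
              have "flip_bit a u < n" using flip_bit_less[of u l a] Dn[OF u(1)] h(3) by (simp only: n_eq)
              moreover have "nbh W Q h \<subseteq> N h" using W0W QP by (auto simp: nbh_def N_def)
              ultimately show "u \<in> {u. flip_bit a u \<in> {..<n} - nbh W Q h}" using u(2) by (auto simp: D_def)
            qed
            then have "card (D - Pr) \<le> card {u. flip_bit a u \<in> {..<n} - nbh W Q h}"
              by (intro card_mono card_flip_preimage) auto
            also have "\<dots> \<le> card ({..<n} - nbh W Q h)" by (rule card_flip_preimage) auto
            finally have "card (D - Pr) \<le> card ({..<n} - nbh W Q h)" .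
            moreover have "real (card ({..<n} - nbh W Q h)) \<le> 2 * real (card W) * \<delta> * real n"
              by (rule card_nbh) (use cfg_finite[OF c] cfg_W[OF c] cfg_thin[OF c] h in auto)
            moreover have "card (D - Pr) = card D - card Pr" "card Pr \<le> card D"
              using finPr finD by (auto intro: card_Diff_subset card_mono)
            ultimately show ?thesis by (simp add: of_nat_diff)
          qed
          have nuge: "9 * real n \<le> 10 * \<nu>"
            using n1 le[of "20 * real (card W)"] small cW
              mult_nonneg_nonneg[OF mult_nonneg_nonneg[OF \<delta>_nonneg, of "real n"], of "real t"]
            by (simp add: algebra_simps)
          have "(gauss \<delta> (t + 2 * d) - gauss \<delta> K) * \<nu> \<le>
              real (card Pr) * (gauss \<delta> (t + 2 * d - 1) - gauss \<delta> K) +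
              (real (card D) - real (card Pr)) * (gauss \<delta> (t + 2 * d + 1) - gauss \<delta> K)"
          proof (rule gauss_step[OF \<delta>_nonneg refl])
            show "1 \<le> d" using d by simp
            show "0 \<le> real (card Pr)" by simp
            show "real (card Pr) \<le> real (card D)" using finPr finD by (simp add: card_mono)
            show "real (card D) \<le> \<nu>" using finN by (simp add: \<nu>_def D_def card_mono)
            have "2 * real t * \<delta> * (9 * real n) \<le> 2 * real t * \<delta> * (10 * \<nu>)"
              using nuge \<delta>_nonneg by (intro mult_left_mono) auto
            then show "(1 - 20 / 9 * real t * \<delta>) * \<nu> \<le> real (card D)" using n2 by (simp add: algebra_simps)
            show "9 * (real (card D) - real (card Pr)) \<le> \<nu>" using n3 nuge le[OF small] by (simp add: algebra_simps)
            show "20 * real t * \<delta> \<le> 1"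
              using small cW mult_nonneg_nonneg[OF \<delta>_nonneg, of "real (card W0)"]
              by (simp add: algebra_simps)
            show "0 \<le> gauss \<delta> K" by (simp add: gauss_def)
          qed
          then have "(gauss \<delta> (t + 2 * d) - gauss \<delta> K) * \<nu> * Y \<le>
              (real (card Pr) * h1 + (real (card D) - real (card Pr)) * h2) * Y"
            unfolding h1_def h2_def by (intro mult_right_mono) (auto simp: Y_def)
          also have "\<dots> \<le> real (card {x \<in> PiE ?U N. ?gd d v (\<sigma> x)})" using tot split by simp
          finally show ?thesis unfolding split1 \<nu>_def t_def by (simp add: mult_ac)
        qed
      qed
    qed
  qed
qed

section \<open>One phase and its iteration\<close>

lemma finite_nbh: "finite (nbh W Q i)"
  by (simp add: nbh_def)

lemma card_nbh_ge:
  assumes c: "cfg W Q \<sigma>" and W: "20 * real (card W) * \<delta> \<le> 1" and i: "i < k" "i \<notin> W"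
  shows "9 * real n \<le> 10 * real (card (nbh W Q i))"
proof -
  have "{..<n} = nbh W Q i \<union> ({..<n} - nbh W Q i)" by (auto simp: nbh_def)
  then have "n \<le> card (nbh W Q i) + card ({..<n} - nbh W Q i)" by (metis card_Un_le card_lessThan)
  moreover have "real (card ({..<n} - nbh W Q i)) \<le> 2 * real (card W) * \<delta> * real n"
    by (rule card_nbh) (use cfg_finite[OF c] cfg_W[OF c] cfg_thin[OF c] i in auto)
  moreover have "20 * real (card W) * \<delta> * real n \<le> 1 * real n"
    by (rule mult_right_mono[OF W]) simp
  ultimately show ?thesis by linarith
qed

lemma card_PiE_nbh_pos:
  assumes c: "cfg W Q \<sigma>" and W: "20 * real (card W) * \<delta> \<le> 1"
  shows "0 < card (PiE ({..<k} - W) (nbh W Q))"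
proof -
  have "0 < card (nbh W Q i)" if "i \<in> {..<k} - W" for i
    using card_nbh_ge[OF assms, of i] that n_pos by (cases "card (nbh W Q i)") auto
  then show ?thesis by (subst card_PiE) (auto intro!: prod_pos)
qed

lemma length_pos: "0 < length P"
  using ref by (simp add: is_refutation_def)

lemma phase:
  assumes c0: "cfg W0 P0 \<sigma>0" and v: "v < length P" "fals v W0 \<sigma>0"
    and small: "20 * (real (card W0) + 4 * real d) * \<delta> \<le> 1"
    and half: "2 * gauss \<delta> (4 * d) \<le> gauss \<delta> (2 * d)"
    and M: "\<And>m. (9 / 5) ^ m * gauss \<delta> (2 * d) \<le> 2 * real (length P) \<Longrightarrow> real m \<le> M"
    and M_small: "4 * (real (card W0) + M) * \<delta> < 1"
  shows "\<exists>w W Q \<sigma>. w < length P \<and> dep w + d \<le> dep v \<and> cfg W Q \<sigma> \<and> fals w W \<sigma> \<and>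
    real (card W) \<le> real (card W0) + M"
proof -
  let ?N = "nbh W0 P0" and ?U = "{..<k} - W0"
  let ?X = "PiE ?U ?N"
  define X where "X w = {x \<in> ?X. good W0 P0 \<sigma>0 d v w (\<sigma>0 x)}" for w
  have finX: "finite ?X" using finite_nbh by (intro finite_PiE) auto
  have W0s: "20 * real (card W0) * \<delta> \<le> 1"
    using small mult_nonneg_nonneg[OF \<delta>_nonneg, of "real d"] by (simp add: algebra_simps)
  have pos: "0 < real (card ?X)" using card_PiE_nbh_pos[OF c0 W0s] by simp
  have adm: "x \<in> adm W0" if "x \<in> ?X" for x
    using PiE_mem[OF that] unfolding adm_def nbh_def by blast
  have "refines W0 P0 \<sigma>0 W0 P0 \<sigma>0"
    using c0 cfg_idem[OF c0] by (simp add: refines_def)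
  \<comment> \<open>The cutoff is \<open>K = 4 * d\<close>; by \<open>half\<close>, subtracting it
    takes away at most half of the success probability.\<close>
  then have "(gauss \<delta> (card (W0 - W0) + 2 * d) - gauss \<delta> (4 * d)) * real (card ?X)
      \<le> real (card {x \<in> ?X. \<exists>w. good W0 P0 \<sigma>0 d v w (\<sigma>0 x)})"
    by (intro walk[OF c0 _ _ v]) (use small in \<open>auto simp: algebra_simps\<close>)
  moreover have "gauss \<delta> (2 * d) / 2 * real (card ?X) \<le> (gauss \<delta> (2 * d) - gauss \<delta> (4 * d)) * real (card ?X)"
    using half by (intro mult_right_mono) auto
  moreover have "{x \<in> ?X. \<exists>w. good W0 P0 \<sigma>0 d v w (\<sigma>0 x)} = (\<Union>w<length P. X w)"
    by (auto simp: X_def good_def)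
  ultimately have lower: "gauss \<delta> (2 * d) / 2 * real (card ?X) \<le> real (card (\<Union>w<length P. X w))" by simp
  \<comment> \<open>Pigeonhole: the line reached most often costs only a factor
    \<open>length P\<close>.\<close>
  define w where "w = (ARG_MAX (\<lambda>w. card (X w)) w. w < length P)"
  have w: "w < length P" "\<And>u. u < length P \<Longrightarrow> card (X u) \<le> card (X w)"
    using arg_max_nat_lemma[of "\<lambda>w. w < length P" 0 "\<lambda>w. card (X w)" "Suc (card ?X)"] length_pos
      card_mono[OF finX] unfolding w_def X_def by (simp_all add: less_Suc_eq_le)
  have "card (\<Union>w<length P. X w) \<le> (\<Sum>u<length P. card (X u))" by (rule card_UN_le) simp
  also have "\<dots> \<le> (\<Sum>u<length P. card (X w))" by (rule sum_mono) (use w(2) in auto)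
  finally have "card (\<Union>w<length P. X w) \<le> length P * card (X w)" by simp
  then have "real (card (\<Union>w<length P. X w)) \<le> real (length P) * real (card (X w))"
    by (metis of_nat_mono of_nat_mult)
  then have Xw: "gauss \<delta> (2 * d) * real (card ?X) \<le> 2 * real (length P) * real (card (X w))"
    using lower by linarith
  \<comment> \<open>Every state refining the initial one and falsifying \<open>w\<close> has its
    points here. Hence all points of \<open>X w\<close> solve the equations of \<open>Z\<close>,
    while these equations in turn suffice to falsify \<open>w\<close>.\<close>
  define Z where "Z = {z \<in> adm {}. \<sigma>0 z = z \<and> \<not> sat_clause (asg z) (line (P ! w))}"
  have inZ: "\<sigma> x \<in> Z" if "refines W0 P0 \<sigma>0 W Q \<sigma>" "fals w W \<sigma>" "x \<in> adm W" for W Q \<sigma> x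
    using that cfg_adm[of W Q \<sigma> x] unfolding Z_def refines_def fals_def by auto
  obtain A where A: "A \<subseteq> vars W0" "inj_on fst A"
    "\<And>e. e \<in> A \<Longrightarrow> \<exists>S c. (S, c) \<in> eqs W0 Z \<and> S \<inter> A = {e}"
    and contract: "\<And>z W' P' \<sigma>'. 4 * (real (card W0) + real (card A)) * \<delta> < 1 \<Longrightarrow> z \<in> Z \<Longrightarrow> z \<in> adm {} \<Longrightarrow>
      cfg W' P' \<sigma>' \<Longrightarrow> W0 \<subseteq> W' \<Longrightarrow> \<forall>i\<in>W0. P' i = P0 i \<Longrightarrow>
      \<forall>x\<in>adm W'. \<sigma>' x \<in> Z \<Longrightarrow> \<sigma>' z = z \<Longrightarrow>
      \<exists>W P \<sigma>. cfg W P \<sigma> \<and> card W \<le> card W0 + card A \<and>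
        (\<forall>x\<in>adm W. \<sigma>0 (\<sigma> x) = \<sigma> x \<and> (\<forall>S c. (S, c) \<in> eqs W0 Z \<longrightarrow> par S (\<sigma> x) = c))"
    by (rule contract_cfg[OF c0 \<delta>_nonneg, of Z]) (rule that; assumption)
  have sol: "par S x = c" if x: "x \<in> X w" and S: "(S, c) \<in> eqs W0 Z" for x S c
  proof -
    obtain W Q \<sigma> where r: "refines W0 P0 \<sigma>0 W Q \<sigma>" "fals w W \<sigma>" "\<sigma> (\<sigma>0 x) = \<sigma>0 x"
      using x unfolding X_def good_def by blast
    have "\<sigma>0 x \<in> adm W"
      using cfg_adm[OF c0 adm] x adm_mono[of "{}" W] unfolding X_def by blast
    then have "\<sigma>0 x \<in> Z" using inZ[OF r(1,2)] r(3) by metis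
    then have "par S (\<sigma>0 x) = c" using S by (simp add: eqs_def)
    moreover have "par S (\<sigma>0 x) = par S x"
      by (rule par_cong) (use S cfg_out[OF c0] in \<open>auto simp: eqs_def vars_def\<close>)
    ultimately show ?thesis by simp
  qed
  have "(9 / 5) ^ card A * real (card (X w)) \<le> real (card ?X)"
  proof (rule card_solutions[OF A(1,2) refl _ _ A(3)])
    show "?N i \<subseteq> {..<n}" for i by (auto simp: nbh_def)
    show "9 * real n \<le> 10 * real (card (?N i))" if "i \<in> ?U" for i
      using card_nbh_ge[OF c0 W0s] that by blast
    show "S \<subseteq> vars W0" if "(S, c) \<in> eqs W0 Z" for S c using that by (simp add: eqs_def)
    show "X w \<subseteq> ?X" by (auto simp: X_def)
  qed (use sol in auto)
  then have "2 * real (length P) * ((9 / 5) ^ card A * real (card (X w))) \<le> 2 * real (length P) * real (card ?X)"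
    by (rule mult_left_mono) simp
  then have "(9 / 5) ^ card A * (2 * real (length P) * real (card (X w))) \<le> 2 * real (length P) * real (card ?X)"
    by (simp add: mult_ac)
  moreover have "(9 / 5) ^ card A * (gauss \<delta> (2 * d) * real (card ?X)) \<le>
      (9 / 5) ^ card A * (2 * real (length P) * real (card (X w)))"
    by (rule mult_left_mono[OF Xw]) simp
  ultimately have "((9 / 5) ^ card A * gauss \<delta> (2 * d)) * real (card ?X) \<le> 2 * real (length P) * real (card ?X)"
    unfolding mult.assoc by linarith
  then have "(9 / 5) ^ card A * gauss \<delta> (2 * d) \<le> 2 * real (length P)"
    using pos by simp
  then have AM: "real (card A) \<le> M" by (rule M)
  have "4 * (real (card W0) + real (card A)) * \<delta> \<le> 4 * (real (card W0) + M) * \<delta>"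
    using AM \<delta>_nonneg by (intro mult_right_mono) auto
  then have As: "4 * (real (card W0) + real (card A)) * \<delta> < 1" using M_small by linarith
  have "0 < gauss \<delta> (2 * d) * real (card ?X)" using pos gauss_bounds by simp
  then have "X w \<noteq> {}" using Xw by (cases "X w = {}") auto
  then obtain x where x: "x \<in> X w" by blast
  then have good: "good W0 P0 \<sigma>0 d v w (\<sigma>0 x)" by (simp add: X_def)
  then obtain W' Q' \<sigma>' where r: "refines W0 P0 \<sigma>0 W' Q' \<sigma>'" "fals w W' \<sigma>'" "\<sigma>' (\<sigma>0 x) = \<sigma>0 x"
    unfolding good_def by blast
  have zadm: "\<sigma>0 x \<in> adm {}" using cfg_adm[OF c0 adm] x by (simp add: X_def)
  then have "\<sigma>0 x \<in> Z" using inZ[OF r(1,2), of "\<sigma>0 x"] adm_mono[of "{}" W'] r(3) by auto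
  then have "\<exists>W P \<sigma>. cfg W P \<sigma> \<and> card W \<le> card W0 + card A \<and>
        (\<forall>x\<in>adm W. \<sigma>0 (\<sigma> x) = \<sigma> x \<and> (\<forall>S c. (S, c) \<in> eqs W0 Z \<longrightarrow> par S (\<sigma> x) = c))"
    by (rule contract[OF As _ zadm, where W' = W' and P' = Q' and \<sigma>' = \<sigma>'])
      (use r(1,3) inZ[OF r(1,2)] in \<open>auto simp: refines_def\<close>)
  then obtain W Q \<sigma> where c: "cfg W Q \<sigma>" "card W \<le> card W0 + card A"
    "\<And>x. x \<in> adm W \<Longrightarrow> \<sigma>0 (\<sigma> x) = \<sigma> x"
    "\<And>x S c. x \<in> adm W \<Longrightarrow> (S, c) \<in> eqs W0 Z \<Longrightarrow> par S (\<sigma> x) = c" by blast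
  \<comment> \<open>The negation of \<open>e\<close>, pulled back through \<open>\<sigma>0\<close>,
    belongs to \<open>eqs W0 Z\<close> and thus holds on the contracted state.\<close>
  have "\<not> sat_eq (asg (\<sigma> x)) e" if x: "x \<in> adm W" and e: "e \<in> line (P ! w)" for x e
  proof -
    obtain S c where S: "S \<subseteq> vars W0" and
      Sc: "\<forall>x\<in>adm W0. odd (card {a \<in> fst e. asg (\<sigma>0 x) a}) = (par S x \<noteq> c)"
      using cfg_pull_form[OF c0 finite_line[OF w(1) e] line_vars[OF w(1) e]]
      by (elim exE conjE) (rule that)
    have "par S z = (snd e = c)" if z: "z \<in> Z" for z
    proof -
      have "z \<in> adm W0" "\<sigma>0 z = z" "\<not> sat_eq (asg z) e"
        using z e adm_mono[of "{}" W0] by (auto simp: Z_def sat_clause_def)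
      then show ?thesis using bspec[OF Sc, of z] by (auto simp: sat_eq_def)
    qed
    then have "(S, snd e = c) \<in> eqs W0 Z" using S by (simp add: eqs_def)
    then have "par S (\<sigma> x) = (snd e = c)" using c(4)[OF x] by blast
    moreover have "\<sigma> x \<in> adm W0" using cfg_adm[OF c(1) x] adm_mono[of "{}" W0] by blast
    then have "odd (card {a \<in> fst e. asg (\<sigma> x) a}) = (par S (\<sigma> x) \<noteq> c)"
      using bspec[OF Sc] c(3)[OF x] by metis
    ultimately show ?thesis by (auto simp: sat_eq_def)
  qed
  then have "fals w W \<sigma>" unfolding fals_def sat_clause_def by blast
  moreover have "real (card W) \<le> real (card W0) + M" using c(2) AM by linarith
  moreover have "dep w + d \<le> dep v" using good by (simp add: good_def)
  ultimately show ?thesis using w(1) c(1) by blast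
qed

lemma fals_root: "fals (length P - 1) W \<sigma>"
proof -
  have "line (P ! (length P - 1)) = {}"
    using ref last_conv_nth[of P] by (simp add: is_refutation_def)
  then show ?thesis by (simp add: fals_def sat_clause_def)
qed

lemma proof_depth_eq: "proof_depth P = dep (length P - 1)"
  unfolding proof_depth_def dep_def using length_pos
  by (subst last_conv_nth) (auto simp flip: length_greater_0_conv)

lemma depth_ge_phases:
  assumes small: "20 * (real t * M + 4 * real d) * \<delta> \<le> 1"
    and half: "2 * gauss \<delta> (4 * d) \<le> gauss \<delta> (2 * d)"
    and M: "\<And>m. (9 / 5) ^ m * gauss \<delta> (2 * d) \<le> 2 * real (length P) \<Longrightarrow> real m \<le> M" "0 \<le> M"
    and M_small: "4 * (real t * M + M) * \<delta> < 1"
  shows "t * d \<le> proof_depth P"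
proof -
  have "\<exists>w W Q \<sigma>. w < length P \<and> dep w + s * d \<le> proof_depth P \<and> cfg W Q \<sigma> \<and> fals w W \<sigma> \<and>
    real (card W) \<le> real s * M" if "s \<le> t" for s
    using that
  proof (induction s)
    case 0
    then show ?case
      using cfg_id[of "\<lambda>_. {}"] fals_root length_pos unfolding proof_depth_eq
      by (intro exI[of _ "length P - 1"] exI[of _ "{}"] exI conjI) auto
  next
    case (Suc s)
    then obtain w W Q \<sigma> where s: "w < length P" "dep w + s * d \<le> proof_depth P" "cfg W Q \<sigma>" "fals w W \<sigma>"
      "real (card W) \<le> real s * M" by auto
    have le: "real (card W) \<le> real t * M"
      using s(5) mult_right_mono[of "real s" "real t" M] Suc.prems M(2) by linarith
    have 1: "20 * (real (card W) + 4 * real d) * \<delta> \<le> 20 * (real t * M + 4 * real d) * \<delta>"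
      using le \<delta>_nonneg by (intro mult_right_mono) auto
    have 2: "4 * (real (card W) + M) * \<delta> \<le> 4 * (real t * M + M) * \<delta>"
      using le \<delta>_nonneg by (intro mult_right_mono) auto
    obtain w' W' Q' \<sigma>' where "w' < length P" "dep w' + d \<le> dep w" "cfg W' Q' \<sigma>'" "fals w' W' \<sigma>'"
      "real (card W') \<le> real (card W) + M"
      using phase[OF s(3,1,4) order_trans[OF 1 small] half M(1) le_less_trans[OF 2 M_small]] by blast
    moreover from this have "real (card W') \<le> real (Suc s) * M" using s(5) by (simp add: algebra_simps)
    moreover have "dep w' + Suc s * d \<le> proof_depth P" using calculation(2) s(2) by simp
    ultimately show ?case by blast
  qed
  from this[of t] show ?thesis by auto
qed

text \<open>For one walk from the empty configuration, positive success probability suffices, so the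
  size does not enter. This settles refutations of very large size and shows that the depth is
  positive.\<close>

lemma depth_ge_walk:
  assumes "80 * real d * \<delta> \<le> 1" "0 < \<delta>" "0 < d"
  shows "d \<le> proof_depth P"
proof -
  let ?X = "PiE ({..<k} - {}) (nbh {} (\<lambda>_. {}))"
  have "(gauss \<delta> (card ({}::nat set) + 2 * d) - gauss \<delta> (4 * d)) * real (card ?X)
      \<le> real (card {x \<in> ?X. \<exists>w. good {} (\<lambda>_. {}) (\<lambda>x. x) d (length P - 1) w x})"
    using walk[where W = "{}" and Q = "\<lambda>_. {}" and \<sigma> = "\<lambda>x. x" and K = "4 * d" and v = "length P - 1"
        and d = d, OF cfg_id] fals_root length_pos cfg_id assms(1)
    by (simp add: refines_def)
  moreover have "gauss \<delta> (4 * d) < gauss \<delta> (2 * d)"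
    using assms(2,3) by (simp add: gauss_def power_mult_distrib)
  moreover have "0 < card ?X" by (rule card_PiE_nbh_pos[OF cfg_id]) simp
  ultimately have "0 < real (card {x \<in> ?X. \<exists>w. good {} (\<lambda>_. {}) (\<lambda>x. x) d (length P - 1) w x})"
    by (smt (verit) add_0 card.empty mult_pos_pos of_nat_0_less_iff)
  then have "{x \<in> ?X. \<exists>w. good {} (\<lambda>_. {}) (\<lambda>x. x) d (length P - 1) w x} \<noteq> {}"
    by (metis card.empty less_irrefl of_nat_0)
  then obtain x w where "good {} (\<lambda>_. {}) (\<lambda>x. x) d (length P - 1) w x" by blast
  then show ?thesis by (simp add: good_def proof_depth_eq)
qed

end

section \<open>Choice of the parameters\<close>

lemma exp_half_le: "exp (1 / 2 :: real) \<le> 9 / 5"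
proof -
  have "(exp (1 / 2 :: real))\<^sup>2 = exp 1" by (simp add: power2_eq_square flip: exp_add)
  also have "\<dots> \<le> (9 / 5)\<^sup>2" using exp_le by (simp add: power2_eq_square)
  finally show ?thesis by (rule power2_le_imp_le) simp
qed

context bin_clique_refutation
begin

text \<open>Makes the binary logarithm of the size at least 1, so that additive constants can be
  absorbed into it.\<close>

lemma two_le_size:
  assumes "0 < proof_depth P"
  shows "2 \<le> length P"
proof (rule ccontr)
  assume "\<not> 2 \<le> length P"
  then have one: "length P = 1" using length_pos by linarith
  have "dep 0 = 0"
    using valid[of 0] dep_eq[of 0] one by (cases "P ! 0") auto
  then show False using assms one by (simp add: proof_depth_eq)
qed

theorem depth_size_tradeoff:
  assumes \<delta>: "0 < \<delta>" "\<delta> \<le> 1 / 80"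
  shows "1 / (51200 * \<delta> * sqrt \<delta>) \<le> real (proof_depth P) * sqrt (log 2 (real (proof_size P)))"
proof -
  define L where "L = log 2 (real (length P))"
  let ?D = "real (proof_depth P)"
  define d1 where "d1 = nat \<lfloor>1 / (80 * \<delta>)\<rfloor>"
  have q1: "1 \<le> 1 / (80 * \<delta>)" using \<delta> by (simp add: field_simps)
  then have d1: "0 < d1" "real d1 \<le> 1 / (80 * \<delta>)" "1 / (160 * \<delta>) \<le> real d1"
  proof -
    have f: "1 \<le> \<lfloor>1 / (80 * \<delta>)\<rfloor>" using q1 by simp
    then show "0 < d1" by (simp add: d1_def)
    show "real d1 \<le> 1 / (80 * \<delta>)" using f unfolding d1_def by linarith
    have "1 / (80 * \<delta>) < real d1 + 1" using f by (simp add: d1_def) linarith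
    then have "1 / (80 * \<delta>) < 2 * real d1" using \<open>0 < d1\<close> by linarith
    then show "1 / (160 * \<delta>) \<le> real d1" by simp
  qed
  have "d1 \<le> proof_depth P"
    by (rule depth_ge_walk) (use d1 \<delta> in \<open>auto simp: field_simps\<close>)
  then have D: "1 / (160 * \<delta>) \<le> ?D" "0 < proof_depth P" using d1 by linarith+
  have len: "2 \<le> length P" using two_le_size D by simp
  then have L: "1 \<le> L" unfolding L_def by (subst le_log_iff) auto
  have S: "real (length P) = exp (L * ln 2)"
  proof -
    have "exp (L * ln 2) = exp (ln (real (length P)))" by (simp add: L_def log_def)
    also have "\<dots> = real (length P)" using len by (subst exp_ln) auto
    finally show ?thesis by simp
  qed
  have sq: "sqrt \<delta> > 0" using \<delta> by simp
  have sd: "sqrt \<delta> * sqrt \<delta> = \<delta>" using \<delta> by simp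
  show ?thesis
  proof (cases "102400 * L * \<delta> \<le> 1")
    \<comment> \<open>The size is so large that \<open>sqrt L\<close> is at least
      \<open>1 / (320 * sqrt \<delta>)\<close>; the depth \<open>1 / (160 * \<delta>)\<close> of a
      single walk is then enough, and \<open>160 * 320 = 51200\<close>.\<close>
    case False
    then have "1 \<le> 102400 * L * \<delta>" by simp
    then have "(1 / (320 * sqrt \<delta>))\<^sup>2 \<le> L"
      using \<delta> by (simp add: power_divide power_mult_distrib field_simps)
    then have "1 / (320 * sqrt \<delta>) \<le> sqrt L" by (rule real_le_rsqrt)
    then have "1 / (160 * \<delta>) * (1 / (320 * sqrt \<delta>)) \<le> ?D * sqrt L"
      using D \<delta> by (intro mult_mono) auto
    then show ?thesis by (simp add: L_def proof_size_def)
  next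
    case True
    \<comment> \<open>The length at which the cost \<open>\<delta> * d\<^sup>2\<close> of a walk
      equals \<open>L\<close>: a shorter phase would still pay \<open>L\<close> for the choice of a
      line, a longer one would add more blocks.\<close>
    define r where "r = sqrt (L / \<delta>)"
    have "1 \<le> L / \<delta>" using L \<delta> by (simp add: field_simps)
    then have r: "1 \<le> r" by (simp add: r_def)
    have r2: "r\<^sup>2 * \<delta> = L" using L \<delta> by (simp add: r_def)
    define d where "d = nat \<lceil>r\<rceil>"
    have d: "r \<le> real d" "real d \<le> 2 * r" using r unfolding d_def by linarith+
    have dL: "L \<le> (real d)\<^sup>2 * \<delta>" "(real d)\<^sup>2 * \<delta> \<le> 4 * L"
    proof -
      have "r\<^sup>2 \<le> (real d)\<^sup>2" using d r by (intro power_mono) auto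
      then show "L \<le> (real d)\<^sup>2 * \<delta>" using r2 \<delta> mult_right_mono[of "r\<^sup>2" "(real d)\<^sup>2" \<delta>] by simp
      have "(real d)\<^sup>2 \<le> (2 * r)\<^sup>2" using d r by (intro power_mono) auto
      then have "(real d)\<^sup>2 * \<delta> \<le> (2 * r)\<^sup>2 * \<delta>" using \<delta> by (intro mult_right_mono) auto
      then show "(real d)\<^sup>2 * \<delta> \<le> 4 * L" using r2 by (simp add: power_mult_distrib mult.assoc)
    qed
    have half: "2 * gauss \<delta> (4 * d) \<le> gauss \<delta> (2 * d)"
    proof -
      have "2 \<le> exp (1::real)" using exp_ge_add_one_self[of 1] by simp
      also have "exp (1::real) \<le> exp (72 * ((real d)\<^sup>2 * \<delta>))" using dL L by simp
      finally have "2 * gauss \<delta> (4 * d) \<le> exp (72 * ((real d)\<^sup>2 * \<delta>)) * gauss \<delta> (4 * d)"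
        using gauss_bounds by (intro mult_right_mono) (auto intro: less_imp_le)
      also have "\<dots> = gauss \<delta> (2 * d)"
        unfolding gauss_def by (simp add: power_mult_distrib flip: exp_add)
      finally show ?thesis .
    qed
    \<comment> \<open>With \<open>gauss \<delta> (2 * d) \<ge> exp (- 96 * L)\<close> and
      \<open>(9 / 5) ^ m \<ge> exp (m / 2)\<close>, the counting bound gives
      \<open>m / 2 \<le> 96 * L + (1 + L) * ln 2 \<le> 98 * L\<close>.\<close>
    define M where "M = 196 * L"
    have M: "real m \<le> M" if "(9 / 5) ^ m * gauss \<delta> (2 * d) \<le> 2 * real (length P)" for m
    proof -
      have "gauss \<delta> (2 * d) = exp (- (24 * ((real d)\<^sup>2 * \<delta>)))"
        by (simp add: gauss_def power_mult_distrib)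
      moreover have "- (96 * L) \<le> - (24 * ((real d)\<^sup>2 * \<delta>))" using dL by linarith
      ultimately have g: "exp (- (96 * L)) \<le> gauss \<delta> (2 * d)" by (simp only: exp_le_cancel_iff)
      have "exp (real m / 2) = exp (1 / 2) ^ m" by (simp flip: exp_of_nat_mult)
      also have "\<dots> \<le> (9 / 5) ^ m" using exp_half_le by (intro power_mono) auto
      finally have "exp (real m / 2) * exp (- (96 * L)) \<le> (9 / 5) ^ m * gauss \<delta> (2 * d)"
        using g by (intro mult_mono) auto
      also have "\<dots> \<le> exp (ln 2) * exp (L * ln 2)" using that S by simp
      finally have "exp (real m / 2 + - (96 * L)) \<le> exp (ln 2 + L * ln 2)" by (simp only: exp_add)
      then have "real m / 2 - 96 * L \<le> ln 2 + L * ln 2" by (simp only: exp_le_cancel_iff)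
      moreover have "ln 2 \<le> (1::real)" using ln_2_less_1 by simp
      moreover from this have "L * ln 2 \<le> L * 1" using L by (intro mult_left_mono) auto
      ultimately show ?thesis using L unfolding M_def by linarith
    qed
    \<comment> \<open>As \<open>7840 = 40 * 196\<close>, the blocks of all phases use at most half
      of the budget in \<open>depth_ge_phases\<close>; the other half is for
      \<open>80 * d * \<delta>\<close>.\<close>
    define t where "t = nat \<lfloor>1 / (7840 * L * \<delta>)\<rfloor>"
    have q: "13 \<le> 1 / (7840 * L * \<delta>)" using True L \<delta> by (simp add: field_simps)
    have t: "real t \<le> 1 / (7840 * L * \<delta>)" "1 / (15680 * L * \<delta>) \<le> real t"
    proof -
      show "real t \<le> 1 / (7840 * L * \<delta>)" using q unfolding t_def by linarith
      have "1 / (7840 * L * \<delta>) < real t + 1" using q unfolding t_def by linarith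
      then have "1 / (7840 * L * \<delta>) \<le> 2 * real t" using q by linarith
      then show "1 / (15680 * L * \<delta>) \<le> real t" by simp
    qed
    have tM: "real t * M * \<delta> \<le> 1 / 40"
      using t(1) L \<delta> by (simp add: M_def field_simps)
    have "160 * r * \<delta> \<le> 1 / 2"
    proof -
      have "(320 * r * \<delta>)\<^sup>2 = 102400 * (r\<^sup>2 * \<delta>) * \<delta>" by (simp add: power2_eq_square)
      also have "\<dots> \<le> 1\<^sup>2" using True r2 by simp
      finally have "320 * r * \<delta> \<le> 1" by (rule power2_le_imp_le) simp
      then show ?thesis by simp
    qed
    moreover have "80 * real d * \<delta> \<le> 160 * r * \<delta>" using d \<delta> by simp
    ultimately have dd: "80 * real d * \<delta> \<le> 1 / 2" by linarith
    have "t * d \<le> proof_depth P"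
    proof (rule depth_ge_phases)
      show "20 * (real t * M + 4 * real d) * \<delta> \<le> 1" using tM dd by (simp add: algebra_simps)
      show "4 * (real t * M + M) * \<delta> < 1" using tM True L \<delta> by (simp add: M_def algebra_simps)
      show "0 \<le> M" using L by (simp add: M_def)
    qed (use half M in auto)
    then have "real t * real d \<le> ?D" by (metis of_nat_le_iff of_nat_mult)
    moreover have "1 / (15680 * L * \<delta>) * r \<le> real t * real d"
      using t(2) d r L \<delta> by (intro mult_mono) auto
    ultimately have "1 / (15680 * L * \<delta>) * r \<le> ?D" by linarith
    then have "1 / (15680 * L * \<delta>) * r * sqrt L \<le> ?D * sqrt L"
      using L by (intro mult_right_mono) auto
    moreover have "1 / (15680 * L * \<delta>) * r * sqrt L = 1 / (15680 * \<delta> * sqrt \<delta>)"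
      using L \<delta> by (simp add: r_def real_sqrt_divide field_simps)
    moreover have "1 / (51200 * \<delta> * sqrt \<delta>) \<le> 1 / (15680 * \<delta> * sqrt \<delta>)"
      using \<delta> by (intro divide_left_mono) auto
    ultimately show ?thesis by (simp add: L_def proof_size_def)
  qed
qed

end

section \<open>Soundness\<close>

lemma no_refutation_if_sat:
  assumes sat: "\<And>C. C \<in> F \<Longrightarrow> sat_clause \<alpha> C"
  shows "\<not> is_refutation X F P"
proof
  assume r: "is_refutation X F P"
  have "sat_clause \<alpha> (line (P ! v))" if "v < length P" for v
    using that
  proof (induction v rule: less_induct)
    case (less v)
    have vs: "valid_step F P v (P ! v)" using r less.prems by (simp add: is_refutation_def)
    show ?case
    proof (cases "P ! v")
      case (Ax C)
      then show ?thesis using vs sat by simp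
    next
      case (Weak i C)
      then show ?thesis using vs less by simp
    next
      case (Res i j C)
      then obtain f where f: "i < v" "j < v" "C = (line (P ! i) - {(f, True)}) \<union> (line (P ! j) - {(f, False)})"
        using vs by auto
      have "sat_clause \<alpha> (line (P ! i))" "sat_clause \<alpha> (line (P ! j))" using less f by auto
      then obtain e e' where e: "e \<in> line (P ! i)" "sat_eq \<alpha> e" "e' \<in> line (P ! j)" "sat_eq \<alpha> e'"
        unfolding sat_clause_def by blast
      have "e \<noteq> (f, True) \<or> e' \<noteq> (f, False)" using e by (auto simp: sat_eq_def)
      then have "e \<in> C \<or> e' \<in> C" using e f(3) by blast
      then show ?thesis using e Res unfolding sat_clause_def by auto
    qed
  qed
  then have "sat_clause \<alpha> (line (last P))" using r by (simp add: is_refutation_def last_conv_nth)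
  then show False using r by (simp add: is_refutation_def sat_clause_def)
qed

text \<open>Every block is assigned the string of the number \<open>N\<close>: it is no vertex, and
  it fits into \<open>nbits N\<close> bits as \<open>N\<close> is not a power of 2.\<close>

lemma BinClique_satisfiable:
  assumes "\<And>m. N \<noteq> 2 ^ m" "C \<in> BinClique N E k"
  shows "sat_clause (\<lambda>(i, a). vbit N a) C"
proof -
  have sat: "sat_clause (\<lambda>(i, a). vbit N a) (neq_block N i u)" if u: "u < N" for i u
  proof (rule ccontr)
    assume n: "\<not> ?thesis"
    have "N \<le> 2 ^ nbits N" using u by (intro le_two_power_nbits) simp
    then have "N < 2 ^ nbits N" using assms(1)[of "nbits N"] by simp
    then have "u = N"
      using falsify_neq_block[OF n] u by (intro vbit_inj[of _ "nbits N"]) auto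
    then show False using u by simp
  qed
  show ?thesis using assms(2) sat unfolding BinClique_def by (auto simp: sat_clause_Un)
qed

lemma all_refs_bound_of_degree:
  assumes n: "2 \<le> n" and \<delta>: "0 < \<delta>" "\<delta> \<le> 1 / 80"
    and deg: "\<And>i j u. i < k \<Longrightarrow> j < k \<Longrightarrow> i \<noteq> j \<Longrightarrow> u < n \<Longrightarrow>
      real (card {v. v < n \<and> {i * n + u, j * n + v} \<notin> E}) \<le> \<delta> * real n"
  shows "all_refs_bound n k E (1 / (51200 * \<delta> * sqrt \<delta>))"
  unfolding all_refs_bound_def
proof (intro allI impI)
  fix P assume P: "is_refutation (bc_vars (k * n) k) (BinClique (k * n) E k) P"
  obtain m where "k * n = 2 ^ m"
  proof (rule ccontr)
    assume "\<not> thesis"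
    then have "k * n \<noteq> 2 ^ m" for m using that by blast
    then have "\<not> is_refutation X (BinClique (k * n) E k) P" for X
      by (intro no_refutation_if_sat[OF BinClique_satisfiable])
    then show False using P by blast
  qed
  then have "n dvd 2 ^ m" by (metis dvd_triv_right)
  then obtain l where l: "n = 2 ^ l" using divides_primepow_nat[of 2 n m] by auto
  interpret bin_clique_refutation k l n E \<delta> P
  proof
    show "0 < l" using l n by (cases l) auto
  qed (use l P deg \<delta> in auto)
  show "1 / (51200 * \<delta> * sqrt \<delta>) \<le> real (proof_depth P) * sqrt (log 2 (real (proof_size P)))"
    by (rule depth_size_tradeoff[OF \<delta>])
qed

lemma all_refs_bound_mono: "all_refs_bound n k E b \<Longrightarrow> b' \<le> b \<Longrightarrow> all_refs_bound n k E b'"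
  unfolding all_refs_bound_def by force

section \<open>Degrees in the random graph\<close>

definition weight :: "'a set \<Rightarrow> real \<Rightarrow> 'a set \<Rightarrow> real" where
  "weight C p E = p ^ card E * (1 - p) ^ (card C - card E)"

lemma finite_cross_pairs: "finite (cross_pairs n k)"
proof (rule finite_subset)
  show "cross_pairs n k \<subseteq> Pow {..<k * n}" by (auto simp: cross_pairs_def)
qed simp

lemma prob_G_eq: "prob_G n p k Q = (\<Sum>E | E \<subseteq> cross_pairs n k \<and> Q E. weight (cross_pairs n k) p E)"
proof -
  have "(\<Sum>E\<in>Pow (cross_pairs n k). if Q E then weight (cross_pairs n k) p E else 0) =
      (\<Sum>E\<in>Pow (cross_pairs n k) \<inter> Collect Q. weight (cross_pairs n k) p E)"
    using sum.inter_restrict[of "Pow (cross_pairs n k)" "weight (cross_pairs n k) p" "Collect Q"]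
      finite_cross_pairs by simp
  also have "Pow (cross_pairs n k) \<inter> Collect Q = {E. E \<subseteq> cross_pairs n k \<and> Q E}" by auto
  finally show ?thesis unfolding prob_G_def by (simp only: weight_def)
qed

text \<open>The exponential moment of the number of missing edges in \<open>T\<close>. By
  independence it is a product over \<open>C\<close>, with factor \<open>p + (1 - p) * 2\<close> on
  \<open>T\<close> and 1 elsewhere; \<open>T = {}\<close> gives total probability 1.\<close>

lemma weight_moment:
  assumes "finite C" "T \<subseteq> C"
  shows "(\<Sum>E\<in>Pow C. weight C p E * 2 ^ card (T - E)) = (2 - p) ^ card T"
proof -
  let ?g = "\<lambda>e. (1 - p) * (if e \<in> T then 2 else 1)"
  have "weight C p E * 2 ^ card (T - E) = (\<Prod>e\<in>E. p) * (\<Prod>e\<in>C - E. ?g e)" if "E \<in> Pow C" for E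
  proof -
    have E: "E \<subseteq> C" "finite E" using that assms finite_subset by auto
    have "(\<Prod>e\<in>C - E. if e \<in> T then 2 else (1::real)) = (\<Prod>e\<in>(C - E) \<inter> T. 2)"
      by (rule prod.inter_restrict[symmetric]) (use assms in auto)
    also have "(C - E) \<inter> T = T - E" using assms by auto
    finally show ?thesis
      using E assms by (simp add: weight_def prod.distrib card_Diff_subset)
  qed
  then have "(\<Sum>E\<in>Pow C. weight C p E * 2 ^ card (T - E)) = (\<Sum>E\<in>Pow C. (\<Prod>e\<in>E. p) * (\<Prod>e\<in>C - E. ?g e))"
    by (rule sum.cong[OF refl])
  also have "\<dots> = (\<Prod>e\<in>C. p + ?g e)" by (rule prod_add[OF assms(1), symmetric])
  also have "\<dots> = (\<Prod>e\<in>C. if e \<in> T then 2 - p else 1)" by (rule prod.cong) auto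
  also have "\<dots> = (\<Prod>e\<in>C \<inter> T. 2 - p)" by (rule prod.inter_restrict[symmetric, OF assms(1)])
  also have "C \<inter> T = T" using assms by auto
  finally show ?thesis by simp
qed

context
  fixes n k :: nat and p :: real
  assumes p: "0 \<le> p" "p \<le> 1"
begin

lemma weight_nonneg: "0 \<le> weight C p E"
  using p by (simp add: weight_def)

lemma prob_G_mono: "(\<And>E. Q E \<Longrightarrow> Q' E) \<Longrightarrow> prob_G n p k Q \<le> prob_G n p k Q'"
  unfolding prob_G_eq using finite_cross_pairs[of n k] weight_nonneg
  by (intro sum_mono2) auto

lemma prob_G_compl: "prob_G n p k Q + prob_G n p k (\<lambda>E. \<not> Q E) = 1"
proof -
  let ?C = "cross_pairs n k"
  have "prob_G n p k Q + prob_G n p k (\<lambda>E. \<not> Q E) = (\<Sum>E\<in>{E. E \<subseteq> ?C \<and> Q E} \<union> {E. E \<subseteq> ?C \<and> \<not> Q E}. weight ?C p E)"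
    unfolding prob_G_eq using finite_cross_pairs[of n k] by (intro sum.union_disjoint[symmetric]) auto
  also have "{E. E \<subseteq> ?C \<and> Q E} \<union> {E. E \<subseteq> ?C \<and> \<not> Q E} = Pow ?C" by auto
  finally show ?thesis using weight_moment[OF finite_cross_pairs, of "{}" n k p] by simp
qed

lemma prob_G_nonneg: "0 \<le> prob_G n p k Q"
  unfolding prob_G_eq by (intro sum_nonneg weight_nonneg)

lemma prob_G_union:
  assumes "finite I"
  shows "prob_G n p k (\<lambda>E. \<exists>i\<in>I. Q i E) \<le> (\<Sum>i\<in>I. prob_G n p k (Q i))"
  using assms
proof (induction I rule: finite_induct)
  case empty
  then show ?case by (simp add: prob_G_def)
next
  case (insert i I)
  have "prob_G n p k (\<lambda>E. \<exists>i\<in>insert i I. Q i E) \<le> prob_G n p k (Q i) + prob_G n p k (\<lambda>E. \<exists>i\<in>I. Q i E)"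
    unfolding prob_G_def sum.distrib[symmetric]
    by (rule sum_mono) (use p in auto)
  then show ?case using insert by simp
qed

text \<open>Chernoff's method with base 2: Markov's inequality for the moment
  \<open>(2 - p) ^ card T\<close>, bounded by \<open>2 - p \<le> exp (1 - p)\<close>.\<close>

lemma prob_G_tail:
  assumes T: "T \<subseteq> cross_pairs n k"
  shows "prob_G n p k (\<lambda>E. x < real (card (T - E))) \<le> exp ((1 - p) * real (card T)) / 2 powr x"
proof -
  let ?C = "cross_pairs n k"
  have "2 powr x * prob_G n p k (\<lambda>E. x < real (card (T - E))) =
      (\<Sum>E | E \<subseteq> ?C \<and> x < real (card (T - E)). weight ?C p E * 2 powr x)"
    by (simp add: prob_G_eq sum_distrib_left mult.commute)
  also have "\<dots> \<le> (\<Sum>E | E \<subseteq> ?C \<and> x < real (card (T - E)). weight ?C p E * 2 ^ card (T - E))"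
  proof (rule sum_mono)
    fix E assume "E \<in> {E. E \<subseteq> ?C \<and> x < real (card (T - E))}"
    then have "2 powr x \<le> 2 powr real (card (T - E))" by (intro powr_mono) auto
    then show "weight ?C p E * 2 powr x \<le> weight ?C p E * 2 ^ card (T - E)"
      using weight_nonneg by (intro mult_left_mono) (auto simp: powr_realpow)
  qed
  also have "\<dots> \<le> (\<Sum>E\<in>Pow ?C. weight ?C p E * 2 ^ card (T - E))"
    using finite_cross_pairs[of n k] weight_nonneg by (intro sum_mono2 mult_nonneg_nonneg) auto
  also have "\<dots> = (2 - p) ^ card T" by (rule weight_moment[OF finite_cross_pairs T])
  also have "\<dots> \<le> exp (1 - p) ^ card T"
    using p exp_ge_add_one_self[of "1 - p"] by (intro power_mono) auto
  also have "\<dots> = exp ((1 - p) * real (card T))" by (simp add: mult.commute flip: exp_of_nat_mult)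
  finally show ?thesis by (simp add: field_simps)
qed

text \<open>\<open>x\<close> bounds the expected number of non-neighbours of a vertex in one block.
  Exceeding \<open>4 * x\<close> has probability at most
  \<open>exp (x - 4 * x * ln 2) \<le> exp (- x)\<close>, as \<open>ln 2\<close> is at least
  \<open>1 / 2\<close>; then a union bound over block pairs and vertices.\<close>

lemma prob_G_degree:
  assumes q: "1 - p \<le> q" and x: "x = q * real n"
  shows "1 - real (k * k * n) * exp (- x) \<le> prob_G n p k (\<lambda>E. \<forall>i<k. \<forall>j<k. \<forall>u<n. i \<noteq> j \<longrightarrow>
    real (card {v. v < n \<and> {i * n + u, j * n + v} \<notin> E}) \<le> 4 * x)"
proof -
  let ?I = "{..<k} \<times> {..<k} \<times> {..<n}"
  let ?B = "\<lambda>(i, j, u) E. i \<noteq> j \<and> 4 * x < real (card {v. v < n \<and> {i * n + u, j * n + v} \<notin> E})"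
  have x0: "0 \<le> x" using p q x by simp
  have bad: "prob_G n p k (?B (i, j, u)) \<le> exp (- x)" if I: "(i, j, u) \<in> ?I" for i j u
  proof (cases "i = j")
    case True
    then show ?thesis by (simp add: prob_G_def)
  next
    case False
    let ?e = "\<lambda>v. {i * n + u, j * n + v}"
    have dv: "(i * n + u) div n = i" "v < n \<Longrightarrow> (j * n + v) div n = j" for v
      using I by auto
    have bd: "i' * n + u' < k * n" if "i' < k" "u' < n" for i' u'
    proof -
      have "i' * n + u' < (i' + 1) * n" using that by simp
      also have "\<dots> \<le> k * n" using that by (intro mult_right_mono) auto
      finally show ?thesis .
    qed
    have T: "?e ` {..<n} \<subseteq> cross_pairs n k"
    proof
      fix e assume "e \<in> ?e ` {..<n}"
      then obtain v where v: "v < n" "e = ?e v" by auto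
      show "e \<in> cross_pairs n k"
        unfolding cross_pairs_def mem_Collect_eq v(2)
        using False I dv(1) dv(2)[OF v(1)] v(1)
        by (intro exI[of _ "i * n + u"] exI[of _ "j * n + v"] conjI refl bd) auto
    qed
    have inj: "inj_on ?e {..<n}"
    proof (rule inj_onI)
      fix v v' assume v: "v \<in> {..<n}" "v' \<in> {..<n}" "?e v = ?e v'"
      have "i * n + u \<noteq> j * n + v'" using dv(1) dv(2)[of v'] v(2) False by (metis lessThan_iff)
      then show "v = v'" using v(3) by (auto simp: doubleton_eq_iff)
    qed
    have card: "card {v. v < n \<and> ?e v \<notin> E} = card (?e ` {..<n} - E)" for E
    proof -
      have "?e ` {..<n} - E = ?e ` {v. v < n \<and> ?e v \<notin> E}" by auto
      moreover have "inj_on ?e {v. v < n \<and> ?e v \<notin> E}" by (rule inj_on_subset[OF inj]) auto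
      ultimately show ?thesis by (simp add: card_image)
    qed
    have "prob_G n p k (?B (i, j, u)) = prob_G n p k (\<lambda>E. 4 * x < real (card (?e ` {..<n} - E)))"
      using False card by simp
    also have "\<dots> \<le> exp ((1 - p) * real (card (?e ` {..<n}))) / 2 powr (4 * x)"
      by (rule prob_G_tail[OF T])
    also have "card (?e ` {..<n}) = n" using card_image[OF inj] by simp
    also have "exp ((1 - p) * real n) / 2 powr (4 * x) = exp ((1 - p) * real n) * exp (- (4 * x * ln 2))"
      by (simp add: powr_def exp_minus field_simps)
    also have "\<dots> = exp ((1 - p) * real n - 4 * x * ln 2)" by (simp flip: exp_add)
    also have "\<dots> \<le> exp (- x)"
    proof -
      have "(1 - p) * real n \<le> x" unfolding x by (intro mult_right_mono q) simp
      moreover have "exp (1 / 2 :: real) \<le> 2" using exp_half_le by simp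
      then have "1 / 2 \<le> ln (2::real)" using ln_ge_iff[of "2::real" "1 / 2"] by linarith
      then have "4 * x * (1 / 2) \<le> 4 * x * ln 2" using x0 by (intro mult_left_mono) auto
      ultimately show ?thesis by simp
    qed
    finally show ?thesis .
  qed
  have "prob_G n p k (\<lambda>E. \<exists>t\<in>?I. ?B t E) \<le> (\<Sum>t\<in>?I. prob_G n p k (?B t))"
    by (rule prob_G_union) simp
  also have "\<dots> \<le> (\<Sum>t\<in>?I. exp (- x))" by (rule sum_mono) (use bad in auto)
  also have "\<dots> = real (k * k * n) * exp (- x)" by (simp add: card_cartesian_product)
  finally have "1 - real (k * k * n) * exp (- x) \<le> prob_G n p k (\<lambda>E. \<not> (\<exists>t\<in>?I. ?B t E))"
    using prob_G_compl[of "\<lambda>E. \<exists>t\<in>?I. ?B t E"] by linarith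
  also have "\<dots> \<le> prob_G n p k (\<lambda>E. \<forall>i<k. \<forall>j<k. \<forall>u<n. i \<noteq> j \<longrightarrow>
    real (card {v. v < n \<and> {i * n + u, j * n + v} \<notin> E}) \<le> 4 * x)"
    by (rule prob_G_mono) force
  finally show ?thesis .
qed

end

section \<open>The lower bound\<close>

text \<open>Eventually \<open>g n < s / 2\<close>, so \<open>k n\<close> is at most
  \<open>exp (n powr (s / 2))\<close>, whose square is still dominated by
  \<open>exp (n powr s)\<close>.\<close>

lemma union_bound_tendsto_0:
  fixes k :: "nat \<Rightarrow> nat"
  assumes s: "0 < s"
    and g: "g \<longlonglongrightarrow> 0" "\<forall>\<^sub>F n in sequentially. real (k n) < exp (real n powr g n)"
  shows "(\<lambda>n. real (k n * k n * n) * exp (- (real n powr s))) \<longlonglongrightarrow> 0"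
proof (rule tendsto_sandwich)
  show "(\<lambda>n::nat. 0::real) \<longlonglongrightarrow> 0" by simp
  show "\<forall>\<^sub>F n in sequentially. 0 \<le> real (k n * k n * n) * exp (- (real n powr s))" by simp
  have "\<forall>\<^sub>F n in sequentially. g n < s / 2"
    using g(1) s by (intro order_tendstoD) auto
  then show "\<forall>\<^sub>F n in sequentially. real (k n * k n * n) * exp (- (real n powr s)) \<le>
      exp (real n powr (s / 2)) * exp (real n powr (s / 2)) * real n * exp (- (real n powr s))"
    using g(2) eventually_ge_at_top[of 1]
  proof eventually_elim
    case (elim n)
    have "real n powr g n \<le> real n powr (s / 2)" using elim by (intro powr_mono) auto
    then have "exp (real n powr g n) \<le> exp (real n powr (s / 2))" by simp
    then have "real (k n) \<le> exp (real n powr (s / 2))" using elim by linarith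
    then have "real (k n) * real (k n) \<le> exp (real n powr (s / 2)) * exp (real n powr (s / 2))"
      by (intro mult_mono) auto
    then show ?case by (simp add: mult_right_mono)
  qed
  show "(\<lambda>n. exp (real n powr (s / 2)) * exp (real n powr (s / 2)) * real n * exp (- (real n powr s)))
      \<longlonglongrightarrow> 0"
    using s by real_asymp
qed

lemma aasI:
  assumes p: "\<forall>\<^sub>F n in sequentially. 0 \<le> p n \<and> p n \<le> 1"
    and Q: "\<forall>\<^sub>F n in sequentially. 1 - r n \<le> prob_G n (p n) (k n) (Q n)" and r: "r \<longlonglongrightarrow> 0"
  shows "aas p k Q"
  unfolding aas_def
proof (rule tendsto_sandwich[OF Q])
  show "\<forall>\<^sub>F n in sequentially. prob_G n (p n) (k n) (Q n) \<le> 1"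
    using p
  proof eventually_elim
    case (elim n)
    then show ?case
      using prob_G_compl[of "p n" n "k n" "Q n"] prob_G_nonneg[of "p n" n "k n" "\<lambda>E. \<not> Q n E"] by simp
  qed
  show "(\<lambda>n. 1 - r n) \<longlonglongrightarrow> 1" using tendsto_diff[OF tendsto_const r, of 1] by simp
qed simp

text \<open>With \<open>\<gamma> < 1\<close> the bound \<open>n powr (1 - \<gamma>)\<close> on the
  expected number of non-neighbours tends to infinity polynomially, so its tail beats the number of
  vertices and blocks.\<close>

lemma aas_all_refs_bound:
  assumes \<gamma>: "0 < \<gamma>" "\<gamma> < 1"
    and p: "\<forall>\<^sub>F n in sequentially. 1 - real n powr (- \<gamma>) \<le> p n \<and> p n \<le> 1"
    and g: "g \<longlonglongrightarrow> 0" "\<forall>\<^sub>F n in sequentially. real (k n) < exp (real n powr g n)"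
    and b: "\<forall>\<^sub>F n in sequentially. b n \<le> 1 / 409600 * real n powr (3 * \<gamma> / 2)"
  shows "aas p k (\<lambda>n E. all_refs_bound n (k n) E (b n))"
proof (rule aasI)
  have "\<forall>\<^sub>F n::nat in sequentially. real n powr (- \<gamma>) \<le> 1 / 320"
    using \<gamma> by real_asymp
  note ev = this p b eventually_ge_at_top[of 2]
  show p01: "\<forall>\<^sub>F n in sequentially. 0 \<le> p n \<and> p n \<le> 1"
    using ev by eventually_elim auto
  show "(\<lambda>n. real (k n * k n * n) * exp (- (real n powr (1 - \<gamma>)))) \<longlonglongrightarrow> 0"
    using \<gamma> by (intro union_bound_tendsto_0[OF _ g]) simp
  show "\<forall>\<^sub>F n in sequentially. 1 - real (k n * k n * n) * exp (- (real n powr (1 - \<gamma>))) \<le>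
      prob_G n (p n) (k n) (\<lambda>E. all_refs_bound n (k n) E (b n))"
    using ev p01
  proof eventually_elim
    case (elim n)
    define q where "q = real n powr (- \<gamma>)"
    have q: "0 < q" "4 * q \<le> 1 / 80" using elim by (auto simp: q_def)
    have x: "real n powr (1 - \<gamma>) = q * real n"
      using elim by (simp add: q_def powr_diff powr_minus field_simps)
    have "sqrt q = real n powr (- (\<gamma> / 2))"
      using elim by (simp add: q_def powr_half_sqrt[symmetric] powr_powr)
    then have "q * sqrt q = real n powr (- (3 * \<gamma> / 2))"
      by (simp add: q_def flip: powr_add)
    then have "1 / (q * sqrt q) = real n powr (3 * \<gamma> / 2)" by (simp add: powr_minus field_simps)
    \<comment> \<open>The tradeoff is used with \<open>\<delta> = 4 * q\<close>, and
      \<open>51200 * 4 * sqrt 4 = 409600\<close>.\<close>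
    moreover have "1 / (51200 * (4 * q) * sqrt (4 * q)) = 1 / 409600 * (1 / (q * sqrt q))"
      by (simp add: real_sqrt_mult)
    ultimately have bn: "b n \<le> 1 / (51200 * (4 * q) * sqrt (4 * q))"
      using elim(3) by (simp only:)
    have "1 - real (k n * k n * n) * exp (- (real n powr (1 - \<gamma>))) \<le>
      prob_G n (p n) (k n) (\<lambda>E. \<forall>i<k n. \<forall>j<k n. \<forall>u<n. i \<noteq> j \<longrightarrow>
        real (card {v. v < n \<and> {i * n + u, j * n + v} \<notin> E}) \<le> 4 * (real n powr (1 - \<gamma>)))"
      by (rule prob_G_degree[OF _ _ _ x]) (use elim in \<open>auto simp: q_def\<close>)
    also have "\<dots> \<le> prob_G n (p n) (k n) (\<lambda>E. all_refs_bound n (k n) E (b n))"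
    proof (rule prob_G_mono)
      fix E assume E: "\<forall>i<k n. \<forall>j<k n. \<forall>u<n. i \<noteq> j \<longrightarrow>
        real (card {v. v < n \<and> {i * n + u, j * n + v} \<notin> E}) \<le> 4 * (real n powr (1 - \<gamma>))"
      have "real (card {v. v < n \<and> {i * n + u, j * n + v} \<notin> E}) \<le> 4 * q * real n"
        if "i < k n" "j < k n" "i \<noteq> j" "u < n" for i j u
        using E[rule_format, OF that(1,2,4,3)] x by simp
      then have "all_refs_bound n (k n) E (1 / (51200 * (4 * q) * sqrt (4 * q)))"
        by (intro all_refs_bound_of_degree) (use q elim in auto)
      then show "all_refs_bound n (k n) E (b n)" using bn by (rule all_refs_bound_mono)
    qed (use elim in auto)
    finally show ?case .
  qed
qed

theorem theorem5p1:
  fixes \<gamma> :: real and p :: "nat \<Rightarrow> real" and k :: "nat \<Rightarrow> nat"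
  assumes gamma_pos: "\<gamma> > 0"
    and p_range: "\<forall>n\<ge>1. 1 - real n powr (- \<gamma>) \<le> p n \<and> p n \<le> 1"
    and k_bound: "\<exists>g :: nat \<Rightarrow> real. g \<longlonglongrightarrow> 0 \<and>
                    (\<forall>\<^sub>F n in sequentially. real (k n) < exp (real n powr g n))"
  shows "(\<gamma> < 1/2 \<longrightarrow>
            (\<exists>c>0. aas p k (\<lambda>n E. all_refs_bound n (k n) E (c * real n powr (3 * \<gamma> / 2)))))
       \<and> (1/2 \<le> \<gamma> \<and> \<gamma> < 1 \<longrightarrow>
            (\<exists>c>0. aas p k (\<lambda>n E. all_refs_bound n (k n) E
                 (c * real n powr ((1 + \<gamma>) / 2) / sqrt (log 2 (real (k n * n)))))))
       \<and> (1 \<le> \<gamma> \<longrightarrow>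
            (\<forall>\<epsilon>>0. \<exists>c>0. aas p k (\<lambda>n E. all_refs_bound n (k n) E (c * real n powr (1 - \<epsilon>)))))"
proof -
  obtain g where g: "g \<longlonglongrightarrow> 0" "\<forall>\<^sub>F n in sequentially. real (k n) < exp (real n powr g n)"
    using k_bound by blast
  have ev: "\<forall>\<^sub>F n in sequentially. 1 - real n powr (- \<gamma>) \<le> p n \<and> p n \<le> 1"
    using p_range eventually_sequentially by blast
  let ?c = "1 / 409600 :: real"
  have "aas p k (\<lambda>n E. all_refs_bound n (k n) E (?c * real n powr (3 * \<gamma> / 2)))" if "\<gamma> < 1 / 2"
    by (rule aas_all_refs_bound[OF gamma_pos _ ev g]) (use that in auto)
  moreover have "aas p k (\<lambda>n E. all_refs_bound n (k n) E
      (?c * real n powr ((1 + \<gamma>) / 2) / sqrt (log 2 (real (k n * n)))))" if \<gamma>: "1 / 2 \<le> \<gamma>" "\<gamma> < 1"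
  proof (rule aas_all_refs_bound[OF gamma_pos \<gamma>(2) ev g])
    \<comment> \<open>For \<open>\<gamma> \<ge> 1 / 2\<close> the exponent
      \<open>(1 + \<gamma>) / 2\<close> is at most \<open>3 * \<gamma> / 2\<close>, so the middle
      case is contained in the general bound.\<close>
    show "\<forall>\<^sub>F n in sequentially. ?c * real n powr ((1 + \<gamma>) / 2) / sqrt (log 2 (real (k n * n)))
        \<le> ?c * real n powr (3 * \<gamma> / 2)"
      using eventually_ge_at_top[of 2]
    proof eventually_elim
      case (elim n)
      show ?case
      \<comment> \<open>For \<open>k n = 0\<close> the logarithm is 0 by convention, and so is the
        quotient by its square root.\<close>
      proof (cases "k n = 0")
        case False
        then have "2 \<le> k n * n" using elim mult_le_mono[of 1 "k n" 2 n] by simp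
        then have "2 \<le> real (k n * n)" by (simp del: of_nat_mult)
        then have "log 2 2 \<le> log 2 (real (k n * n))" by (subst log_le_cancel_iff) auto
        then have "1 \<le> sqrt (log 2 (real (k n * n)))" by simp
        then have "?c * real n powr ((1 + \<gamma>) / 2) / sqrt (log 2 (real (k n * n))) \<le>
            ?c * real n powr ((1 + \<gamma>) / 2) / 1"
          by (intro divide_left_mono) auto
        also have "\<dots> \<le> ?c * real n powr (3 * \<gamma> / 2)"
          using elim \<gamma> by (auto intro!: powr_mono)
        finally show ?thesis .
      qed (simp add: log_def)
    qed
  qed
  moreover have "aas p k (\<lambda>n E. all_refs_bound n (k n) E (?c * real n powr (1 - \<epsilon>)))"
    if \<gamma>: "1 \<le> \<gamma>" "0 < \<epsilon>" for \<epsilon>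
  \<comment> \<open>A larger \<open>\<gamma>\<close> only narrows the range of \<open>p\<close>, so
    the bound for \<open>2 / 3\<close> applies; its exponent \<open>3 * (2 / 3) / 2\<close> is
    1.\<close>
  proof (rule aas_all_refs_bound[OF _ _ _ g, of "2 / 3"])
    show "\<forall>\<^sub>F n in sequentially. 1 - real n powr (- (2 / 3)) \<le> p n \<and> p n \<le> 1"
      using ev eventually_ge_at_top[of 1]
    proof eventually_elim
      case (elim n)
      then have "real n powr (- \<gamma>) \<le> real n powr (- (2 / 3))" using \<gamma> by (intro powr_mono) auto
      then show ?case using elim by linarith
    qed
    show "\<forall>\<^sub>F n in sequentially. ?c * real n powr (1 - \<epsilon>) \<le> ?c * real n powr (3 * (2 / 3) / 2)"
      using eventually_ge_at_top[of 1]
    proof eventually_elim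
      case (elim n)
      have "real n powr (1 - \<epsilon>) \<le> real n powr 1" using elim \<gamma> by (intro powr_mono) auto
      then show ?case by simp
    qed
  qed auto
  moreover have "0 < ?c" by simp
  ultimately show ?thesis by blast
qed

end
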